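(* Let $\Phi:M\rightarrow\mathbb{S}^2\times\mathbb{S}^2$ be an orientable hypersurface with three different constant principal curvatures. (1) If the scalar curvature $\rho$ of $M$ satisfies $2\rho\neq 1$ and the Gauss-Kronecker curvature is $K=0$, then $C^2<1$ on $M$. (2) If $p_0\in M$ is a critical point of the function $C$, then either $C^2(p_0)=1$ or $C(p_0)=0$. Moreover, in the second case, the Gauss-Kronecker curvature is $K=0$ and the scalar curvature is $\rho=1$.
   Context: $\mathbb{S}^2$ is the unit 2-sphere and $\mathbb{S}^2\times\mathbb{S}^2$ carries the product metric $\langle\cdot,\cdot\rangle$. The product structure $P$ is the endomorphism of the tangent bundle given by $P(v_1,v_2)=(v_1,-v_2)$. A hypersurface $\Phi:M\to\mathbb{S}^2\times\mathbb{S}^2$ is a smooth immersion of a 3-manifold $M$ with the induced metric. With $N$ a unit normal field, $A$ the associated shape operator: $C=\langle PN,N\rangle:M\to[-1,1]$, the principal curvatures are the eigenvalues of $A$, $K=\det A$ is the Gauss-Kronecker curvature, and $\rho$ is the scalar curvature (trace of the Ricci tensor) of $M$; by the Gauss equation $\rho=2+9H^2-|\sigma|^2$ with $3H=\mathrm{tr}\,A$ and $|\sigma|^2=\mathrm{tr}\,A^2$. *)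

theory Defs
  imports "HOL-Analysis.Analysis"
begin

section \<open>Smooth functions on open sets\<close>

text \<open>These notions are used only for open \<open>S\<close>, where \<^term>\<open>at x\<close> sees only points of \<open>S\<close>.\<close>

fun C_on :: "nat \<Rightarrow> 'a::real_normed_vector set \<Rightarrow> ('a \<Rightarrow> 'b::real_normed_vector) \<Rightarrow> bool" where
  "C_on 0 S f \<longleftrightarrow> continuous_on S f"
| "C_on (Suc n) S f \<longleftrightarrow>
     (\<forall>x\<in>S. f differentiable (at x)) \<and> (\<forall>v. C_on n S (\<lambda>x. frechet_derivative f (at x) v))"

definition smooth_on :: "'a::real_normed_vector set \<Rightarrow> ('a \<Rightarrow> 'b::real_normed_vector) \<Rightarrow> bool" where
  "smooth_on S f \<longleftrightarrow> (\<forall>n. C_on n S f)"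


section \<open>Smooth manifolds\<close>

text \<open>A chart is a pair \<open>(U, \<phi>)\<close> of a domain and a coordinate map, the latter being relevant
  only on \<open>U\<close>.\<close>

type_synonym ('m, 'n) chart = "'m set \<times> ('m \<Rightarrow> real ^ 'n)"

definition in_chart :: "('m, 'n) chart \<Rightarrow> ('m \<Rightarrow> 'b) \<Rightarrow> (real ^ 'n \<Rightarrow> 'b)" where
  "in_chart c f = f \<circ> inv_into (fst c) (snd c)"

definition smooth_manifold :: "'m topology \<Rightarrow> ('m, 'n::finite) chart set \<Rightarrow> bool" where
  "smooth_manifold M \<A> \<longleftrightarrow>
     Hausdorff_space M \<and> second_countable M \<and>
     (\<Union>c\<in>\<A>. fst c) = topspace M \<and>
     (\<forall>(U, \<phi>)\<in>\<A>. openin M U \<and> open (\<phi> ` U) \<and>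
        homeomorphic_map (subtopology M U) (top_of_set (\<phi> ` U)) \<phi>) \<and>
     (\<forall>c\<in>\<A>. \<forall>d\<in>\<A>. smooth_on (snd c ` (fst c \<inter> fst d)) (in_chart c (snd d)))"

text \<open>\<open>\<B>\<close> is an oriented atlas defining the same smooth structure as \<open>\<A>\<close>.\<close>

definition orientable :: "'m topology \<Rightarrow> ('m, 'n::finite) chart set \<Rightarrow> bool" where
  "orientable M \<A> \<longleftrightarrow>
     (\<exists>\<B>. smooth_manifold M \<B> \<and> smooth_manifold M (\<A> \<union> \<B>) \<and>
        (\<forall>c\<in>\<B>. \<forall>d\<in>\<B>. \<forall>p \<in> fst c \<inter> fst d.
           det (matrix (frechet_derivative (in_chart c (snd d)) (at (snd c p)))) > 0))"

definition smooth_map :: "('m, 'n::finite) chart set \<Rightarrow> ('m \<Rightarrow> 'b::real_normed_vector) \<Rightarrow> bool" where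
  "smooth_map \<A> f \<longleftrightarrow> (\<forall>c\<in>\<A>. smooth_on (snd c ` fst c) (in_chart c f))"

text \<open>A tangent vector at \<open>p\<close> is represented by its components with respect to the chart
  \<open>chart_at \<A> p\<close>. The pointwise notions built on this below (critical point, immersion, unit
  normal, principal curvatures, determinant of the shape operator, scalar curvature) do not
  depend on the chart chosen.\<close>

definition chart_at :: "('m, 'n::finite) chart set \<Rightarrow> 'm \<Rightarrow> ('m, 'n) chart" where
  "chart_at \<A> p = (SOME c. c \<in> \<A> \<and> p \<in> fst c)"

definition differential ::
    "('m, 'n::finite) chart set \<Rightarrow> ('m \<Rightarrow> 'b::real_normed_vector) \<Rightarrow> 'm \<Rightarrow> real ^ 'n \<Rightarrow> 'b" where
  "differential \<A> f p =
     (let c = chart_at \<A> p in frechet_derivative (in_chart c f) (at (snd c p)))"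

definition critical_point :: "('m, 'n::finite) chart set \<Rightarrow> ('m \<Rightarrow> real) \<Rightarrow> 'm \<Rightarrow> bool" where
  "critical_point \<A> f p \<longleftrightarrow> (\<forall>u. differential \<A> f p u = 0)"


section \<open>Scalar curvature of a Riemannian metric in coordinates\<close>

definition partial :: "'n::finite \<Rightarrow> (real ^ 'n \<Rightarrow> real) \<Rightarrow> real ^ 'n \<Rightarrow> real" where
  "partial i f x = frechet_derivative f (at x) (axis i 1)"

definition christoffel ::
    "(real ^ 'n::finite \<Rightarrow> real ^ 'n ^ 'n) \<Rightarrow> 'n \<Rightarrow> 'n \<Rightarrow> 'n \<Rightarrow> real ^ 'n \<Rightarrow> real" where
  "christoffel g k i j x =
     1/2 * (\<Sum>l\<in>UNIV. matrix_inv (g x) $ k $ l *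
        (partial i (\<lambda>y. g y $ j $ l) x + partial j (\<lambda>y. g y $ i $ l) x
          - partial l (\<lambda>y. g y $ i $ j) x))"

text \<open>The \<open>l\<close>-th component of \<open>R(\<partial>\<^sub>i, \<partial>\<^sub>j)\<partial>\<^sub>k\<close>, where
  \<open>R(X, Y)Z = \<nabla>\<^sub>X\<nabla>\<^sub>YZ - \<nabla>\<^sub>Y\<nabla>\<^sub>XZ - \<nabla>\<^sub>[\<^sub>X\<^sub>,\<^sub>Y\<^sub>]Z\<close>.\<close>

definition riemann ::
    "(real ^ 'n::finite \<Rightarrow> real ^ 'n ^ 'n) \<Rightarrow> 'n \<Rightarrow> 'n \<Rightarrow> 'n \<Rightarrow> 'n \<Rightarrow> real ^ 'n \<Rightarrow> real" where
  "riemann g l i j k x =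
     partial i (christoffel g l j k) x - partial j (christoffel g l i k) x
     + (\<Sum>m\<in>UNIV. christoffel g m j k x * christoffel g l i m x
                  - christoffel g m i k x * christoffel g l j m x)"

definition ricci :: "(real ^ 'n::finite \<Rightarrow> real ^ 'n ^ 'n) \<Rightarrow> 'n \<Rightarrow> 'n \<Rightarrow> real ^ 'n \<Rightarrow> real" where
  "ricci g j k x = (\<Sum>i\<in>UNIV. riemann g i i j k x)"

definition scalar_curvature_coord ::
    "(real ^ 'n::finite \<Rightarrow> real ^ 'n ^ 'n) \<Rightarrow> real ^ 'n \<Rightarrow> real" where
  "scalar_curvature_coord g x =
     (\<Sum>j\<in>UNIV. \<Sum>k\<in>UNIV. matrix_inv (g x) $ j $ k * ricci g j k x)"


section \<open>Hypersurfaces of the product of two unit 2-spheres\<close>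

type_synonym R33 = "(real ^ 3) \<times> (real ^ 3)"

definition S2xS2 :: "R33 set" where
  "S2xS2 = sphere 0 1 \<times> sphere 0 1"

definition tangent_S2xS2 :: "R33 \<Rightarrow> R33 set" where
  "tangent_S2xS2 x = {w. fst w \<bullet> fst x = 0 \<and> snd w \<bullet> snd x = 0}"

text \<open>Orthogonal projection of the ambient Euclidean space onto \<open>tangent_S2xS2 x\<close>, for \<open>x\<close> in
  \<open>S2xS2\<close>. The Levi-Civita connection of the product metric is the ambient derivative followed
  by this projection.\<close>

definition tangent_proj :: "R33 \<Rightarrow> R33 \<Rightarrow> R33" where
  "tangent_proj x w =
     (fst w - (fst w \<bullet> fst x) *\<^sub>R fst x, snd w - (snd w \<bullet> snd x) *\<^sub>R snd x)"

definition product_structure :: "R33 \<Rightarrow> R33" where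
  "product_structure v = (fst v, - snd v)"

definition hypersurface :: "'m topology \<Rightarrow> ('m, 3) chart set \<Rightarrow> ('m \<Rightarrow> R33) \<Rightarrow> bool" where
  "hypersurface M \<A> \<Phi> \<longleftrightarrow>
     smooth_manifold M \<A> \<and> \<Phi> ` topspace M \<subseteq> S2xS2 \<and> smooth_map \<A> \<Phi> \<and>
     (\<forall>p\<in>topspace M. inj (differential \<A> \<Phi> p))"

definition unit_normal_field ::
    "'m topology \<Rightarrow> ('m, 3) chart set \<Rightarrow> ('m \<Rightarrow> R33) \<Rightarrow> ('m \<Rightarrow> R33) \<Rightarrow> bool" where
  "unit_normal_field M \<A> \<Phi> N \<longleftrightarrow>
     smooth_map \<A> N \<and>
     (\<forall>p\<in>topspace M. N p \<in> tangent_S2xS2 (\<Phi> p) \<and> norm (N p) = 1 \<and>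
        (\<forall>u. N p \<bullet> differential \<A> \<Phi> p u = 0))"

definition induced_metric ::
    "('m, 3) chart \<Rightarrow> ('m \<Rightarrow> R33) \<Rightarrow> real ^ 3 \<Rightarrow> real ^ 3 ^ 3" where
  "induced_metric c \<Phi> x =
     (\<chi> i j. frechet_derivative (in_chart c \<Phi>) (at x) (axis i 1) \<bullet>
            frechet_derivative (in_chart c \<Phi>) (at x) (axis j 1))"

definition scalar_curvature :: "('m, 3) chart set \<Rightarrow> ('m \<Rightarrow> R33) \<Rightarrow> 'm \<Rightarrow> real" where
  "scalar_curvature \<A> \<Phi> p =
     (let c = chart_at \<A> p in scalar_curvature_coord (induced_metric c \<Phi>) (snd c p))"

text \<open>The shape operator \<open>A\<close> is given by \<open>d\<Phi>(A u) = - \<nabla>\<^sub>u N\<close>, where \<open>\<nabla>\<close> is the Levi-Civita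
  connection of the ambient product.\<close>

definition shape_operator ::
    "('m, 3) chart set \<Rightarrow> ('m \<Rightarrow> R33) \<Rightarrow> ('m \<Rightarrow> R33) \<Rightarrow> 'm \<Rightarrow> real ^ 3 \<Rightarrow> real ^ 3" where
  "shape_operator \<A> \<Phi> N p u =
     (THE w. differential \<A> \<Phi> p w = - tangent_proj (\<Phi> p) (differential \<A> N p u))"

definition principal_curvatures ::
    "('m, 3) chart set \<Rightarrow> ('m \<Rightarrow> R33) \<Rightarrow> ('m \<Rightarrow> R33) \<Rightarrow> 'm \<Rightarrow> real set" where
  "principal_curvatures \<A> \<Phi> N p = {\<kappa>. \<exists>u. u \<noteq> 0 \<and> shape_operator \<A> \<Phi> N p u = \<kappa> *\<^sub>R u}"

definition gauss_kronecker ::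
    "('m, 3) chart set \<Rightarrow> ('m \<Rightarrow> R33) \<Rightarrow> ('m \<Rightarrow> R33) \<Rightarrow> 'm \<Rightarrow> real" where
  "gauss_kronecker \<A> \<Phi> N p = det (matrix (shape_operator \<A> \<Phi> N p))"

definition C_fun :: "('m \<Rightarrow> R33) \<Rightarrow> 'm \<Rightarrow> real" where
  "C_fun N p = product_structure (N p) \<bullet> N p"

end

(*
  Near a point choose an orthonormal frame e_1, e_2, e_3 of principal directions, and let C, x_i,
  f_ij be the entries of the product structure P in the frame e_1, e_2, e_3, N. As the principal
  curvatures are constant, the Codazzi equations express all connection coefficients through x and
  f, up to one unknown function t. The Gauss equations then become polynomial identities in
  x, f, C and t, and their mixed components give the derivatives of t.

  At a point with C^2 = 1 we have x = 0, and (1 + C f) / 2 is a projection of rank one. If K = 0, the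
  Gauss equations and their first derivatives force 4 k_i k_j = -3 for the two nonzero principal
  curvatures, that is 2 rho = 1.

  At a critical point of C with C^2 < 1 some k_l vanishes and the tangential part of P N is a
  multiple of e_l. This persists to infinite order along e_l, so along e_l the matrix f only rotates
  by an angle, and the Gauss equations become algebraic relations for this angle and t with constant
  coefficients. They leave only C = 0 and 2 k_i k_j = -1.
*)
theory Submission
  imports Defs "HOL-Computational_Algebra.Formal_Power_Series"
begin

text \<open>Two obstacles shape the proof. First, at a point with C^2 = 1 the Gauss equations bring
  in t^2 as a further unknown. Differentiating them once more shows that t times each off-diagonal
  entry of f vanishes; a nonzero t would make f diagonal, which the signs in the Gauss equations
  exclude, so t = 0. The case C = -1 is reduced to C = 1 by replacing P by -P, which exchanges the
  two spheres. Second, the data near a critical point are only smooth, and a product of smooth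
  functions can vanish without a factor vanishing. Formal Taylor series at the point along e_l form
  an integral domain, so alternatives such as "the derivative of f_ii is zero or the coefficients
  vanish" become legitimate, without integral curves or analyticity. With k_l = 0 the scalar
  curvature is 2 + 2 k_i k_j; this is why 4 k_i k_j = -3 means 2 rho = 1, and 2 k_i k_j = -1 means
  rho = 1. The algebra is carried out in an abstract locale of derivations, so geometry enters only
  where its axioms are verified for smooth functions on a coordinate domain.\<close>

section \<open>Derivations and formal Taylor series\<close>

text \<open>An algebra \<open>S\<close> of functions with derivations \<open>D i\<close>; identities are required on \<open>W\<close> only,
  and \<open>D_cong\<close> expresses that the \<open>D i\<close> are local.\<close>

locale derivations =
  fixes W :: "'a set" and S :: "('a \<Rightarrow> real) set" and D :: "'i \<Rightarrow> ('a \<Rightarrow> real) \<Rightarrow> 'a \<Rightarrow> real"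
  assumes S_const [simp, intro]: "(\<lambda>_. c) \<in> S"
    and S_add [simp, intro]: "f \<in> S \<Longrightarrow> g \<in> S \<Longrightarrow> (\<lambda>y. f y + g y) \<in> S"
    and S_mult [simp, intro]: "f \<in> S \<Longrightarrow> g \<in> S \<Longrightarrow> (\<lambda>y. f y * g y) \<in> S"
    and S_D [simp, intro]: "f \<in> S \<Longrightarrow> D i f \<in> S"
    and D_cong: "f \<in> S \<Longrightarrow> g \<in> S \<Longrightarrow> (\<And>y. y \<in> W \<Longrightarrow> f y = g y) \<Longrightarrow> y \<in> W \<Longrightarrow> D i f y = D i g y"
    and D_const [simp]: "y \<in> W \<Longrightarrow> D i (\<lambda>_. c) y = 0"
    and D_add [simp]: "f \<in> S \<Longrightarrow> g \<in> S \<Longrightarrow> y \<in> W \<Longrightarrow> D i (\<lambda>y. f y + g y) y = D i f y + D i g y"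
    and D_mult [simp]: "f \<in> S \<Longrightarrow> g \<in> S \<Longrightarrow> y \<in> W \<Longrightarrow>
          D i (\<lambda>y. f y * g y) y = D i f y * g y + f y * D i g y"
begin

lemma S_uminus [simp, intro]: "f \<in> S \<Longrightarrow> (\<lambda>y. - f y) \<in> S"
  using S_mult[OF S_const[of "-1"], of f] by simp

lemma S_diff [simp, intro]: "f \<in> S \<Longrightarrow> g \<in> S \<Longrightarrow> (\<lambda>y. f y - g y) \<in> S"
  using S_add[of f "\<lambda>y. - g y"] by simp

lemma D_uminus [simp]: "f \<in> S \<Longrightarrow> y \<in> W \<Longrightarrow> D i (\<lambda>y. - f y) y = - D i f y"
  using D_mult[OF S_const[of "-1"], of f y i] by simp

lemma D_diff [simp]: "f \<in> S \<Longrightarrow> g \<in> S \<Longrightarrow> y \<in> W \<Longrightarrow> D i (\<lambda>y. f y - g y) y = D i f y - D i g y"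
  using D_add[of f "\<lambda>y. - g y" y i] by simp

lemma S_power [simp, intro]: "f \<in> S \<Longrightarrow> (\<lambda>y. (f y)\<^sup>2) \<in> S"
  unfolding power2_eq_square by simp

lemma D_power2 [simp]: "f \<in> S \<Longrightarrow> y \<in> W \<Longrightarrow> D i (\<lambda>y. (f y)\<^sup>2) y = 2 * f y * D i f y"
  unfolding power2_eq_square by simp

lemma S_divide [simp, intro]: "f \<in> S \<Longrightarrow> (\<lambda>y. f y / c) \<in> S"
  using S_mult[OF _ S_const[of "1 / c"], of f] by simp

lemma D_divide [simp]: "f \<in> S \<Longrightarrow> y \<in> W \<Longrightarrow> D i (\<lambda>y. f y / c) y = D i f y / c"
  using D_mult[OF _ S_const[of "1 / c"], of f y i] by simp

text \<open>When \<open>D i\<close> is the derivative along a vector field, this is the Taylor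
  series of \<open>f\<close> along the integral curve through \<open>p\<close>; iterating
  \<open>D i\<close> yields the coefficients without constructing the curve.\<close>

definition taylor :: "'i \<Rightarrow> 'a \<Rightarrow> ('a \<Rightarrow> real) \<Rightarrow> real fps" where
  "taylor i p f = Abs_fps (\<lambda>n. ((D i ^^ n) f) p / fact n)"

lemma S_D_funpow: "f \<in> S \<Longrightarrow> (D i ^^ n) f \<in> S"
  by (induction n) auto

lemma taylor_nth_0: "fps_nth (taylor i p f) 0 = f p"
  by (simp add: taylor_def)

lemma taylor_D: "taylor i p (D i f) = fps_deriv (taylor i p f)"
  by (rule fps_ext) (simp add: taylor_def funpow_swap1 fact_Suc divide_simps del: of_nat_Suc)

text \<open>The induction runs over all points of \<open>W\<close>, since \<open>D_cong\<close>
  needs agreement on \<open>W\<close> and not only at one point.\<close>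

lemma D_funpow_cong:
  assumes "f \<in> S" "g \<in> S" "\<And>y. y \<in> W \<Longrightarrow> f y = g y" "y \<in> W"
  shows "(D i ^^ n) f y = (D i ^^ n) g y"
  using assms(4)
proof (induction n arbitrary: y)
  case (Suc n)
  then show ?case
    by (auto intro!: D_cong S_D_funpow assms(1,2))
qed (use assms in auto)

lemma taylor_cong:
  assumes "f \<in> S" "g \<in> S" "\<And>y. y \<in> W \<Longrightarrow> f y = g y" "p \<in> W"
  shows "taylor i p f = taylor i p g"
  by (simp add: taylor_def D_funpow_cong[OF assms])

lemma taylor_add:
  assumes "f \<in> S" "g \<in> S" "p \<in> W"
  shows "taylor i p (\<lambda>y. f y + g y) = taylor i p f + taylor i p g"
proof -
  have "(D i ^^ n) (\<lambda>y. f y + g y) y = (D i ^^ n) f y + (D i ^^ n) g y" if "y \<in> W" for n y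
    using that
  proof (induction n arbitrary: y)
    case (Suc n)
    have "D i ((D i ^^ n) (\<lambda>y. f y + g y)) y = D i (\<lambda>y. (D i ^^ n) f y + (D i ^^ n) g y) y"
      using Suc assms by (intro D_cong) (auto intro: S_D_funpow)
    then show ?case
      using Suc.prems assms by (simp add: S_D_funpow)
  qed auto
  then show ?thesis
    using assms(3) by (auto simp: taylor_def fps_eq_iff add_divide_distrib)
qed

text \<open>Coefficient \<open>Suc n\<close> is coefficient \<open>n\<close> of the derivative
  divided by \<open>Suc n\<close>, and both products obey the Leibniz rule. The derivative involves
  \<open>D i f\<close> and \<open>D i g\<close>, so the induction ranges over all \<open>f\<close>
  and \<open>g\<close>.\<close>

lemma taylor_mult:
  assumes "f \<in> S" "g \<in> S" "p \<in> W"
  shows "taylor i p (\<lambda>y. f y * g y) = taylor i p f * taylor i p g"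
proof -
  have "fps_nth (taylor i p (\<lambda>y. f y * g y)) n = fps_nth (taylor i p f * taylor i p g) n" for n
    using assms(1,2)
  proof (induction n arbitrary: f g)
    case 0
    then show ?case by (simp add: taylor_nth_0)
  next
    case (Suc n)
    have "of_nat (Suc n) * fps_nth (taylor i p (\<lambda>y. f y * g y)) (Suc n)
        = fps_nth (taylor i p (D i (\<lambda>y. f y * g y))) n"
      by (simp add: taylor_D)
    also have "taylor i p (D i (\<lambda>y. f y * g y)) = taylor i p (\<lambda>y. D i f y * g y + f y * D i g y)"
      using Suc.prems assms(3) by (intro taylor_cong) auto
    also have "\<dots> = taylor i p (\<lambda>y. D i f y * g y) + taylor i p (\<lambda>y. f y * D i g y)"
      using Suc.prems assms(3) by (intro taylor_add) auto
    also have "fps_nth \<dots> n = fps_nth (taylor i p (D i f) * taylor i p g + taylor i p f * taylor i p (D i g)) n"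
      using Suc by simp
    also have "\<dots> = fps_nth (fps_deriv (taylor i p f * taylor i p g)) n"
      by (subst fps_deriv_mult) (simp add: taylor_D algebra_simps)
    also have "\<dots> = of_nat (Suc n) * fps_nth (taylor i p f * taylor i p g) (Suc n)"
      by (simp only: fps_deriv_nth Suc_eq_plus1)
    finally show ?case
      by (metis mult_cancel_left of_nat_neq_0)
  qed
  then show ?thesis by (simp add: fps_ext)
qed

lemma taylor_const [simp]:
  assumes "p \<in> W" shows "taylor i p (\<lambda>_. c) = fps_const c"
proof (rule fps_ext)
  fix n
  have "(D i ^^ n) (\<lambda>_. c) y = (if n = 0 then c else 0)" if "y \<in> W" for y
    using that
  proof (induction n arbitrary: y)
    case (Suc n)
    have "D i ((D i ^^ n) (\<lambda>_. c)) y = D i (\<lambda>_. if n = 0 then c else 0) y"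
      using Suc by (intro D_cong) (auto intro: S_D_funpow)
    then show ?case using Suc.prems by simp
  qed auto
  then show "fps_nth (taylor i p (\<lambda>_. c)) n = fps_nth (fps_const c) n"
    using assms by (simp add: taylor_def)
qed

lemma taylor_cmult: "f \<in> S \<Longrightarrow> p \<in> W \<Longrightarrow> taylor i p (\<lambda>y. c * f y) = fps_const c * taylor i p f"
  using taylor_mult[OF S_const] by simp

lemma taylor_uminus: "f \<in> S \<Longrightarrow> p \<in> W \<Longrightarrow> taylor i p (\<lambda>y. - f y) = - taylor i p f"
  using taylor_cmult[of f p i "-1"] by (simp flip: fps_const_neg)

lemma taylor_diff:
  "f \<in> S \<Longrightarrow> g \<in> S \<Longrightarrow> p \<in> W \<Longrightarrow> taylor i p (\<lambda>y. f y - g y) = taylor i p f - taylor i p g"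
  using taylor_add[of f "\<lambda>y. - g y" p i] by (simp add: taylor_uminus)

lemma taylor_power2: "f \<in> S \<Longrightarrow> p \<in> W \<Longrightarrow> taylor i p (\<lambda>y. (f y)\<^sup>2) = (taylor i p f)\<^sup>2"
  by (simp add: power2_eq_square taylor_mult)

lemmas taylor_simps = taylor_add taylor_mult taylor_uminus taylor_diff taylor_power2

end

section \<open>The structure equations in a principal frame\<close>

text \<open>The frame identities are stated for an arbitrary ordering \<open>i, j, l\<close> of the
  three indices; this expands their sums along it.\<close>

lemma sum_3_distinct:
  fixes h :: "3 \<Rightarrow> 'b::comm_monoid_add"
  assumes "distinct [i, j, l]"
  shows "(\<Sum>m\<in>UNIV. h m) = h i + h j + h l"
proof -
  have "card {i, j, l} = CARD(3)" using assms by simp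
  then have "{i, j, l} = UNIV" by (intro card_subset_eq) auto
  then have "(\<Sum>m\<in>UNIV. h m) = (\<Sum>m\<in>{i, j, l}. h m)" by simp
  then show ?thesis using assms by (simp add: add.assoc)
qed

abbreviation kron :: "'i \<Rightarrow> 'i \<Rightarrow> real" where
  "kron i j \<equiv> if i = j then 1 else 0"

text \<open>In an orthonormal principal frame \<open>e\<^sub>i\<close> with unit normal \<open>N\<close>: \<open>D i\<close> is the derivative along
  \<open>e\<^sub>i\<close>, \<open>C = \<langle>P N, N\<rangle>\<close>, \<open>x i = \<langle>P e\<^sub>i, N\<rangle>\<close>, \<open>f i j = \<langle>P e\<^sub>i, e\<^sub>j\<rangle>\<close> and
  \<open>\<Gamma> i j m = \<langle>D i e\<^sub>j, e\<^sub>m\<rangle>\<close>. The \<open>P_\<close> axioms say that \<open>P\<close> is a symmetric involution of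
  \<open>\<langle>e\<^sub>1, e\<^sub>2, e\<^sub>3, N\<rangle>\<close> of trace zero.\<close>

locale frame_eqs = derivations W S D
  for W :: "'a set" and S :: "('a \<Rightarrow> real) set" and D :: "3 \<Rightarrow> ('a \<Rightarrow> real) \<Rightarrow> 'a \<Rightarrow> real" +
  fixes k :: "3 \<Rightarrow> real" and C :: "'a \<Rightarrow> real" and x :: "3 \<Rightarrow> 'a \<Rightarrow> real"
    and f :: "3 \<Rightarrow> 3 \<Rightarrow> 'a \<Rightarrow> real" and \<Gamma> :: "3 \<Rightarrow> 3 \<Rightarrow> 3 \<Rightarrow> 'a \<Rightarrow> real"
  assumes inj_k: "inj k"
    and S_C [simp, intro]: "C \<in> S" and S_x [simp, intro]: "x i \<in> S"
    and S_f [simp, intro]: "f i j \<in> S" and S_G [simp, intro]: "\<Gamma> i j m \<in> S"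
    and f_sym: "y \<in> W \<Longrightarrow> f i j y = f j i y"
    and G_skew: "y \<in> W \<Longrightarrow> \<Gamma> i j m y = - \<Gamma> i m j y"
    and P_square: "y \<in> W \<Longrightarrow> (\<Sum>m\<in>UNIV. f i m y * f m j y) + x i y * x j y = kron i j"
    and P_normal: "y \<in> W \<Longrightarrow> (\<Sum>m\<in>UNIV. f i m y * x m y) = - C y * x i y"
    and P_unit: "y \<in> W \<Longrightarrow> (\<Sum>m\<in>UNIV. (x m y)\<^sup>2) + (C y)\<^sup>2 = 1"
    and P_trace: "y \<in> W \<Longrightarrow> (\<Sum>m\<in>UNIV. f m m y) = - C y"
    and D_C: "y \<in> W \<Longrightarrow> D l C y = - 2 * k l * x l y"
    and D_x: "y \<in> W \<Longrightarrow> D l (x i) y =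
          (\<Sum>m\<in>UNIV. \<Gamma> l i m y * x m y) + k l * (C y * kron l i - f l i y)"
    and D_f: "y \<in> W \<Longrightarrow> D l (f i j) y =
          (\<Sum>m\<in>UNIV. \<Gamma> l i m y * f m j y + \<Gamma> l j m y * f i m y)
          + k l * (kron l i * x j y + kron l j * x i y)"
    and codazzi: "y \<in> W \<Longrightarrow> (k j - k m) * \<Gamma> i j m y - (k i - k m) * \<Gamma> j i m y =
          (x i y * f j m y - x j y * f i m y) / 2"
    and gauss: "y \<in> W \<Longrightarrow> D i (\<Gamma> j a b) y - D j (\<Gamma> i a b) y
          + (\<Sum>m\<in>UNIV. \<Gamma> j a m y * \<Gamma> i m b y - \<Gamma> i a m y * \<Gamma> j m b y
                - (\<Gamma> i j m y - \<Gamma> j i m y) * \<Gamma> m a b y)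
          = (k i * k j + 1/2) * (kron j a * kron i b - kron i a * kron j b)
          + (f j a y * f i b y - f i a y * f j b y) / 2"
begin

section \<open>Connection coefficients and their derivatives from the Codazzi and Gauss
  equations\<close>

lemma k_neq: "i \<noteq> j \<Longrightarrow> k i \<noteq> k j"
  using inj_k by (auto dest: injD)

lemma G_diag: "y \<in> W \<Longrightarrow> \<Gamma> i j j y = 0"
  using G_skew[of y i j j] by simp

text \<open>For \<open>m = i\<close> the second Codazzi term drops out, so a coefficient with a
  repeated index is determined by \<open>x\<close> and \<open>f\<close>.\<close>

lemma codazzi_2: "y \<in> W \<Longrightarrow> (k j - k i) * \<Gamma> i j i y = (x i y * f i j y - x j y * f i i y) / 2"
  using codazzi[of y j i i] f_sym[of y i j] G_diag[of y j i] by simp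

text \<open>For distinct \<open>i, j, l\<close> the Codazzi equation makes this totally symmetric, so that it is the only
  connection coefficient not determined by \<open>x\<close> and \<open>f\<close>.\<close>

definition T :: "3 \<Rightarrow> 3 \<Rightarrow> 3 \<Rightarrow> 'a \<Rightarrow> real" where
  "T i j l = (\<lambda>y. (k j - k l) * \<Gamma> i j l y - x i y * f j l y / 2)"

lemma S_T [simp, intro]: "T i j l \<in> S"
  unfolding T_def by simp

lemma T_sym:
  assumes "y \<in> W" shows "T i j l y = T i l j y" "T i j l y = T j i l y"
proof -
  show "T i j l y = T i l j y"
    unfolding T_def G_skew[OF assms, of i j l] f_sym[OF assms, of j l] by (simp add: algebra_simps)
  show "T i j l y = T j i l y"
    using codazzi[OF assms, of j l i] unfolding T_def by (simp add: diff_divide_distrib)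
qed

lemma G_T: "y \<in> W \<Longrightarrow> (k j - k l) * \<Gamma> i j l y = T i j l y + x i y * f j l y / 2"
  unfolding T_def by simp

text \<open>\<open>codazzi_2\<close> holds on all of \<open>W\<close> and may therefore be
  differentiated; keeping the factor \<open>k j - k i\<close> avoids division.\<close>

lemma D_G_diag:
  assumes "y \<in> W"
  shows "(k j - k i) * D a (\<Gamma> i j i) y =
    (D a (x i) y * f i j y + x i y * D a (f i j) y - D a (x j) y * f i i y - x j y * D a (f i i) y) / 2"
proof -
  have "D a (\<lambda>y. (k j - k i) * \<Gamma> i j i y) y = D a (\<lambda>y. (x i y * f i j y - x j y * f i i y) / 2) y"
    by (rule D_cong) (use assms codazzi_2 in simp_all)
  then show ?thesis using assms by simp
qed

lemma D_G_T:
  assumes "y \<in> W"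
  shows "(k j - k l) * D a (\<Gamma> i j l) y =
    D a (T i j l) y + (D a (x i) y * f j l y + x i y * D a (f j l) y) / 2"
proof -
  have "D a (\<lambda>y. (k j - k l) * \<Gamma> i j l y) y = D a (\<lambda>y. T i j l y + x i y * f j l y / 2) y"
    by (rule D_cong) (use assms G_T in simp_all)
  then show ?thesis using assms by simp
qed

lemma D_T_sym:
  assumes "y \<in> W" shows "D a (T i j l) y = D a (T i l j) y" "D a (T i j l) y = D a (T j i l) y"
  using D_cong[of "T i j l" "T i l j" y a] D_cong[of "T i j l" "T j i l" y a] T_sym assms by simp_all

lemma D_G_skew: "y \<in> W \<Longrightarrow> D a (\<Gamma> i j m) y = - D a (\<Gamma> i m j) y"
  using D_cong[of "\<Gamma> i j m" "\<lambda>y. - \<Gamma> i m j y" y a, OF _ _ G_skew] by simp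

text \<open>The Gauss equation with \<open>a = j\<close>, \<open>b = i\<close>. The factor
  \<open>k i - k j\<close> lets \<open>D_G_diag\<close> trade both derivatives of connection
  coefficients for derivatives of \<open>x\<close> and \<open>f\<close>.\<close>

lemma gauss_diag:
  assumes "distinct [i, j, l]" "y \<in> W"
  shows "(k i - k j) * (k i * k j + (1 + f i i y * f j j y - (f i j y)\<^sup>2) / 2) =
    (1/2) * (D j (x i) y * f i j y + x i y * D j (f i j) y - D j (x j) y * f i i y - x j y * D j (f i i) y
      + D i (x i) y * f j j y + x i y * D i (f j j) y - D i (x j) y * f i j y - x j y * D i (f i j) y)
    + (k i - k j) * (\<Gamma> j j l y * \<Gamma> i l i y - \<Gamma> i j l y * \<Gamma> j l i y - (\<Gamma> i j i y)\<^sup>2 - (\<Gamma> j i j y)\<^sup>2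
       - (\<Gamma> i j l y - \<Gamma> j i l y) * \<Gamma> l j i y)"
proof -
  have d: "i \<noteq> j" "j \<noteq> l" "i \<noteq> l" "j \<noteq> i" "l \<noteq> j" "l \<noteq> i" using assms by auto
  have s: "\<Gamma> j j i y = - \<Gamma> j i j y" "D i (\<Gamma> j j i) y = - D i (\<Gamma> j i j) y"
    by (rule G_skew[OF assms(2)] D_G_skew[OF assms(2)])+
  have eq: "f j i y = f i j y" "D a (f j i) y = D a (f i j) y" for a
    by (intro D_cong f_sym S_f assms(2) | assumption)+
  have z: "\<Gamma> i j j y = 0" "\<Gamma> i i i y = 0" "\<Gamma> j i i y = 0" "\<Gamma> j j j y = 0"
    using G_diag assms(2) by auto
  define Q where "Q = \<Gamma> j j l y * \<Gamma> i l i y - \<Gamma> i j l y * \<Gamma> j l i y - (\<Gamma> i j i y)\<^sup>2 - (\<Gamma> j i j y)\<^sup>2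
       - (\<Gamma> i j l y - \<Gamma> j i l y) * \<Gamma> l j i y"
  define A where "A = D i (\<Gamma> j i j) y"
  define B where "B = D j (\<Gamma> i j i) y"
  have "k i * k j + (1 + f i i y * f j j y - (f i j y)\<^sup>2) / 2 = - A - B + Q"
    using gauss[OF assms(2), of i j j i] d s eq z
    by (simp add: sum_3_distinct[OF assms(1)] power2_eq_square A_def B_def Q_def field_simps)
  then have "(k i - k j) * (k i * k j + (1 + f i i y * f j j y - (f i j y)\<^sup>2) / 2) =
      - ((k i - k j) * A) + (k j - k i) * B + (k i - k j) * Q"
    by (simp only:) (simp add: algebra_simps)
  also have "\<dots> = - ((D i (x j) y * f i j y + x j y * D i (f i j) y - D i (x i) y * f j j y - x i y * D i (f j j) y) / 2)
      + (D j (x i) y * f i j y + x i y * D j (f i j) y - D j (x j) y * f i i y - x j y * D j (f i i) y) / 2 + (k i - k j) * Q"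
    unfolding A_def B_def D_G_diag[OF assms(2)] eq by simp
  finally show ?thesis
    by (fold Q_def) (simp add: algebra_simps add_divide_distrib diff_divide_distrib)
qed

text \<open>The Gauss equation with \<open>a = l\<close>, \<open>b = i\<close>, where the
  \<open>kron\<close> terms vanish. By total symmetry \<open>T i j l\<close> is also the function
  belonging to \<open>\<Gamma> j l i\<close>, so its derivative along one of its own indices comes
  out; permuting the indices gives all three derivatives.\<close>

lemma gauss_mixed:
  assumes "distinct [i, j, l]" "y \<in> W"
  shows "D i (T i j l) y =
    - (D i (x j) y * f i l y + x j y * D i (f i l) y) / 2
    + (D j (x i) y * f i l y + x i y * D j (f i l) y - D j (x l) y * f i i y - x l y * D j (f i i) y) / 2
    - (k l - k i) * (\<Gamma> j l j y * \<Gamma> i j i y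
        + \<Gamma> i l j y * \<Gamma> j i j y - \<Gamma> i j i y * \<Gamma> i l i y + \<Gamma> j i j y * \<Gamma> j l i y
        - (\<Gamma> i j l y - \<Gamma> j i l y) * \<Gamma> l l i y)
    + (k l - k i) * (f j l y * f i i y - f i l y * f i j y) / 2"
proof -
  have d: "i \<noteq> j" "j \<noteq> l" "i \<noteq> l" "j \<noteq> i" "l \<noteq> j" "l \<noteq> i" using assms by auto
  have s: "\<Gamma> i j j y = 0" "\<Gamma> i i i y = 0" "\<Gamma> j i i y = 0" "\<Gamma> j l l y = 0" "\<Gamma> i l l y = 0" "\<Gamma> j j j y = 0"
    using G_diag assms by auto
  have s2: "\<Gamma> i i j y = - \<Gamma> i j i y" "\<Gamma> j j i y = - \<Gamma> j i j y"
    by (rule G_skew[OF assms(2)])+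
  have eq: "f j i y = f i j y" "D a (f l i) y = D a (f i l) y" "f l i y = f i l y" for a
    by (intro D_cong f_sym S_f assms(2) | assumption)+
  have T: "(k l - k i) * D i (\<Gamma> j l i) y = D i (T i j l) y + (D i (x j) y * f i l y + x j y * D i (f i l) y) / 2"
    using D_G_T[OF assms(2), of l i i j] eq(3) eq(2)[of i]
      trans[OF D_T_sym(1)[OF assms(2), of i j l i] D_T_sym(2)[OF assms(2), of i j i l]]
    by simp
  have "D i (\<Gamma> j l i) y - D j (\<Gamma> i l i) y =
      - (\<Gamma> j l j y * \<Gamma> i j i y + \<Gamma> i l j y * \<Gamma> j i j y - \<Gamma> i j i y * \<Gamma> i l i y + \<Gamma> j i j y * \<Gamma> j l i y
        - (\<Gamma> i j l y - \<Gamma> j i l y) * \<Gamma> l l i y)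
      + (f j l y * f i i y - f i l y * f i j y) / 2" (is "?A - ?B = ?X")
    using gauss[OF assms(2), of i j l i] d s s2 eq
    by (simp add: sum_3_distinct[OF assms(1)] field_simps)
  then have "(k l - k i) * ?A - (k l - k i) * ?B = (k l - k i) * ?X"
    by (simp only: right_diff_distrib[symmetric])
  then show ?thesis
    unfolding T D_G_diag[OF assms(2), of l i j] eq
    by (simp only: distrib_left)
qed

end

section \<open>Points with \<open>C\<^sup>2 = 1\<close>\<close>

context frame_eqs
begin

text \<open>\<open>k i - k j\<close> times the Gauss equation of the plane spanned by \<open>e\<^sub>i, e\<^sub>j\<close>, with all derivatives of
  connection coefficients eliminated by the Codazzi equation.\<close>

definition gauss_defect :: "3 \<Rightarrow> 3 \<Rightarrow> 3 \<Rightarrow> 'a \<Rightarrow> real" where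
  "gauss_defect i j l = (\<lambda>y.
    (1/2) * ((\<Gamma> j i j y * x j y + \<Gamma> j i l y * x l y - k j * f i j y) * f i j y
      + x i y * (\<Gamma> j i j y * f j j y + \<Gamma> j i l y * f j l y - \<Gamma> j i j y * f i i y + \<Gamma> j j l y * f i l y + k j * x i y)
      - (- \<Gamma> j i j y * x i y + \<Gamma> j j l y * x l y + k j * (C y - f j j y)) * f i i y
      - x j y * (2 * (\<Gamma> j i j y * f i j y + \<Gamma> j i l y * f i l y))
      + (- \<Gamma> i j i y * x j y + \<Gamma> i i l y * x l y + k i * (C y - f i i y)) * f j j y
      + x i y * (2 * (\<Gamma> i j i y * f i j y + \<Gamma> i j l y * f j l y))
      - (\<Gamma> i j i y * x i y + \<Gamma> i j l y * x l y - k i * f i j y) * f i j y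
      - x j y * (- \<Gamma> i j i y * f j j y + \<Gamma> i i l y * f j l y + \<Gamma> i j i y * f i i y + \<Gamma> i j l y * f i l y + k i * x j y))
    + (k i - k j) * (\<Gamma> j j l y * \<Gamma> i l i y - \<Gamma> i j l y * \<Gamma> j l i y - (\<Gamma> i j i y)\<^sup>2 - (\<Gamma> j i j y)\<^sup>2
       - (\<Gamma> i j l y - \<Gamma> j i l y) * \<Gamma> l j i y)
    - (k i - k j) * (k i * k j + (1 + f i i y * f j j y - (f i j y)\<^sup>2) / 2))"

lemma S_gauss_defect [simp, intro]: "gauss_defect i j l \<in> S"
  unfolding gauss_defect_def by simp

text \<open>Inserting \<open>D_x\<close> and \<open>D_f\<close> into \<open>gauss_diag\<close>
  leaves an expression free of derivatives.\<close>

lemma gauss_defect_eq_0: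
  assumes "distinct [i, j, l]" "y \<in> W"
  shows "gauss_defect i j l y = 0"
proof -
  have d: "i \<noteq> j" "j \<noteq> l" "i \<noteq> l" "j \<noteq> i" "l \<noteq> j" "l \<noteq> i" using assms by auto
  have z: "\<Gamma> a b b y = 0" for a b using G_diag assms(2) by auto
  have s: "\<Gamma> i i j y = - \<Gamma> i j i y" "\<Gamma> j j i y = - \<Gamma> j i j y"
    by (rule G_skew[OF assms(2)])+
  have fs: "f j i y = f i j y" "f l i y = f i l y" "f l j y = f j l y"
    by (rule f_sym[OF assms(2)])+
  show ?thesis
    unfolding gauss_defect_def gauss_diag[OF assms] D_x[OF assms(2)] D_f[OF assms(2)] sum_3_distinct[OF assms(1)] z s fs
    using d by (simp add: algebra_simps)
qed

text \<open>The defect is zero on all of \<open>W\<close>. Being free of derivatives itself, it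
  yields relations that contain only first derivatives of \<open>C\<close>, \<open>x\<close>,
  \<open>f\<close> and \<open>\<Gamma>\<close>.\<close>

lemma D_gauss_defect:
  assumes "distinct [i, j, l]" "y \<in> W"
  shows "D r (gauss_defect i j l) y = 0"
proof -
  have "D r (gauss_defect i j l) y = D r (\<lambda>_. 0) y"
    using assms by (intro D_cong) (simp_all add: gauss_defect_eq_0)
  then show ?thesis using assms by simp
qed

text \<open>Only \<open>t\<close> survives among the connection coefficients at \<open>p\<close>. If
  \<open>t = 0\<close>, the Gauss equations fix the diagonal of the projection and the product of
  the curvatures; their derivatives exclude \<open>t \<noteq> 0\<close>.\<close>

lemma pole_product:
  assumes "distinct [i, j, l]" "k l = 0" "p \<in> W" "C p = 1"
  shows "4 * (k i * k j) = - 3"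
proof -
  have d: "i \<noteq> j" "j \<noteq> l" "i \<noteq> l" "j \<noteq> i" "l \<noteq> j" "l \<noteq> i" using assms by auto
  note sum3 = sum_3_distinct[OF assms(1)]
  have kn: "k i \<noteq> 0" "k j \<noteq> 0" "k i \<noteq> k j"
    using k_neq[OF d(3)] k_neq[OF d(2)] k_neq[OF d(1)] assms(2) by auto
  have xpa: "x r p = 0" for r
    using sum_nonneg_eq_0_iff[of UNIV "\<lambda>m. (x m p)\<^sup>2"] P_unit[OF assms(3)] assms(4) by simp
  note xp = xpa[of i] xpa[of j] xpa[of l]
  \<comment> \<open>the entries of the projection \<open>(1 + f) / 2\<close>, which has rank one\<close>
  define a b c where "a = (1 + f i i p) / 2" "b = (1 + f j j p) / 2" "c = (1 + f l l p) / 2"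
  define h m n where "h = f i j p / 2" "m = f i l p / 2" "n = f j l p / 2"
  have fv: "f i i p = 2 * a - 1" "f j j p = 2 * b - 1" "f l l p = 2 * c - 1"
    "f i j p = 2 * h" "f i l p = 2 * m" "f j l p = 2 * n" "f j i p = 2 * h" "f l i p = 2 * m" "f l j p = 2 * n"
    using f_sym[OF assms(3), of j i] f_sym[OF assms(3), of l i] f_sym[OF assms(3), of l j]
    by (simp_all add: a_b_c_def h_m_n_def add_divide_distrib)
  have tr: "a + b + c = 1"
    using P_trace[OF assms(3)] assms(4) by (simp add: sum3 fv)
  have sq: "a^2 + h^2 + m^2 = a" "h^2 + b^2 + n^2 = b" "m^2 + n^2 + c^2 = c"
    "a * h + h * b + m * n = h" "a * m + h * n + m * c = m" "h * m + b * n + n * c = n"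
    using P_square[OF assms(3), of i i] P_square[OF assms(3), of j j] P_square[OF assms(3), of l l]
      P_square[OF assms(3), of i j] P_square[OF assms(3), of i l] P_square[OF assms(3), of j l] d
    by (simp_all add: sum3 fv xp algebra_simps power2_eq_square)
  have c: "c = 1 - a - b" using tr by simp
  \<comment> \<open>Vanishing of the 2 by 2 minors.\<close>
  have rank1: "h^2 = a * b" "m^2 = a * c" "n^2 = b * c" "h * m = a * n" "h * n = b * m" "m * n = c * h"
    using sq unfolding c by (simp_all add: algebra_simps power2_eq_square)
  define t where "t = T i j l p"
  \<comment> \<open>Reciprocals of the differences of principal curvatures (\<open>k l = 0\<close>);
    the relations \<open>kinv\<close> and \<open>uvw\<close> keep everything polynomial for
    \<open>algebra\<close>.\<close>
  define u v w where "u = 1 / (k i - k j)" "v = 1 / k i" "w = 1 / k j"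
  \<comment> \<open>Since \<open>x = 0\<close> at \<open>p\<close>, \<open>codazzi_2\<close> removes
    every coefficient with a repeated index.\<close>
  have zz: "\<Gamma> r s r p = 0" for r s
  proof (cases "r = s")
    case False
    then have "(k s - k r) * \<Gamma> r s r p = 0"
      using codazzi_2[OF assms(3), of s r] xpa by simp
    then show ?thesis using k_neq[of s r] False by auto
  qed (simp add: G_diag assms)
  have zz2: "\<Gamma> r r s p = 0" "\<Gamma> r s s p = 0" for r s
    using G_skew[OF assms(3), of r r s] zz G_diag[OF assms(3)] by auto
  have Tv: "T i j l p = t" "T i l j p = t" "T j i l p = t" "T j l i p = t" "T l i j p = t" "T l j i p = t"
    using T_sym[OF assms(3)] unfolding t_def by metis+
  have G: "\<Gamma> i j l p = t * w" "\<Gamma> i l j p = - t * w" "\<Gamma> j i l p = t * v" "\<Gamma> j l i p = - t * v"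
     "\<Gamma> l i j p = t * u" "\<Gamma> l j i p = - t * u"
    using G_T[OF assms(3), of j l i] G_T[OF assms(3), of l j i] G_T[OF assms(3), of i l j] G_T[OF assms(3), of l i j]
      G_T[OF assms(3), of i j l] G_T[OF assms(3), of j i l] kn assms(2)
    unfolding Tv xp u_v_w_def by (simp_all add: field_simps)
  have DTs: "D r (T j i l) p = D r (T i j l) p" "D r (T l i j) p = D r (T i j l) p" for r
    using D_T_sym[OF assms(3)] by metis+
  have "D i (T i j l) p = 2 * k i * (h * m) + (k j - k i) * (n * (2 * a - 1) - 2 * (h * m))"
    "D j (T j i l) p = 2 * k j * (h * n) + (k i - k j) * (m * (2 * b - 1) - 2 * (h * n))"
    "D l (T l i j) p = (k i + k j) * (h * (2 * c - 1) - 2 * (m * n))"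
    using gauss_mixed[OF _ assms(3), of i j l] gauss_mixed[OF _ assms(3), of j i l]
      gauss_mixed[OF _ assms(3), of l i j] d
    by (simp_all add: D_x[OF assms(3)] sum3 xp zz zz2 fv assms(2,4) field_simps)
  then have DT: "D i (T i j l) p = n * (k i - k j + 2 * k i * a)"
    "D j (T i j l) p = m * (k j - k i + 2 * k j * b)"
    "D l (T i j l) p = - h * (k i + k j)"
    unfolding rank1(4-6) DTs by (simp_all add: algebra_simps)
  have kinv: "k i * v = 1" "k j * w = 1" "(k i - k j) * u = 1"
    using kn by (simp_all add: u_v_w_def)
  have dil: "distinct [i, l, j]" and djl: "distinct [j, l, i]" using d by auto
  have uvw: "u * w - u * v = v * w"
    using kinv by algebra
  \<comment> \<open>The Gauss equations of the planes \<open>ij\<close>, \<open>il\<close> and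
    \<open>jl\<close>; in the last two the common factor \<open>k i\<close> or \<open>k j\<close> is
    cancelled.\<close>
  have E: "(k i - k j) * (k i * k j + 2 * c) = k i * b - k j * a + 2 * t\<^sup>2 * (k i - k j) * (v * w)"
      "c - 2 * b = 2 * t\<^sup>2 * (u * w)" "c - 2 * a = - 2 * t\<^sup>2 * (u * v)"
  proof -
    have "2 * ((k i - k j) * (k i * k j)) + (k i - k j) * (1 + (2 * a - 1) * (2 * b - 1) - 4 * h\<^sup>2) =
        - 4 * k j * h\<^sup>2 - k j * (2 - 2 * b) * (2 * a - 1) + k i * (2 - 2 * a) * (2 * b - 1) + 4 * k i * h\<^sup>2
        + 2 * (k i - k j) * (t * w * (t * v) + (t * w - t * v) * (t * u))"
      using gauss_defect_eq_0[OF assms(1,3)]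
      by (simp add: gauss_defect_def xp zz zz2 fv assms(2,4) G power2_eq_square field_simps)
    then show "(k i - k j) * (k i * k j + 2 * c) = k i * b - k j * a + 2 * t\<^sup>2 * (k i - k j) * (v * w)"
      using uvw rank1(1) c by algebra
    have "k i * (1 + (2 * a - 1) * (2 * c - 1) - 4 * m\<^sup>2) =
        k i * ((2 - 2 * a) * (2 * c - 1) + 4 * m\<^sup>2 + 2 * ((- (t * w) - t * u) * (t * v) - t * w * (t * u)))"
      using gauss_defect_eq_0[OF dil assms(3)]
      by (simp add: gauss_defect_def xp zz zz2 fv assms(2,4) G power2_eq_square field_simps)
    then have "1 + (2 * a - 1) * (2 * c - 1) - 4 * m\<^sup>2 =
        (2 - 2 * a) * (2 * c - 1) + 4 * m\<^sup>2 + 2 * ((- (t * w) - t * u) * (t * v) - t * w * (t * u))"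
      using kn(1) mult_left_cancel by blast
    then show "c - 2 * b = 2 * t\<^sup>2 * (u * w)"
      using uvw rank1(2) c by algebra
    have "k j * (1 + (2 * b - 1) * (2 * c - 1) - 4 * n\<^sup>2) =
        k j * ((2 - 2 * b) * (2 * c - 1) + 4 * n\<^sup>2 + 2 * (t * v * (t * u) + (t * u - t * v) * (t * w)))"
      using gauss_defect_eq_0[OF djl assms(3)]
      by (simp add: gauss_defect_def xp zz zz2 fv assms(2,4) G power2_eq_square field_simps)
    then have "1 + (2 * b - 1) * (2 * c - 1) - 4 * n\<^sup>2 =
        (2 - 2 * b) * (2 * c - 1) + 4 * n\<^sup>2 + 2 * (t * v * (t * u) + (t * u - t * v) * (t * w))"
      using kn(2) mult_left_cancel by blast
    then show "c - 2 * a = - 2 * t\<^sup>2 * (u * v)"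
      using uvw rank1(3) c by algebra
  qed
  \<comment> \<open>\<open>x\<close> vanishes at \<open>p\<close>, but its derivatives need not.
    Coefficients with a repeated index occur in \<open>gauss_defect\<close> only multiplied by
    \<open>x\<close> or by one another, so their derivatives do not enter.\<close>
  have Dx: "D r (x s) p = k r * (kron r s - f r s p)" for r s
    by (simp add: D_x[OF assms(3)] xpa assms(4))
  have DC: "D r C p = 0" for r
    by (simp add: D_C[OF assms(3)] xpa)
  have DG: "D r (\<Gamma> i j l) p = w * (D r (T i j l) p + n * D r (x i) p)"
    "D r (\<Gamma> j i l) p = v * (D r (T i j l) p + m * D r (x j) p)"
    "D r (\<Gamma> l i j) p = u * (D r (T i j l) p + h * D r (x l) p)" for r
    using D_G_T[OF assms(3), of j l r i] D_G_T[OF assms(3), of i l r j] D_G_T[OF assms(3), of i j r l] DTs kn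
    by (simp_all add: xpa fv assms(2) u_v_w_def field_simps)
  have DG': "D r (\<Gamma> i l j) p = - (w * (D r (T i j l) p + n * D r (x i) p))"
    "D r (\<Gamma> j l i) p = - (v * (D r (T i j l) p + m * D r (x j) p))"
    "D r (\<Gamma> l j i) p = - (u * (D r (T i j l) p + h * D r (x l) p))" for r
    using D_G_skew[OF assms(3)] DG by metis+
  \<comment> \<open>The Gauss equations of the two planes containing \<open>e l\<close>,
    differentiated along \<open>e l\<close> and along the other direction; each isolates one
    off-diagonal entry times \<open>t\<close>.\<close>
  have e1: "n * t = 0"
    using D_gauss_defect[OF dil assms(3), of i]
    by (simp add: gauss_defect_def assms(2,3,4) xp zz zz2 fv G D_x[OF assms(3)] D_f[OF assms(3)] sum3 d DG DG' DC DT)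
      (use uvw rank1 kinv c in algebra)
  have e2: "(k i + 2 * k j) * h * t = 0"
    using D_gauss_defect[OF dil assms(3), of l]
    by (simp add: gauss_defect_def assms(2,3,4) xp zz zz2 fv G D_x[OF assms(3)] D_f[OF assms(3)] sum3 d DG DG' DC DT)
      (use uvw rank1 kinv c in algebra)
  have e3: "m * t = 0"
    using D_gauss_defect[OF djl assms(3), of j]
    by (simp add: gauss_defect_def assms(2,3,4) xp zz zz2 fv G D_x[OF assms(3)] D_f[OF assms(3)] sum3 d DG DG' DC DT)
      (use uvw rank1 kinv c in algebra)
  have e4: "(k j + 2 * k i) * h * t = 0"
    using D_gauss_defect[OF djl assms(3), of l]
    by (simp add: gauss_defect_def assms(2,3,4) xp zz zz2 fv G D_x[OF assms(3)] D_f[OF assms(3)] sum3 d DG DG' DC DT)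
      (use uvw rank1 kinv c in algebra)
  show ?thesis
  proof (rule ccontr)
    assume q: "4 * (k i * k j) \<noteq> - 3"
    \<comment> \<open>With \<open>t = 0\<close> the last two equations of \<open>E\<close> and the
      trace give \<open>a = b = 1/4\<close>, \<open>c = 1/2\<close>, and the first equation becomes
      the excluded value.\<close>
    have t: "t \<noteq> 0"
    proof
      assume t0: "t = 0"
      then have abc: "a = 1 / 4" "b = 1 / 4" "c = 1 / 2"
        using E(2,3) tr by simp_all
      have "(k i - k j) * (k i * k j + 1) = (k i - k j) * (1 / 4)"
        using E(1) unfolding abc t0 by (simp add: left_diff_distrib)
      then have "k i * k j + 1 = 1 / 4"
        using kn(3) by simp
      then show False using q by simp
    qed
    have mn: "m = 0" "n = 0" using e1 e3 t by simp_all
    have h: "h = 0"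
    proof (rule ccontr)
      assume "h \<noteq> 0"
      then have "k i + 2 * k j = 0" "k j + 2 * k i = 0" using e2 e4 t by simp_all
      then have "k i = 0" by linarith
      then show False using kn by simp
    qed
    have uvw_nz: "u \<noteq> 0" "v \<noteq> 0" "w \<noteq> 0" using kn by (auto simp: u_v_w_def)
    \<comment> \<open>The projection is now diagonal of rank one, so two of \<open>a, b, c\<close>
      vanish.\<close>
    have "a * b = 0" "a * c = 0" "b * c = 0" using rank1 mn h by auto
    then consider "b = 0" "c = 0" | "a = 0" "c = 0" | "a = 0" "b = 0" by auto
    then show False
    proof cases
      case 1 then show False using E(2) t uvw_nz by simp
    next
      case 2 then show False using E(3) t uvw_nz by simp
    next
      case 3
      then have "c = 1" using tr by simp
      \<comment> \<open>The opposite signs force \<open>v = - w\<close>, and then \<open>uvw\<close>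
        makes a square negative.\<close>
      with 3 have c1: "2 * t\<^sup>2 * (u * w) = 1" "2 * t\<^sup>2 * (u * v) = - 1" using E(2,3) by simp_all
      have "(t\<^sup>2 * u) * (v + w) = 0" using c1 by algebra
      then have "v = - w" using t uvw_nz by (simp add: add_eq_0_iff)
      then have "t\<^sup>2 * w\<^sup>2 = - 1" using c1 uvw by algebra
      moreover have "0 \<le> t\<^sup>2 * w\<^sup>2" by simp
      ultimately show False by linarith
    qed
  qed
qed

end

section \<open>Critical points of \<open>C\<close>\<close>

lemma fps_X_power_dvd_coeff:
  fixes g :: "'a::comm_ring_1 fps"
  shows "fps_X ^ n dvd g \<longleftrightarrow> (\<forall>m<n. fps_nth g m = 0)"
proof
  assume "\<forall>m<n. fps_nth g m = 0"
  then have "g = fps_X ^ n * fps_shift n g"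
    by (intro fps_ext) (simp add: fps_X_power_mult_nth)
  then show "fps_X ^ n dvd g" by (rule dvdI)
qed (auto simp: fps_X_power_mult_nth elim!: dvdE)

text \<open>Formal uniqueness for a homogeneous linear system with zero initial values. Linearity
  enters only through orders of vanishing: if all members of \<open>G\<close> have order at least
  \<open>n\<close>, so have their derivatives. Zero constant terms then raise the order of all
  members to \<open>n + 1\<close>, so every order is infinite.\<close>

lemma fps_linear_ode_zero:
  fixes G :: "real fps set"
  assumes "\<And>g n. g \<in> G \<Longrightarrow> (\<And>h. h \<in> G \<Longrightarrow> fps_X ^ n dvd h) \<Longrightarrow> fps_X ^ n dvd fps_deriv g"
    and "\<And>g. g \<in> G \<Longrightarrow> fps_nth g 0 = 0" and "g \<in> G"
  shows "g = 0"
proof -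
  have "\<forall>h\<in>G. fps_X ^ n dvd h" for n
  proof (induction n)
    case (Suc n)
    show ?case
    proof
      fix h assume h: "h \<in> G"
      have "fps_nth h m = 0" if "m < Suc n" for m
      proof (cases m)
        case (Suc r)
        have "fps_X ^ n dvd fps_deriv h"
          by (rule assms(1)[OF h]) (use Suc.IH in blast)
        then have "fps_nth (fps_deriv h) r = 0"
          using that Suc unfolding fps_X_power_dvd_coeff by simp
        then show ?thesis using Suc by (simp del: of_nat_Suc)
      qed (use assms(2) h in simp)
      then show "fps_X ^ Suc n dvd h" unfolding fps_X_power_dvd_coeff by blast
    qed
  qed simp
  then show ?thesis
    using assms(3) by (intro fps_ext) (metis fps_X_power_dvd_coeff fps_zero_nth lessI)
qed

context frame_eqs
begin

text \<open>Along \<open>e\<^sub>l\<close> the functions \<open>x i, x j, f i l, f j l\<close> satisfy a homogeneous linear system of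
  differential equations. They vanish at \<open>p\<close>, hence so do their Taylor series along \<open>e\<^sub>l\<close>, and the
  Gauss equations reduce to identities between the Taylor series of \<open>f i i\<close>, \<open>f i j\<close> and \<open>t\<close>.\<close>

lemma critical_taylor:
  assumes ijl: "distinct [i, j, l]" and kl: "k l = 0" and p: "p \<in> W"
    and xp: "x i p = 0" "x j p = 0"
    and xl: "x l p \<noteq> 0"
  defines "K \<equiv> \<lambda>m. fps_const (k m)"
  defines "\<alpha> \<equiv> taylor l p (f i i)" and "\<beta> \<equiv> taylor l p (f i j)" and "t \<equiv> taylor l p (T i j l)"
    and "\<delta> \<equiv> K i - K j" and "s \<equiv> K i + K j" and "q \<equiv> K i * K j"
    and "c \<equiv> fps_const (C p)" and "\<xi> \<equiv> fps_const (x l p)"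
  shows "\<alpha>\<^sup>2 + \<beta>\<^sup>2 = 1" "\<xi>\<^sup>2 + c\<^sup>2 = 1"
    "\<delta> * fps_deriv \<alpha> = \<beta> * (2 * t + \<xi> * \<beta>)"
    "\<delta> * fps_deriv \<beta> = - \<alpha> * (2 * t + \<xi> * \<beta>)"
    "c * \<alpha> * q * s + 2 * q\<^sup>2 * \<delta> - q * \<delta> - 4 * t\<^sup>2 * \<delta> = 0"
    "2 * c * \<alpha> * K i * q * \<delta> + \<alpha>\<^sup>2 * (K j)\<^sup>2 * \<xi>\<^sup>2 - 4 * \<beta> * q * t * \<xi> - q * \<xi>\<^sup>2 - 2 * K i * q * \<delta> - 4 * (K i)\<^sup>2 * t\<^sup>2 = 0"
    "- 2 * c * \<alpha> * K j * q * \<delta> - \<alpha>\<^sup>2 * (K i)\<^sup>2 * \<xi>\<^sup>2 + 4 * \<beta> * q * t * \<xi> + q * \<xi>\<^sup>2 - 2 * K j * q * \<delta> + 4 * (K j)\<^sup>2 * t\<^sup>2 = 0"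
    "- c * \<beta> * q * s * \<delta> + \<alpha> * \<beta> * q * \<xi>\<^sup>2 + 2 * \<alpha> * t * \<xi> * (s\<^sup>2 - 3 * q) = 2 * q * \<delta> * fps_deriv t"
proof -
  have d: "i \<noteq> j" "j \<noteq> l" "i \<noteq> l" "j \<noteq> i" "l \<noteq> j" "l \<noteq> i" using ijl by auto
  note sum3 = sum_3_distinct[OF ijl]
  have kn: "k i \<noteq> 0" "k j \<noteq> 0" "k i \<noteq> k j"
    using k_neq[OF d(3)] k_neq[OF d(2)] k_neq[OF d(1)] kl by auto
  define \<tau> where "\<tau> = taylor l p"
  have tau2: "\<tau> (\<lambda>y. g y + h y) = \<tau> g + \<tau> h" "\<tau> (\<lambda>y. g y * h y) = \<tau> g * \<tau> h" "\<tau> (\<lambda>y. g y - h y) = \<tau> g - \<tau> h"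
    if "g \<in> S" "h \<in> S" for g h
    using that p unfolding \<tau>_def by (simp_all add: taylor_simps)
  have tau1: "\<tau> (\<lambda>y. - g y) = - \<tau> g" "\<tau> (\<lambda>y. (g y)\<^sup>2) = (\<tau> g)\<^sup>2" "\<tau> (\<lambda>y. g y / r) = \<tau> g * fps_const (1 / r)"
    if "g \<in> S" for g r
    using that p taylor_mult[OF that S_const[of "1 / r"] p, of l] unfolding \<tau>_def by (simp_all add: taylor_simps)
  note tau = tau1 tau2
  have tau_const: "\<tau> (\<lambda>_. r) = fps_const r" for r
    using p by (simp add: \<tau>_def)
  have tau_D: "\<tau> (D l g) = fps_deriv (\<tau> g)" for g
    by (simp add: \<tau>_def taylor_D)
  have tau_eq: "\<tau> g = \<tau> h" if "g \<in> S" "h \<in> S" "\<And>y. y \<in> W \<Longrightarrow> g y = h y" for g h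
    unfolding \<tau>_def by (rule taylor_cong[OF that p])
  define \<gamma> where "\<gamma> = (\<lambda>a b m. \<tau> (\<Gamma> a b m))"
  define X where "X = (\<lambda>a. \<tau> (x a))"
  define F where "F = (\<lambda>a b. \<tau> (f a b))"
  note folds = \<gamma>_def[THEN fun_cong, THEN fun_cong, THEN fun_cong, symmetric]
    X_def[THEN fun_cong, symmetric] F_def[THEN fun_cong, THEN fun_cong, symmetric]
  define kr :: "3 \<Rightarrow> 3 \<Rightarrow> real fps" where "kr = (\<lambda>a b. if a = b then 1 else 0)"
  have krc: "fps_const (kron a b) = kr a b" for a b by (simp add: kr_def)
  have DX: "\<tau> (D a (x b)) = \<gamma> a b i * X i + \<gamma> a b j * X j + \<gamma> a b l * X l + K a * (\<tau> C * kr a b - F a b)" for a b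
  proof -
    have "\<tau> (D a (x b)) = \<tau> (\<lambda>y. \<Gamma> a b i y * x i y + \<Gamma> a b j y * x j y + \<Gamma> a b l y * x l y + k a * (C y * kron a b - f a b y))"
      by (rule tau_eq) (simp_all add: D_x sum3)
    then show ?thesis by (simp add: tau tau_const krc K_def folds)
  qed
  have DF: "\<tau> (D a (f b m)) = \<gamma> a b i * F i m + \<gamma> a m i * F b i + (\<gamma> a b j * F j m + \<gamma> a m j * F b j) + (\<gamma> a b l * F l m + \<gamma> a m l * F b l)
     + K a * (kr a b * X m + kr a m * X b)" for a b m
  proof -
    have "\<tau> (D a (f b m)) = \<tau> (\<lambda>y. \<Gamma> a b i y * f i m y + \<Gamma> a m i y * f b i y + (\<Gamma> a b j y * f j m y + \<Gamma> a m j y * f b j y)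
       + (\<Gamma> a b l y * f l m y + \<Gamma> a m l y * f b l y) + k a * (kron a b * x m y + kron a m * x b y))"
      by (rule tau_eq) (simp_all add: D_f sum3)
    then show ?thesis by (simp add: tau tau_const krc K_def folds)
  qed
  have Fs: "F a b = F b a" for a b
    unfolding F_def by (rule tau_eq) (simp_all add: f_sym[of _ a b])
  have Gs: "\<gamma> a b m = - \<gamma> a m b" for a b m
  proof -
    have "\<gamma> a b m = \<tau> (\<lambda>y. - \<Gamma> a m b y)"
      unfolding \<gamma>_def by (rule tau_eq) (simp_all add: G_skew[of _ a b m])
    then show ?thesis by (simp add: tau \<gamma>_def)
  qed
  have G0: "\<gamma> a b b = 0" for a b
    using Gs[of a b b] by (simp add: eq_neg_iff_add_eq_0 flip: mult_2)
  \<comment> \<open>One half as a series, so that all identities stay polynomial for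
    \<open>algebra\<close>.\<close>
  define hf where "hf = fps_const (1 / 2 :: real)"
  have hf: "2 * hf = 1" by (simp add: hf_def numeral_fps_const)
  have G2: "(K b - K a) * \<gamma> a b a = (X a * F a b - X b * F a a) * hf" for a b
  proof -
    have "\<tau> (\<lambda>y. (k b - k a) * \<Gamma> a b a y) = \<tau> (\<lambda>y. (x a y * f a b y - x b y * f a a y) / 2)"
      by (rule tau_eq) (simp_all add: codazzi_2)
    then show ?thesis by (simp add: tau tau_const folds K_def hf_def)
  qed
  have GT: "(K b - K m) * \<gamma> a b m = \<tau> (T a b m) + X a * F b m * hf" for a b m
  proof -
    have "\<tau> (\<lambda>y. (k b - k m) * \<Gamma> a b m y) = \<tau> (\<lambda>y. T a b m y + x a y * f b m y / 2)"
      by (rule tau_eq) (simp_all add: G_T)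
    then show ?thesis by (simp add: tau tau_const folds K_def hf_def)
  qed
  have Kl: "K l = 0" by (simp add: K_def kl)
  define vi vj vd where "vi = fps_const (1 / k i)" "vj = fps_const (1 / k j)" "vd = fps_const (1 / (k i - k j))"
  have inv: "K i * vi = 1" "K j * vj = 1" "(K i - K j) * vd = 1"
    using kn by (simp_all add: K_def vi_vj_vd_def)
  have glil: "\<gamma> l i l = vi * hf * (X l * F i l - X i * F l l)" "\<gamma> l j l = vj * hf * (X l * F j l - X j * F l l)"
    using G2[of i l] G2[of j l] Fs[of l i] Fs[of l j] inv unfolding Kl by algebra+
  \<comment> \<open>Along \<open>e l\<close> the equations of these four series carry no curvature
    term because \<open>k l = 0\<close>. By \<open>glil\<close> the factors
    \<open>\<gamma> l i l\<close> and \<open>\<gamma> l j l\<close> are combinations of the four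
    series, which makes the system homogeneous.\<close>
  have gen0: "h = 0" if "h \<in> {X i, X j, F i l, F j l}" for h
  proof (rule fps_linear_ode_zero[OF _ _ that])
    fix g n assume g: "g \<in> {X i, X j, F i l, F j l}"
      and dv: "\<And>h. h \<in> {X i, X j, F i l, F j l} \<Longrightarrow> fps_X ^ n dvd h"
    have dv': "fps_X ^ n dvd X i" "fps_X ^ n dvd X j" "fps_X ^ n dvd F i l" "fps_X ^ n dvd F j l"
      using dv by auto
    have dg: "fps_X ^ n dvd \<gamma> l i l" "fps_X ^ n dvd \<gamma> l j l"
      unfolding glil using dv' by (auto intro!: dvd_mult dvd_diff dvd_mult2)
    have "fps_deriv (X i) = \<gamma> l i j * X j + \<gamma> l i l * X l"
      "fps_deriv (X j) = \<gamma> l j i * X i + \<gamma> l j l * X l"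
      using DX[of l i] DX[of l j] unfolding tau_D folds Kl G0 by simp_all
    moreover have "fps_deriv (F i l) = \<gamma> l i j * F j l + \<gamma> l i l * F l l - \<gamma> l i l * F i i - \<gamma> l j l * F i j"
      "fps_deriv (F j l) = \<gamma> l j i * F i l + \<gamma> l j l * F l l - \<gamma> l i l * F j i - \<gamma> l j l * F j j"
      using DF[of l i l] DF[of l j l] Gs[of l l i] Gs[of l l j] unfolding tau_D folds Kl G0 by simp_all
    ultimately show "fps_X ^ n dvd fps_deriv g"
      using g dv' dg by (auto intro!: dvd_add dvd_diff dvd_mult2 intro: dvd_mult)
  next
    fix g assume "g \<in> {X i, X j, F i l, F j l}"
    \<comment> \<open>At \<open>p\<close> the equations \<open>P_normal\<close> reduce to
      \<open>f i l * x l = 0\<close> and \<open>f j l * x l = 0\<close>.\<close>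
    moreover have "f i l p = 0" "f j l p = 0"
      using P_normal[OF p, of i] P_normal[OF p, of j] xp xl by (auto simp: sum3)
    ultimately show "fps_nth g 0 = 0"
      using xp by (auto simp: X_def F_def \<tau>_def taylor_nth_0)
  qed
  then have z: "X i = 0" "X j = 0" "F i l = 0" "F j l = 0" "F l i = 0" "F l j = 0"
    using Fs by auto
  have gz: "\<gamma> l i l = 0" "\<gamma> l j l = 0" "\<gamma> l l i = 0" "\<gamma> l l j = 0"
    using glil z Gs[of l l i] Gs[of l l j] by auto
  have "fps_deriv (\<tau> C) = 0"
  proof -
    have "\<tau> (D l C) = \<tau> (\<lambda>_. 0)" by (rule tau_eq) (simp_all add: D_C kl)
    then show ?thesis by (simp add: tau_D tau_const)
  qed
  then have tC: "\<tau> C = c"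
    unfolding fps_deriv_eq_0_iff c_def by (simp add: \<tau>_def taylor_nth_0)
  have "fps_deriv (X l) = 0"
    using DX[of l l] unfolding tau_D folds Kl G0 z gz by simp
  then have Xl: "X l = \<xi>"
    unfolding fps_deriv_eq_0_iff \<xi>_def by (simp add: X_def \<tau>_def taylor_nth_0)
  have xi_nz: "\<xi> \<noteq> 0" using xl by (simp add: \<xi>_def)
  \<comment> \<open>Cancelling \<open>\<xi>\<close> uses that formal power series form an integral
    domain.\<close>
  have Fll: "F l l = - c"
  proof -
    have "\<tau> (\<lambda>y. f l i y * x i y + f l j y * x j y + f l l y * x l y) = \<tau> (\<lambda>y. - C y * x l y)"
      using P_normal[of _ l] by (intro tau_eq) (simp_all add: sum3)
    then have "F l l * \<xi> = - c * \<xi>" by (simp add: tau folds z tC Xl)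
    then show ?thesis using xi_nz by (metis mult_right_cancel)
  qed
  have Fii: "F i i = \<alpha>" "F i j = \<beta>" "F j i = \<beta>"
    using Fs[of i j] by (simp_all add: F_def \<alpha>_def \<beta>_def \<tau>_def)
  \<comment> \<open>The trace \<open>- C\<close> is used up by \<open>F l l\<close>, so the block of
    \<open>F\<close> for \<open>i, j\<close> is symmetric and trace-free; together with
    \<open>P1\<close> it is a reflection, described by one angle.\<close>
  have Fjj: "F j j = - \<alpha>"
  proof -
    have "\<tau> (\<lambda>y. f i i y + f j j y + f l l y) = \<tau> (\<lambda>y. - C y)"
      using P_trace by (intro tau_eq) (simp_all add: sum3)
    then have "F i i + F j j + F l l = - \<tau> C" by (simp add: tau folds)
    then show ?thesis unfolding Fll tC Fii by (simp add: add_eq_0_iff2)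
  qed
  have Tt: "\<tau> (T i j l) = t" "\<tau> (T j i l) = t" "\<tau> (T l i j) = t"
  proof -
    show "\<tau> (T i j l) = t" by (simp add: t_def \<tau>_def)
    moreover have "\<tau> (T j i l) = \<tau> (T i j l)" "\<tau> (T l i j) = \<tau> (T i j l)"
      by (rule tau_eq; use T_sym in \<open>metis S_T\<close>)+
    ultimately show "\<tau> (T j i l) = t" "\<tau> (T l i j) = t" by simp_all
  qed
  show P1: "\<alpha>\<^sup>2 + \<beta>\<^sup>2 = 1"
  proof -
    have "\<tau> (\<lambda>y. f i i y * f i i y + f i j y * f j i y + f i l y * f l i y + x i y * x i y) = \<tau> (\<lambda>y. 1)"
      using P_square[of _ i i] by (intro tau_eq) (simp_all add: sum3)
    then show ?thesis by (simp add: tau tau_const folds z Fii power2_eq_square)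
  qed
  show P2: "\<xi>\<^sup>2 + c\<^sup>2 = 1"
  proof -
    have "(x l p)\<^sup>2 + (C p)\<^sup>2 = 1" using P_unit[OF p] by (simp add: sum3 xp)
    then show ?thesis by (simp add: \<xi>_def c_def fps_const_power flip: fps_const_add)
  qed
  have g1: "\<gamma> i j i = 0" "\<gamma> j i j = 0" "\<gamma> i i j = 0" "\<gamma> j j i = 0"
  proof -
    have "K i - K j \<noteq> 0" using inv(3) by auto
    then show "\<gamma> i j i = 0" "\<gamma> j i j = 0" using G2[of j i] G2[of i j] by (auto simp: z)
    then show "\<gamma> i i j = 0" "\<gamma> j j i = 0" using Gs[of i i j] Gs[of j j i] by auto
  qed
  have g2: "\<gamma> i l i = vi * hf * \<xi> * \<alpha>" "\<gamma> j l j = - vj * hf * \<xi> * \<alpha>"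
    using G2[of l i] G2[of l j] inv unfolding z Xl Fii Fjj Kl by algebra+
  have g3: "\<gamma> i j l = vj * t" "\<gamma> j i l = vi * t" "\<gamma> l i j = vd * (t + \<xi> * \<beta> * hf)"
    using GT[of j l i] GT[of i l j] GT[of i j l] inv unfolding z Xl Fii Fjj Kl Tt by algebra+
  have gs: "\<gamma> i i l = - \<gamma> i l i" "\<gamma> j j l = - \<gamma> j l j" "\<gamma> i l j = - \<gamma> i j l" "\<gamma> j l i = - \<gamma> j i l" "\<gamma> l j i = - \<gamma> l i j"
    by (rule Gs)+
  note vals = z gz g1 gs g2 g3 Fii Fjj Fll Xl tC Kl G0
  have Kc: "fps_const (k i - k j) = K i - K j" "fps_const (k j - k i) = K j - K i" "fps_const (k i * k j) = K i * K j"
    "fps_const (k j * k i) = K i * K j" "fps_const (k i) = K i" "fps_const (k j) = K j" "fps_const (1 / 2) = hf"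
    "fps_const 2 = 2" "fps_const (- k i) = - K i" "fps_const (- k j) = - K j"
    by (simp_all add: K_def hf_def numeral_fps_const)
  have "fps_deriv \<alpha> = 2 * \<gamma> l i j * \<beta>"
    using DF[of l i i] unfolding tau_D folds Fii Kl G0 gz z by simp
  then show "\<delta> * fps_deriv \<alpha> = \<beta> * (2 * t + \<xi> * \<beta>)"
    unfolding \<delta>_def g3 using inv(3) hf by algebra
  have "fps_deriv \<beta> = - 2 * \<gamma> l i j * \<alpha>"
    using DF[of l i j] unfolding tau_D folds Fii Fjj gs Kl G0 gz z by simp
  then show "\<delta> * fps_deriv \<beta> = - \<alpha> * (2 * t + \<xi> * \<beta>)"
    unfolding \<delta>_def g3 using inv(3) hf by algebra
  have dil: "distinct [i, l, j]" and djl: "distinct [j, l, i]" and dlij: "distinct [l, i, j]" using d by auto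
  note alg = inv hf P1 P2 \<delta>_def s_def q_def
  \<comment> \<open>The defect is zero as a function on \<open>W\<close>, hence so is its series;
    the three planes give the three algebraic relations.\<close>
  have tg: "\<tau> (gauss_defect a b m) = 0" if "distinct [a, b, m]" for a b m
  proof -
    have "\<tau> (gauss_defect a b m) = \<tau> (\<lambda>_. 0)"
      using that by (intro tau_eq) (simp_all add: gauss_defect_eq_0)
    then show ?thesis by (simp add: tau_const)
  qed
  show "c * \<alpha> * q * s + 2 * q\<^sup>2 * \<delta> - q * \<delta> - 4 * t\<^sup>2 * \<delta> = 0"
    using tg[OF ijl] unfolding gauss_defect_def
    by (simp add: tau tau_const folds) (simp add: vals kl Kc, use alg in algebra)
  show "2 * c * \<alpha> * K i * q * \<delta> + \<alpha>\<^sup>2 * (K j)\<^sup>2 * \<xi>\<^sup>2 - 4 * \<beta> * q * t * \<xi> - q * \<xi>\<^sup>2 - 2 * K i * q * \<delta> - 4 * (K i)\<^sup>2 * t\<^sup>2 = 0"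
    using tg[OF dil] unfolding gauss_defect_def
    by (simp add: tau tau_const folds) (simp add: vals kl Kc, use alg in algebra)
  show "- 2 * c * \<alpha> * K j * q * \<delta> - \<alpha>\<^sup>2 * (K i)\<^sup>2 * \<xi>\<^sup>2 + 4 * \<beta> * q * t * \<xi> + q * \<xi>\<^sup>2 - 2 * K j * q * \<delta> + 4 * (K j)\<^sup>2 * t\<^sup>2 = 0"
    using tg[OF djl] unfolding gauss_defect_def
    by (simp add: tau tau_const folds) (simp add: vals kl Kc, use alg in algebra)
  \<comment> \<open>\<open>gauss_mixed\<close> with \<open>l\<close> in front gives the derivative
    of \<open>T\<close> along \<open>e l\<close> itself.\<close>
  have "\<tau> (D l (T l i j)) = \<tau> (\<lambda>y. - (D l (x i) y * f l j y + x i y * D l (f l j) y) / 2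
    + (D i (x l) y * f l j y + x l y * D i (f l j) y - D i (x j) y * f l l y - x j y * D i (f l l) y) / 2
    - (k j - k l) * (\<Gamma> i j i y * \<Gamma> l i l y
        + \<Gamma> l j i y * \<Gamma> i l i y - \<Gamma> l i l y * \<Gamma> l j l y + \<Gamma> i l i y * \<Gamma> i j l y
        - (\<Gamma> l i j y - \<Gamma> i l j y) * \<Gamma> j j l y)
    + (k j - k l) * (f i j y * f l l y - f l j y * f l i y) / 2)"
    using gauss_mixed[OF dlij] by (intro tau_eq) simp_all
  then show "- c * \<beta> * q * s * \<delta> + \<alpha> * \<beta> * q * \<xi>\<^sup>2 + 2 * \<alpha> * t * \<xi> * (s\<^sup>2 - 3 * q) = 2 * q * \<delta> * fps_deriv t"
    by (simp add: tau tau_const folds tau_D DX DF Tt) (simp add: vals kl Kc kr_def d, use alg in algebra)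
qed

text \<open>Eliminating \<open>t\<close> from the three algebraic relations leaves a quadratic
  equation for \<open>\<alpha>\<close> with constant coefficients, which forces
  \<open>\<alpha>\<close> to be constant. Then \<open>\<beta> = 0\<close> or the angle of the pair
  \<open>\<alpha>, \<beta>\<close> does not move, and both cases reduce to equations between
  numbers.\<close>

lemma critical_values:
  assumes ijl: "distinct [i, j, l]" and kl: "k l = 0" and p: "p \<in> W"
    and xp: "x i p = 0" "x j p = 0"
    and xl: "x l p \<noteq> 0"
  shows "C p = 0" "2 * (k i * k j) = - 1"
proof -
  have d: "i \<noteq> j" "j \<noteq> l" "i \<noteq> l" "j \<noteq> i" "l \<noteq> j" "l \<noteq> i" using ijl by auto
  have kn: "k i \<noteq> 0" "k j \<noteq> 0" "k i \<noteq> k j"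
    using k_neq[OF d(3)] k_neq[OF d(2)] k_neq[OF d(1)] kl by auto
  define \<alpha> \<beta> t where "\<alpha> = taylor l p (f i i)" "\<beta> = taylor l p (f i j)" "t = taylor l p (T i j l)"
  define \<xi> c Ki Kj where "\<xi> = fps_const (x l p)" "c = fps_const (C p)" "Ki = fps_const (k i)" "Kj = fps_const (k j)"
  define \<delta> s q where "\<delta> = Ki - Kj" "s = Ki + Kj" "q = Ki * Kj"
  note eqs = critical_taylor[OF assms, folded \<alpha>_\<beta>_t_def \<xi>_c_Ki_Kj_def, folded \<delta>_s_q_def]
  have nz: "\<xi> \<noteq> 0" "Ki \<noteq> 0" "Kj \<noteq> 0" "\<delta> \<noteq> 0" "q \<noteq> 0"
    using xl kn by (auto simp: \<xi>_c_Ki_Kj_def \<delta>_s_q_def)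
  have cst: "fps_deriv \<xi> = 0" "fps_deriv c = 0" "fps_deriv Ki = 0" "fps_deriv Kj = 0" "fps_deriv \<delta> = 0"
      "fps_deriv s = 0" "fps_deriv q = 0"
    by (simp_all add: \<xi>_c_Ki_Kj_def \<delta>_s_q_def)
  \<comment> \<open>The sum of the relations of the two planes containing \<open>e l\<close> is
    divisible by \<open>\<delta>\<close>.\<close>
  have "\<delta> * (2 * c * \<alpha> * q * \<delta> - \<alpha>\<^sup>2 * \<xi>\<^sup>2 * s - 2 * q * s - 4 * t\<^sup>2 * s) = 0"
    using eqs(6,7) unfolding \<delta>_s_q_def by algebra
  then have S: "2 * c * \<alpha> * q * \<delta> - \<alpha>\<^sup>2 * \<xi>\<^sup>2 * s - 2 * q * s - 4 * t\<^sup>2 * s = 0"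
    using nz by simp
  \<comment> \<open>This is \<open>\<delta>\<close> times \<open>S\<close> minus \<open>s\<close>
    times the relation of the plane \<open>ij\<close>; the terms with \<open>t\<close>
    cancel.\<close>
  have Q: "c * q * (2 * \<delta>\<^sup>2 - s\<^sup>2) * \<alpha> - \<xi>\<^sup>2 * s * \<delta> * \<alpha>\<^sup>2 - q * s * \<delta> * (1 + 2 * q) = 0"
    using S eqs(5) by algebra
  have Q': "fps_deriv \<alpha> * (c * q * (2 * \<delta>\<^sup>2 - s\<^sup>2) - 2 * \<xi>\<^sup>2 * s * \<delta> * \<alpha>) = 0"
    using arg_cong[OF Q, of fps_deriv] by (simp add: cst power2_eq_square algebra_simps)
  \<comment> \<open>otherwise the coefficients of the quadratic equation \<open>Q\<close>, which are constant, vanish\<close>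
  have \<alpha>': "fps_deriv \<alpha> = 0"
  proof (rule ccontr)
    assume n: "fps_deriv \<alpha> \<noteq> 0"
    with Q' have lin: "c * q * (2 * \<delta>\<^sup>2 - s\<^sup>2) - 2 * \<xi>\<^sup>2 * s * \<delta> * \<alpha> = 0" by simp
    have "2 * \<xi>\<^sup>2 * s * \<delta> * fps_deriv \<alpha> = 0"
      using arg_cong[OF lin, of fps_deriv] by (simp add: cst power2_eq_square algebra_simps)
    then have s0: "s = 0" using n nz by simp
    then have c0: "c = 0" using lin nz by simp
    \<comment> \<open>Up to the factor \<open>\<delta>\<close>, the speed at which the angle of the
      pair \<open>\<alpha>, \<beta>\<close> turns.\<close>
    define w where "w = 2 * t + \<xi> * \<beta>"
    have w: "\<delta> * fps_deriv \<alpha> = \<beta> * w" "\<delta> * fps_deriv \<beta> = - \<alpha> * w"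
      using eqs(3,4) by (simp_all add: w_def)
    have w_nz: "w \<noteq> 0" using w(1) n nz by auto
    have qi: "Kj = - Ki" using s0 unfolding \<delta>_s_q_def by (simp add: add_eq_0_iff)
    have tt: "4 * t\<^sup>2 = 2 * q\<^sup>2 - q"
    proof -
      have "\<delta> * (2 * q\<^sup>2 - q - 4 * t\<^sup>2) = 0" using eqs(5) s0 by algebra
      then show ?thesis using nz by simp
    qed
    \<comment> \<open>If \<open>t = 0\<close>, then \<open>2 * q = 1\<close>, whereas
      \<open>s = 0\<close> makes \<open>q\<close> minus a square.\<close>
    have "t \<noteq> 0"
    proof
      assume "t = 0"
      then have "q * (2 * q - 1) = 0" using tt by algebra
      then have "2 * q - 1 = 0" using nz by simp
      then have "2 * Ki\<^sup>2 + 1 = 0" unfolding \<delta>_s_q_def qi by algebra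
      then have "2 * (k i)\<^sup>2 + 1 = 0"
        using arg_cong[of "2 * Ki\<^sup>2 + 1" 0 "\<lambda>h. fps_nth h 0"] by (simp add: \<xi>_c_Ki_Kj_def power2_eq_square)
      then show False using zero_le_power2[of "k i"] by linarith
    qed
    moreover have "8 * t * fps_deriv t = 0"
      using arg_cong[OF tt, of fps_deriv] by (simp add: cst power2_eq_square algebra_simps)
    ultimately have t': "fps_deriv t = 0" by simp
    have "Ki\<^sup>2 * (\<alpha>\<^sup>2 * \<xi>\<^sup>2 + 4 * \<beta> * t * \<xi> + \<xi>\<^sup>2 + 4 * Ki\<^sup>2 - 4 * t\<^sup>2) = 0"
      using eqs(6) c0 unfolding \<delta>_s_q_def qi by algebra
    then have E: "\<alpha>\<^sup>2 * \<xi>\<^sup>2 + 4 * \<beta> * t * \<xi> + \<xi>\<^sup>2 + 4 * Ki\<^sup>2 - 4 * t\<^sup>2 = 0" using nz by simp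
    have "2 * \<alpha> * fps_deriv \<alpha> * \<xi>\<^sup>2 + 4 * fps_deriv \<beta> * t * \<xi> = 0"
      using arg_cong[OF E, of fps_deriv] by (simp add: cst t' power2_eq_square algebra_simps)
    \<comment> \<open>This forces \<open>\<beta> * \<xi> = 2 * t\<close>, hence a constant
      \<open>\<beta>\<close>, although neither \<open>\<alpha>\<close> nor the speed
      \<open>w\<close> is zero.\<close>
    then have "2 * (\<alpha> * w * \<xi> * (\<beta> * \<xi> - 2 * t)) = 0" using w by algebra
    moreover have "\<alpha> \<noteq> 0" using n by auto
    ultimately have bt: "\<beta> * \<xi> - 2 * t = 0" using w_nz nz by simp
    have "fps_deriv \<beta> * \<xi> = 0"
      using arg_cong[OF bt, of fps_deriv] by (simp add: cst t')
    then have "\<alpha> * w = 0" using w(2) nz(1) by (metis mult_eq_0_iff mult_zero_right neg_equal_0_iff_equal mult_minus_left)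
    then show False using \<open>\<alpha> \<noteq> 0\<close> w_nz by simp
  qed
  \<comment> \<open>With \<open>\<alpha>\<close> constant it is enough to compare constant terms,
    the values at \<open>p\<close>.\<close>
  define a b u x0 C0 k1 k2 where "a = fps_nth \<alpha> 0" "b = fps_nth \<beta> 0" "u = fps_nth t 0" "x0 = x l p" "C0 = C p" "k1 = k i" "k2 = k j"
  have vals: "fps_nth \<alpha> 0 = a" "fps_nth \<beta> 0 = b" "fps_nth t 0 = u" "fps_nth \<xi> 0 = x0" "fps_nth c 0 = C0"
    "fps_nth Ki 0 = k1" "fps_nth Kj 0 = k2"
    by (simp_all add: a_b_u_x0_C0_k1_k2_def \<xi>_c_Ki_Kj_def)
  note ev = arg_cong[of _ _ "\<lambda>h. fps_nth h 0"]
  have R: "a\<^sup>2 + b\<^sup>2 = 1" "x0\<^sup>2 + C0\<^sup>2 = 1"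
    "C0 * a * (k1 * k2) * (k1 + k2) + 2 * (k1 * k2)\<^sup>2 * (k1 - k2) - k1 * k2 * (k1 - k2) - 4 * u\<^sup>2 * (k1 - k2) = 0"
    "2 * C0 * a * k1 * (k1 * k2) * (k1 - k2) + a\<^sup>2 * k2\<^sup>2 * x0\<^sup>2 - 4 * b * (k1 * k2) * u * x0 - k1 * k2 * x0\<^sup>2 - 2 * k1 * (k1 * k2) * (k1 - k2) - 4 * k1\<^sup>2 * u\<^sup>2 = 0"
    "2 * C0 * a * (k1 * k2) * (k1 - k2) - a\<^sup>2 * x0\<^sup>2 * (k1 + k2) - 2 * (k1 * k2) * (k1 + k2) - 4 * u\<^sup>2 * (k1 + k2) = 0"
    "- C0 * b * (k1 * k2) * (k1 + k2) * (k1 - k2) + a * b * (k1 * k2) * x0\<^sup>2 + 2 * a * u * x0 * ((k1 + k2)\<^sup>2 - 3 * (k1 * k2))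
        = 2 * (k1 * k2) * (k1 - k2) * fps_nth (fps_deriv t) 0"
    using ev[OF eqs(1)] ev[OF eqs(2)] ev[OF eqs(5)] ev[OF eqs(6)] ev[OF S] ev[OF eqs(8)]
    by (simp_all add: vals \<delta>_s_q_def power2_eq_square)
  have rn: "k1 \<noteq> 0" "k2 \<noteq> 0" "k1 \<noteq> k2" "x0 \<noteq> 0" using kn xl by (simp_all add: a_b_u_x0_C0_k1_k2_def)
  have "\<beta> * (2 * t + \<xi> * \<beta>) = 0" using eqs(3) \<alpha>' by simp
  then consider "\<beta> = 0" | "2 * t + \<xi> * \<beta> = 0" "\<beta> \<noteq> 0" by auto
  then have "C0 = 0 \<and> 2 * (k1 * k2) = - 1"
  proof cases
    case 1
    then have "\<alpha> * (2 * t) = 0" using eqs(4) by simp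
    moreover have "\<alpha> \<noteq> 0" using eqs(1) 1 by auto
    ultimately have "t = 0" by simp
    then have z: "u = 0" "b = 0" using 1 by (simp_all add: a_b_u_x0_C0_k1_k2_def)
    then have a1: "a\<^sup>2 = 1" using R(1) by simp
    \<comment> \<open>Since \<open>a\<close> squares to 1, the square of \<open>x0\<close> is
      \<open>(1 - C0 * a) * (1 + C0 * a)\<close>, and \<open>R(4)\<close> factors.\<close>
    have "(k2 * (k1 - k2)) * ((C0 * a - 1) * (2 * k1\<^sup>2 + 1 + C0 * a)) = 0"
      using R(4) R(2) a1 z by algebra
    then have "(C0 * a - 1) * (2 * k1\<^sup>2 + 1 + C0 * a) = 0" using rn by simp
    moreover have "\<bar>C0 * a\<bar> < 1"
    proof -
      have "(C0 * a)\<^sup>2 = 1 - x0\<^sup>2" using R(2) a1 by algebra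
      then have "(C0 * a)\<^sup>2 < 1" using rn by simp
      then show ?thesis by (simp add: abs_square_less_1)
    qed
    ultimately have "2 * k1\<^sup>2 + 1 + C0 * a = 0" by auto
    then show ?thesis using \<open>\<bar>C0 * a\<bar> < 1\<close> zero_le_power2[of k1] by linarith
  next
    case 2
    have "fps_deriv \<beta> = 0" using eqs(4) 2(1) nz(4) by (metis mult_eq_0_iff mult_zero_right)
    have "2 * fps_deriv t + \<xi> * fps_deriv \<beta> = 0"
      using arg_cong[OF 2(1), of fps_deriv] by (simp add: cst)
    then have "2 * fps_deriv t = 0"
      using \<open>fps_deriv \<beta> = 0\<close> by (metis add.right_neutral mult_zero_right)
    then have t': "fps_nth (fps_deriv t) 0 = 0"
      by (metis fps_zero_nth mult_eq_0_iff zero_neq_numeral)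
    have u: "2 * u = - x0 * b" using ev[OF 2(1)] by (simp add: vals add_eq_0_iff)
    have b: "b \<noteq> 0"
      using 2(2) \<open>fps_deriv \<beta> = 0\<close> unfolding fps_deriv_eq_0_iff by (auto simp: a_b_u_x0_C0_k1_k2_def)
    \<comment> \<open>Inserting \<open>2 * u = - x0 * b\<close> produces the discriminant
      \<open>(k1 + k2)^2 - 4 * k1 * k2\<close>, the square of \<open>k1 - k2\<close>.\<close>
    have "b * (k1 - k2) * (C0 * (k1 * k2) * (k1 + k2) + a * x0\<^sup>2 * (k1 - k2)) = 0"
      using R(6) u t' by algebra
    then have r1: "C0 * (k1 * k2) * (k1 + k2) + a * x0\<^sup>2 * (k1 - k2) = 0" using rn b by simp
    have "(k1 - k2) * (x0\<^sup>2 - 2 * (k1 * k2)\<^sup>2 + k1 * k2) = 0"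
      using R(3) R(1) u r1 by algebra
    then have r2: "x0\<^sup>2 = 2 * (k1 * k2)\<^sup>2 - k1 * k2" using rn by simp
    have "(k1 * k2) * (2 * C0 * a * (k1 - k2) - (k1 + k2) * (2 * (k1 * k2) + 1)) = 0"
      using R(5) R(1) u r2 by algebra
    then have r3: "2 * C0 * a * (k1 - k2) = (k1 + k2) * (2 * (k1 * k2) + 1)" using rn by simp
    \<comment> \<open>For \<open>k1 + k2 = 0\<close> the relations \<open>r1\<close> and
      \<open>r3\<close> say only \<open>a = 0\<close>, and \<open>R(4)\<close> must be used;
      otherwise \<open>r1\<close>, \<open>r2\<close>, \<open>r3\<close> and \<open>R(2)\<close>
      suffice.\<close>
    have "2 * (k1 * k2) = - 1"
    proof (cases "k1 + k2 = 0")
      case True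
      then have k2: "k2 = - k1" by simp
      have "a * (x0\<^sup>2 * (k1 - k2)) = 0" using r1 True by simp
      then have "a = 0" using rn by simp
      then have "k1\<^sup>2 * (x0\<^sup>2 - 2 * k1\<^sup>2) = 0"
        using R(4) R(1) u k2 \<open>a = 0\<close> by algebra
      then have "k1\<^sup>2 * (2 * k1\<^sup>2 - 1) = 0" using r2 k2 by algebra
      then show ?thesis using rn unfolding k2 by (simp add: power2_eq_square)
    next
      case False
      have "(k1 * k2) * ((k1 + k2) * (2 * (k1 * k2) + 1)) = 0"
        using r1 r2 r3 R(2) by algebra
      then show ?thesis using False rn by simp
    qed
    moreover from this have "x0\<^sup>2 = 1" using r2 by algebra
    ultimately show ?thesis using R(2) by simp
  qed
  then show "C p = 0" "2 * (k i * k j) = - 1" by (simp_all add: a_b_u_x0_C0_k1_k2_def)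
qed

end

section \<open>Calculus of smooth maps\<close>

lemma has_derivative_frechet:
  "f differentiable (at x) \<Longrightarrow> (f has_derivative frechet_derivative f (at x)) (at x)"
  using frechet_derivative_works by blast

lemma frechet_derivative_cong:
  assumes "open S" "x \<in> S" "f differentiable (at x)" "\<And>y. y \<in> S \<Longrightarrow> f y = g y"
  shows "frechet_derivative f (at x) = frechet_derivative g (at x)" "g differentiable (at x)"
proof -
  have "(g has_derivative frechet_derivative f (at x)) (at x)"
    using has_derivative_transform_within_open[OF has_derivative_frechet[OF assms(3)] assms(1,2)] assms(4) by blast
  then show "frechet_derivative f (at x) = frechet_derivative g (at x)" "g differentiable (at x)"
    by (rule frechet_derivative_at, rule differentiableI)
qed

lemma C_on_cong:
  assumes "open S" "\<And>x. x \<in> S \<Longrightarrow> f x = g x" "C_on n S f"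
  shows "C_on n S g"
  using assms(2,3)
proof (induction n arbitrary: f g)
  case 0
  then show ?case by (simp cong: continuous_on_cong)
next
  case (Suc n)
  have "frechet_derivative f (at x) = frechet_derivative g (at x)" "g differentiable (at x)" if "x \<in> S" for x
    using frechet_derivative_cong[OF assms(1) that, of f g] Suc.prems that by auto
  moreover have "C_on n S (\<lambda>x. frechet_derivative g (at x) v)" for v
    by (rule Suc.IH[of "\<lambda>x. frechet_derivative f (at x) v"]) (use Suc.prems calculation in simp_all)
  ultimately show ?case by simp
qed

lemma C_on_Suc_D: "C_on (Suc n) S f \<Longrightarrow> C_on n S f"
proof (induction n arbitrary: f)
  case 0
  then show ?case
    by (auto intro!: continuous_at_imp_continuous_on differentiable_imp_continuous_within)
qed auto

lemma C_on_subset: "C_on n S f \<Longrightarrow> T \<subseteq> S \<Longrightarrow> C_on n T f"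
  by (induction n arbitrary: f) (auto intro: continuous_on_subset)

lemma C_on_const: "C_on n S (\<lambda>_. c)"
  by (induction n arbitrary: c) simp_all

lemma C_on_bounded_linear:
  assumes "bounded_linear L" "open S" "C_on n S f"
  shows "C_on n S (\<lambda>x. L (f x))"
  using assms(3)
proof (induction n arbitrary: f)
  case 0
  then show ?case by (simp add: bounded_linear.continuous_on[OF assms(1)])
next
  case (Suc n)
  have d: "((\<lambda>x. L (f x)) has_derivative (\<lambda>v. L (frechet_derivative f (at x) v))) (at x)" if "x \<in> S" for x
    by (rule bounded_linear.has_derivative[OF assms(1) has_derivative_frechet]) (use Suc.prems that in simp)
  have "C_on n S (\<lambda>x. L (frechet_derivative f (at x) v))" for v
    using Suc by auto
  then have "C_on n S (\<lambda>x. frechet_derivative (\<lambda>x. L (f x)) (at x) v)" for v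
    by (rule C_on_cong[OF assms(2), rotated]) (simp add: frechet_derivative_at[OF d, symmetric])
  then show ?case using differentiableI[OF d] by simp
qed

lemma C_on_add:
  assumes "open S" "C_on n S f" "C_on n S g"
  shows "C_on n S (\<lambda>x. f x + g x)"
  using assms(2,3)
proof (induction n arbitrary: f g)
  case 0
  then show ?case by (auto intro: continuous_on_add)
next
  case (Suc n)
  have d: "((\<lambda>x. f x + g x) has_derivative (\<lambda>v. frechet_derivative f (at x) v + frechet_derivative g (at x) v)) (at x)"
    if "x \<in> S" for x
    by (intro has_derivative_add has_derivative_frechet) (use Suc.prems that in simp_all)
  have "C_on n S (\<lambda>x. frechet_derivative f (at x) v + frechet_derivative g (at x) v)" for v
    using Suc by auto
  then have "C_on n S (\<lambda>x. frechet_derivative (\<lambda>x. f x + g x) (at x) v)" for v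
    by (rule C_on_cong[OF assms(1), rotated]) (simp add: frechet_derivative_at[OF d, symmetric])
  then show ?case using differentiableI[OF d] by simp
qed

lemma C_on_bounded_bilinear:
  assumes "bounded_bilinear B" "open S" "C_on n S f" "C_on n S g"
  shows "C_on n S (\<lambda>x. B (f x) (g x))"
  using assms(3,4)
proof (induction n arbitrary: f g)
  case 0
  then show ?case by (simp add: bounded_bilinear.continuous_on[OF assms(1)])
next
  case (Suc n)
  have d: "((\<lambda>x. B (f x) (g x)) has_derivative (\<lambda>v. B (f x) (frechet_derivative g (at x) v) + B (frechet_derivative f (at x) v) (g x))) (at x)"
    if "x \<in> S" for x
    by (intro bounded_bilinear.FDERIV[OF assms(1)] has_derivative_frechet) (use Suc.prems that in simp_all)
  have "C_on n S (\<lambda>x. B (f x) (frechet_derivative g (at x) v) + B (frechet_derivative f (at x) v) (g x))" for v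
    using Suc C_on_Suc_D[OF Suc.prems(1)] C_on_Suc_D[OF Suc.prems(2)] by (intro C_on_add[OF assms(2)] Suc.IH) auto
  then have "C_on n S (\<lambda>x. frechet_derivative (\<lambda>x. B (f x) (g x)) (at x) v)" for v
    by (rule C_on_cong[OF assms(2), rotated]) (simp add: frechet_derivative_at[OF d, symmetric])
  then show ?case using differentiableI[OF d] by simp
qed

text \<open>The function \<open>h = inverse (sqrt f)\<close> has derivative
  \<open>- 1/2 * h * h * h\<close> times that of \<open>f\<close>, so its derivative is a product of
  functions already covered by the induction hypothesis.\<close>

lemma C_on_inverse_sqrt:
  fixes f :: "'a::real_normed_vector \<Rightarrow> real"
  assumes "open S" "\<And>x. x \<in> S \<Longrightarrow> f x > 0" "C_on n S f"
  shows "C_on n S (\<lambda>x. inverse (sqrt (f x)))"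
  using assms(3)
proof (induction n)
  case 0
  have "sqrt (f x) \<noteq> 0" if "x \<in> S" for x using assms(2)[OF that] by simp
  with 0 show ?case by (auto intro!: continuous_on_inverse continuous_on_real_sqrt)
next
  case (Suc n)
  define h where "h = (\<lambda>x. inverse (sqrt (f x)))"
  have d: "(h has_derivative (\<lambda>v. (- 1 / 2) * (frechet_derivative f (at x) v * (h x * (h x * h x))))) (at x)"
    if "x \<in> S" for x
  proof -
    have fx: "f x > 0" using assms(2) that .
    have "((\<lambda>y. inverse (sqrt y)) has_field_derivative - (1 / 2) * (h x * (h x * h x))) (at (f x))"
      using fx unfolding h_def by (auto intro!: derivative_eq_intros simp: field_simps)
    moreover have "(f has_derivative frechet_derivative f (at x)) (at x)"
      using Suc.prems that has_derivative_frechet by auto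
    ultimately have "((\<lambda>y. inverse (sqrt (f y))) has_derivative
        (\<lambda>v. - (1 / 2) * (h x * (h x * h x)) * frechet_derivative f (at x) v)) (at x)"
      unfolding has_field_derivative_def by (rule has_derivative_compose[rotated])
    then show ?thesis by (simp add: h_def mult_ac)
  qed
  have "C_on n S h" using Suc C_on_Suc_D by (auto simp: h_def)
  then have H: "C_on n S (\<lambda>x. (- 1 / 2) * (frechet_derivative f (at x) v * (h x * (h x * h x))))" for v
    using Suc.prems by (intro C_on_bounded_bilinear[OF bounded_bilinear_mult assms(1)] C_on_const) auto
  have "C_on n S (\<lambda>x. frechet_derivative h (at x) v)" for v
    by (rule C_on_cong[OF assms(1) _ H[of v]]) (simp add: frechet_derivative_at[OF d, symmetric])
  then have "C_on (Suc n) S h" using differentiableI[OF d] by simp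
  then show ?case by (simp add: h_def)
qed

lemma smooth_on_differentiable: "smooth_on S f \<Longrightarrow> x \<in> S \<Longrightarrow> f differentiable (at x)"
  unfolding smooth_on_def using C_on.simps(2)[of 0 S f] by blast

lemma smooth_on_deriv: "smooth_on S f \<Longrightarrow> smooth_on S (\<lambda>x. frechet_derivative f (at x) v)"
  unfolding smooth_on_def using C_on.simps(2) by blast

lemma smooth_on_continuous: "smooth_on S f \<Longrightarrow> continuous_on S f"
  unfolding smooth_on_def using C_on.simps(1) by blast

lemma smooth_on_cong: "smooth_on S f \<Longrightarrow> open S \<Longrightarrow> (\<And>x. x \<in> S \<Longrightarrow> f x = g x) \<Longrightarrow> smooth_on S g"
  unfolding smooth_on_def using C_on_cong by blast

lemma smooth_on_subset: "smooth_on S f \<Longrightarrow> T \<subseteq> S \<Longrightarrow> smooth_on T f"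
  unfolding smooth_on_def using C_on_subset by blast

lemma smooth_on_const: "smooth_on S (\<lambda>_. c)"
  unfolding smooth_on_def using C_on_const by blast

lemma smooth_on_bounded_linear: "bounded_linear L \<Longrightarrow> open S \<Longrightarrow> smooth_on S f \<Longrightarrow> smooth_on S (\<lambda>x. L (f x))"
  unfolding smooth_on_def using C_on_bounded_linear by blast

lemma smooth_on_add: "open S \<Longrightarrow> smooth_on S f \<Longrightarrow> smooth_on S g \<Longrightarrow> smooth_on S (\<lambda>x. f x + g x)"
  unfolding smooth_on_def using C_on_add by blast

lemma smooth_on_bounded_bilinear:
  "bounded_bilinear B \<Longrightarrow> open S \<Longrightarrow> smooth_on S f \<Longrightarrow> smooth_on S g \<Longrightarrow> smooth_on S (\<lambda>x. B (f x) (g x))"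
  unfolding smooth_on_def using C_on_bounded_bilinear by blast

lemma smooth_on_inverse_sqrt:
  fixes f :: "'a::real_normed_vector \<Rightarrow> real"
  shows "open S \<Longrightarrow> (\<And>x. x \<in> S \<Longrightarrow> f x > 0) \<Longrightarrow> smooth_on S f \<Longrightarrow> smooth_on S (\<lambda>x. inverse (sqrt (f x)))"
  unfolding smooth_on_def using C_on_inverse_sqrt by blast

lemmas smooth_on_mult = smooth_on_bounded_bilinear[OF bounded_bilinear_mult]
  and smooth_on_scaleR = smooth_on_bounded_bilinear[OF bounded_bilinear_scaleR]
  and smooth_on_inner = smooth_on_bounded_bilinear[OF bounded_bilinear_inner]

lemma smooth_on_sum:
  assumes "open S" "\<And>i. i \<in> I \<Longrightarrow> smooth_on S (f i)"
  shows "smooth_on S (\<lambda>x. \<Sum>i\<in>I. f i x)"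
  using assms(2) by (induction I rule: infinite_finite_induct) (auto intro: smooth_on_const smooth_on_add assms(1))

lemma smooth_on_uminus: "open S \<Longrightarrow> smooth_on S f \<Longrightarrow> smooth_on S (\<lambda>x. - f x)"
  using smooth_on_bounded_linear[OF bounded_linear_minus[OF bounded_linear_ident]] .

lemma smooth_on_diff: "open S \<Longrightarrow> smooth_on S f \<Longrightarrow> smooth_on S g \<Longrightarrow> smooth_on S (\<lambda>x. f x - g x)"
  using smooth_on_add[of S f "\<lambda>x. - g x"] smooth_on_uminus[of S g] by simp

lemma smooth_on_prod:
  fixes f :: "'i \<Rightarrow> 'a::real_normed_vector \<Rightarrow> real"
  assumes "open S" "\<And>i. i \<in> I \<Longrightarrow> smooth_on S (f i)"
  shows "smooth_on S (\<lambda>x. \<Prod>i\<in>I. f i x)"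
  using assms(2) by (induction I rule: infinite_finite_induct) (auto intro: smooth_on_const smooth_on_mult assms(1))

text \<open>The reciprocal of \<open>f\<close> is \<open>f\<close> times the squared inverse root of
  \<open>f * f\<close>, which works for either sign of \<open>f\<close>.\<close>

lemma smooth_on_inverse:
  fixes f :: "'a::real_normed_vector \<Rightarrow> real"
  assumes "open S" "\<And>x. x \<in> S \<Longrightarrow> f x \<noteq> 0" "smooth_on S f"
  shows "smooth_on S (\<lambda>x. inverse (f x))"
proof -
  define h where "h = (\<lambda>x. inverse (sqrt (f x * f x)))"
  have "smooth_on S h" unfolding h_def
    using assms by (intro smooth_on_inverse_sqrt smooth_on_mult) (auto simp: zero_less_mult_iff linorder_neq_iff)
  then have "smooth_on S (\<lambda>x. f x * (h x * h x))" using assms by (intro smooth_on_mult)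
  then show ?thesis
    by (rule smooth_on_cong[OF _ assms(1)]) (use assms(2) in \<open>simp add: h_def field_simps\<close>)
qed

lemma smooth_on_vec_lambda:
  fixes f :: "'i::finite \<Rightarrow> 'a::real_normed_vector \<Rightarrow> real"
  assumes "open S" "\<And>i. smooth_on S (f i)"
  shows "smooth_on S (\<lambda>x. \<chi> i. f i x)"
proof -
  have "smooth_on S (\<lambda>x. \<Sum>i\<in>UNIV. f i x *\<^sub>R axis i (1::real))"
    using assms by (intro smooth_on_sum smooth_on_scaleR smooth_on_const) auto
  then show ?thesis
    by (rule smooth_on_cong[OF _ assms(1)]) (simp add: vec_eq_iff axis_def if_distrib cong: if_cong)
qed

text \<open>The direction varies with the point, so the derivative is expanded over constant
  directions, for which \<open>smooth_on_deriv\<close> applies.\<close>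

lemma smooth_on_directional:
  fixes u :: "real ^ 'n::finite \<Rightarrow> real ^ 'n" and f :: "real ^ 'n \<Rightarrow> 'b::real_normed_vector"
  assumes "open S" "smooth_on S f" "smooth_on S u"
  shows "smooth_on S (\<lambda>x. frechet_derivative f (at x) (u x))"
proof -
  have "smooth_on S (\<lambda>x. \<Sum>i\<in>UNIV. (u x $ i) *\<^sub>R frechet_derivative f (at x) (axis i 1))"
    using assms by (intro smooth_on_sum smooth_on_scaleR smooth_on_deriv smooth_on_bounded_linear[OF bounded_linear_vec_nth]) auto
  then show ?thesis
  proof (rule smooth_on_cong[OF _ assms(1)])
    fix x assume "x \<in> S"
    then have lin: "linear (frechet_derivative f (at x))"
      using smooth_on_differentiable[OF assms(2)] linear_frechet_derivative by blast
    have "(\<Sum>i\<in>UNIV. (u x $ i) *\<^sub>R axis i 1) = u x"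
      by (simp add: vec_eq_iff axis_def if_distrib cong: if_cong)
    then have "frechet_derivative f (at x) (u x) = frechet_derivative f (at x) (\<Sum>i\<in>UNIV. (u x $ i) *\<^sub>R axis i 1)"
      by (simp only:)
    also have "\<dots> = (\<Sum>i\<in>UNIV. frechet_derivative f (at x) ((u x $ i) *\<^sub>R axis i 1))"
      by (rule linear_sum[OF lin])
    finally show "(\<Sum>i\<in>UNIV. (u x $ i) *\<^sub>R frechet_derivative f (at x) (axis i 1)) = frechet_derivative f (at x) (u x)"
      by (simp add: linear_scale[OF lin])
  qed
qed

text \<open>The mean value theorem along \<open>v\<close> and then along \<open>w\<close>. The
  difference on the left is symmetric in \<open>v\<close> and \<open>w\<close>, while the derivative
  on the right is taken in a definite order.\<close>

lemma second_difference_mvt: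
  fixes f :: "'a::real_normed_vector \<Rightarrow> real"
  assumes "smooth_on S f" and "h > 0"
    and sub: "\<And>s t. 0 \<le> s \<Longrightarrow> s \<le> h \<Longrightarrow> 0 \<le> t \<Longrightarrow> t \<le> h \<Longrightarrow> x + s *\<^sub>R v + t *\<^sub>R w \<in> S"
  obtains y where "norm (y - x) \<le> h * (norm v + norm w)" "y \<in> S"
    "f (x + h *\<^sub>R v + h *\<^sub>R w) - f (x + h *\<^sub>R v) - f (x + h *\<^sub>R w) + f x
       = h * h * frechet_derivative (\<lambda>y. frechet_derivative f (at y) v) (at y) w"
proof -
  have der: "((\<lambda>s. g (a + s *\<^sub>R u)) has_real_derivative frechet_derivative g (at (a + s *\<^sub>R u)) u) (at s)"
    if g: "smooth_on S g" and "a + s *\<^sub>R u \<in> S" for g :: "'a \<Rightarrow> real" and a u s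
  proof -
    have d: "g differentiable (at (a + s *\<^sub>R u))" using smooth_on_differentiable that by blast
    have "((\<lambda>s. a + s *\<^sub>R u) has_derivative (\<lambda>r. r *\<^sub>R u)) (at s)"
      by (auto intro!: derivative_eq_intros)
    from has_derivative_compose[OF this has_derivative_frechet[OF d]]
    have "((\<lambda>s. g (a + s *\<^sub>R u)) has_derivative (\<lambda>r. frechet_derivative g (at (a + s *\<^sub>R u)) (r *\<^sub>R u))) (at s)" .
    moreover have "(\<lambda>r. frechet_derivative g (at (a + s *\<^sub>R u)) (r *\<^sub>R u)) = (*) (frechet_derivative g (at (a + s *\<^sub>R u)) u)"
      using linear_scale[OF linear_frechet_derivative[OF d]] by (auto simp: mult.commute)
    ultimately show ?thesis by (simp add: has_field_derivative_def)
  qed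
  define g where "g = (\<lambda>y. frechet_derivative f (at y) v)"
  have g: "smooth_on S g" unfolding g_def by (rule smooth_on_deriv[OF assms(1)])
  define \<phi> where "\<phi> = (\<lambda>s. f (x + h *\<^sub>R w + s *\<^sub>R v) - f (x + s *\<^sub>R v))"
  have "\<exists>s>0. s < h \<and> \<phi> h - \<phi> 0 = (h - 0) * (g (x + h *\<^sub>R w + s *\<^sub>R v) - g (x + s *\<^sub>R v))"
  proof (rule MVT2[OF assms(2)])
    fix s assume s: "0 \<le> s" "s \<le> h"
    have "x + h *\<^sub>R w + s *\<^sub>R v \<in> S" "x + s *\<^sub>R v \<in> S"
      using sub[of s h] sub[of s 0] s assms(2) by (simp_all add: add_ac)
    then show "(\<phi> has_real_derivative g (x + h *\<^sub>R w + s *\<^sub>R v) - g (x + s *\<^sub>R v)) (at s)"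
      unfolding \<phi>_def g_def by (intro DERIV_diff der assms(1))
  qed
  then obtain s where s: "0 < s" "s < h" "\<phi> h - \<phi> 0 = h * (g (x + h *\<^sub>R w + s *\<^sub>R v) - g (x + s *\<^sub>R v))"
    by auto
  have "\<exists>t>0. t < h \<and> g (x + s *\<^sub>R v + h *\<^sub>R w) - g (x + s *\<^sub>R v + 0 *\<^sub>R w)
      = (h - 0) * frechet_derivative g (at (x + s *\<^sub>R v + t *\<^sub>R w)) w"
  proof (rule MVT2[OF assms(2)])
    fix t assume "0 \<le> t" "t \<le> h"
    then show "((\<lambda>t. g (x + s *\<^sub>R v + t *\<^sub>R w)) has_real_derivative frechet_derivative g (at (x + s *\<^sub>R v + t *\<^sub>R w)) w) (at t)"
      using sub[of s t] s by (intro der g) auto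
  qed
  then obtain t where t: "0 < t" "t < h"
    "g (x + s *\<^sub>R v + h *\<^sub>R w) - g (x + s *\<^sub>R v) = h * frechet_derivative g (at (x + s *\<^sub>R v + t *\<^sub>R w)) w"
    by auto
  show thesis
  proof (rule that)
    show "norm (x + s *\<^sub>R v + t *\<^sub>R w - x) \<le> h * (norm v + norm w)"
    proof -
      have "norm (s *\<^sub>R v + t *\<^sub>R w) \<le> s * norm v + t * norm w"
        using norm_triangle_ineq[of "s *\<^sub>R v" "t *\<^sub>R w"] s t by simp
      also have "\<dots> \<le> h * norm v + h * norm w"
        using s t by (intro add_mono mult_right_mono) auto
      finally show ?thesis by (simp add: algebra_simps)
    qed
    show "x + s *\<^sub>R v + t *\<^sub>R w \<in> S" using sub[of s t] s t by auto
    have "f (x + h *\<^sub>R v + h *\<^sub>R w) - f (x + h *\<^sub>R v) - f (x + h *\<^sub>R w) + f x = \<phi> h - \<phi> 0"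
      by (simp add: \<phi>_def add_ac)
    also have "\<dots> = h * (g (x + s *\<^sub>R v + h *\<^sub>R w) - g (x + s *\<^sub>R v))"
      using s(3) by (simp add: add_ac)
    also have "\<dots> = h * h * frechet_derivative g (at (x + s *\<^sub>R v + t *\<^sub>R w)) w"
      unfolding t(3) by simp
    finally show "f (x + h *\<^sub>R v + h *\<^sub>R w) - f (x + h *\<^sub>R v) - f (x + h *\<^sub>R w) + f x
       = h * h * frechet_derivative (\<lambda>y. frechet_derivative f (at y) v) (at (x + s *\<^sub>R v + t *\<^sub>R w)) w"
      unfolding g_def .
  qed
qed

text \<open>Exchanging \<open>v\<close> and \<open>w\<close> leaves the second difference unchanged,
  so the two mixed derivatives take a common value at points arbitrarily near \<open>x\<close>;
  continuity excludes a gap at \<open>x\<close>.\<close>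

lemma second_derivative_sym_real:
  fixes f :: "'a::real_normed_vector \<Rightarrow> real"
  assumes "smooth_on S f" "open S" "x \<in> S"
  shows "frechet_derivative (\<lambda>y. frechet_derivative f (at y) v) (at x) w
       = frechet_derivative (\<lambda>y. frechet_derivative f (at y) w) (at x) v"
proof (rule ccontr)
  define a where "a = (\<lambda>y. frechet_derivative (\<lambda>y. frechet_derivative f (at y) v) (at y) w)"
  define b where "b = (\<lambda>y. frechet_derivative (\<lambda>y. frechet_derivative f (at y) w) (at y) v)"
  assume "\<not> ?thesis"
  then have e: "dist (a x) (b x) / 2 > 0" (is "?e > 0") by (simp add: a_def b_def)
  have "continuous_on S a" "continuous_on S b"
    unfolding a_def b_def by (intro smooth_on_continuous smooth_on_deriv assms(1))+
  then obtain d1 d2 where d: "d1 > 0" "d2 > 0"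
    "\<And>y. y \<in> S \<Longrightarrow> dist y x < d1 \<Longrightarrow> dist (a y) (a x) < ?e"
    "\<And>y. y \<in> S \<Longrightarrow> dist y x < d2 \<Longrightarrow> dist (b y) (b x) < ?e"
    using e assms(3) unfolding continuous_on_iff by metis
  obtain r where r: "r > 0" "ball x r \<subseteq> S" using assms(2,3) open_contains_ball by blast
  define m where "m = min r (min d1 d2)"
  have m: "m > 0" "m \<le> r" "m \<le> d1" "m \<le> d2" using r d by (auto simp: m_def)
  \<comment> \<open>The summand 1 keeps the denominator positive when \<open>v\<close> and
    \<open>w\<close> are zero.\<close>
  define h where "h = m / (norm v + norm w + 1)"
  have h: "h > 0" unfolding h_def using m(1) by (intro divide_pos_pos) (auto intro: add_nonneg_pos)
  have hm: "h * (norm v + norm w) < m"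
  proof -
    have "h * (norm v + norm w + 1) = m" unfolding h_def by (simp add: add_nonneg_eq_0_iff)
    then show ?thesis using h by (simp add: distrib_left)
  qed
  have sub: "x + s *\<^sub>R v + t *\<^sub>R w \<in> S" if "0 \<le> s" "s \<le> h" "0 \<le> t" "t \<le> h" for s t
  proof -
    have "norm (s *\<^sub>R v + t *\<^sub>R w) \<le> s * norm v + t * norm w"
      using norm_triangle_ineq[of "s *\<^sub>R v" "t *\<^sub>R w"] that by simp
    also have "\<dots> \<le> h * norm v + h * norm w"
      using that by (intro add_mono mult_right_mono) auto
    also have "\<dots> < r" using hm m(2) by (simp add: distrib_left)
    finally have "dist (x + (s *\<^sub>R v + t *\<^sub>R w)) x < r" unfolding dist_norm by simp
    then have "x + (s *\<^sub>R v + t *\<^sub>R w) \<in> ball x r" by (simp add: dist_commute)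
    then show ?thesis using r(2) by (simp add: add_ac subset_iff)
  qed
  define \<Delta> where "\<Delta> = f (x + h *\<^sub>R v + h *\<^sub>R w) - f (x + h *\<^sub>R v) - f (x + h *\<^sub>R w) + f x"
  obtain y where y: "norm (y - x) \<le> h * (norm v + norm w)" "y \<in> S" "\<Delta> = h * h * a y"
    using second_difference_mvt[OF assms(1) h sub] unfolding \<Delta>_def a_def by blast
  have sub': "x + s *\<^sub>R w + t *\<^sub>R v \<in> S" if "0 \<le> s" "s \<le> h" "0 \<le> t" "t \<le> h" for s t
    using sub[of t s] that by (simp add: add_ac)
  have \<Delta>': "\<Delta> = f (x + h *\<^sub>R w + h *\<^sub>R v) - f (x + h *\<^sub>R w) - f (x + h *\<^sub>R v) + f x"
    by (simp add: \<Delta>_def add_ac)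
  obtain z where z: "norm (z - x) \<le> h * (norm w + norm v)" "z \<in> S" "\<Delta> = h * h * b z"
    using second_difference_mvt[OF assms(1) h sub'] unfolding \<Delta>' b_def by blast
  have "a y = b z" using y(3) z(3) h by simp
  moreover have "dist (a y) (a x) < ?e" "dist (b z) (b x) < ?e"
    using y z hm m d by (auto simp: dist_norm add.commute intro!: d)
  ultimately show False
    using dist_triangle2[of "a x" "b x" "a y"] by (simp add: dist_commute)
qed

lemma second_derivative_sym:
  fixes f :: "'a::real_normed_vector \<Rightarrow> 'b::euclidean_space"
  assumes "smooth_on S f" "open S" "x \<in> S"
  shows "frechet_derivative (\<lambda>y. frechet_derivative f (at y) v) (at x) w
       = frechet_derivative (\<lambda>y. frechet_derivative f (at y) w) (at x) v"
proof (rule euclidean_eqI)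
  fix b :: 'b
  have inner: "frechet_derivative (\<lambda>y. g y \<bullet> b) (at y) u = frechet_derivative g (at y) u \<bullet> b"
    if "smooth_on S g" "y \<in> S" for g :: "'a \<Rightarrow> 'b" and y u
  proof -
    have "((\<lambda>y. g y \<bullet> b) has_derivative (\<lambda>h. frechet_derivative g (at y) h \<bullet> b)) (at y)"
      by (intro has_derivative_inner_left has_derivative_frechet smooth_on_differentiable[OF that])
    from frechet_derivative_at[OF this, symmetric] show ?thesis by simp
  qed
  have sm: "smooth_on S (\<lambda>y. f y \<bullet> b)"
    by (intro smooth_on_inner smooth_on_const assms)
  have "frechet_derivative (\<lambda>y. frechet_derivative f (at y) v) (at x) w \<bullet> b
      = frechet_derivative (\<lambda>y. frechet_derivative (\<lambda>y. f y \<bullet> b) (at y) v) (at x) w" for v w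
  proof -
    have "frechet_derivative (\<lambda>y. frechet_derivative f (at y) v) (at x) w \<bullet> b
        = frechet_derivative (\<lambda>y. frechet_derivative f (at y) v \<bullet> b) (at x) w"
      by (rule inner[symmetric]) (use assms smooth_on_deriv in auto)
    also have "\<dots> = frechet_derivative (\<lambda>y. frechet_derivative (\<lambda>y. f y \<bullet> b) (at y) v) (at x) w"
      by (intro fun_cong[OF frechet_derivative_cong(1)[OF assms(2,3)]] smooth_on_differentiable[OF _ assms(3)]
            smooth_on_inner smooth_on_const smooth_on_deriv assms) (simp add: inner assms)
    finally show ?thesis .
  qed
  then show "frechet_derivative (\<lambda>y. frechet_derivative f (at y) v) (at x) w \<bullet> b
      = frechet_derivative (\<lambda>y. frechet_derivative f (at y) w) (at x) v \<bullet> b"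
    using second_derivative_sym_real[OF sm assms(2,3)] by simp
qed

section \<open>Derivatives along vector fields and their commutators\<close>

definition along :: "('a::real_normed_vector \<Rightarrow> 'a) \<Rightarrow> ('a \<Rightarrow> 'b::real_normed_vector) \<Rightarrow> 'a \<Rightarrow> 'b" where
  "along u f = (\<lambda>x. frechet_derivative f (at x) (u x))"

lemma along_cong:
  assumes "open S" "smooth_on S f" "\<And>y. y \<in> S \<Longrightarrow> f y = g y" "x \<in> S"
  shows "along u f x = along u g x"
  unfolding along_def using frechet_derivative_cong(1)[OF assms(1,4) smooth_on_differentiable[OF assms(2,4)]] assms(3) by simp

lemma along_const [simp]: "along u (\<lambda>_. c) x = 0"
  by (simp add: along_def)

lemma along_bounded_bilinear:
  assumes "bounded_bilinear B" "smooth_on S f" "smooth_on S g" "x \<in> S"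
  shows "along u (\<lambda>y. B (f y) (g y)) x = B (along u f x) (g x) + B (f x) (along u g x)"
  using fun_cong[OF frechet_derivative_at[OF bounded_bilinear.FDERIV[OF assms(1) has_derivative_frechet has_derivative_frechet]], of f x g "u x"]
    smooth_on_differentiable[OF assms(2,4)] smooth_on_differentiable[OF assms(3,4)]
  unfolding along_def by (simp add: add.commute)

lemmas along_mult = along_bounded_bilinear[OF bounded_bilinear_mult]
  and along_scaleR = along_bounded_bilinear[OF bounded_bilinear_scaleR]
  and along_inner = along_bounded_bilinear[OF bounded_bilinear_inner]

lemma along_add:
  assumes "smooth_on S f" "smooth_on S g" "x \<in> S"
  shows "along u (\<lambda>y. f y + g y) x = along u f x + along u g x"
  using fun_cong[OF frechet_derivative_at[OF has_derivative_add[OF has_derivative_frechet has_derivative_frechet]], of f x g "u x"]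
    smooth_on_differentiable[OF assms(1,3)] smooth_on_differentiable[OF assms(2,3)]
  unfolding along_def by simp

lemma along_bounded_linear:
  assumes "bounded_linear L" "smooth_on S f" "x \<in> S"
  shows "along u (\<lambda>y. L (f y)) x = L (along u f x)"
  using fun_cong[OF frechet_derivative_at[OF bounded_linear.has_derivative[OF assms(1) has_derivative_frechet]], of f x "u x"]
    smooth_on_differentiable[OF assms(2,3)]
  unfolding along_def by simp

lemma along_sum:
  assumes "open S" "\<And>i. i \<in> I \<Longrightarrow> smooth_on S (f i)" "x \<in> S"
  shows "along u (\<lambda>y. \<Sum>i\<in>I. f i y) x = (\<Sum>i\<in>I. along u (f i) x)"
  using assms(2)
  by (induction I rule: infinite_finite_induct) (simp_all add: along_add[OF _ smooth_on_sum[OF assms(1)] assms(3)])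

lemma smooth_on_along:
  fixes u :: "real ^ 'n::finite \<Rightarrow> real ^ 'n"
  shows "open S \<Longrightarrow> smooth_on S f \<Longrightarrow> smooth_on S u \<Longrightarrow> smooth_on S (along u f)"
  unfolding along_def by (rule smooth_on_directional)

text \<open>Product rule in coordinates: one term with \<open>v\<close> frozen at \<open>x\<close>,
  a pure second derivative, and one where only \<open>v\<close> is differentiated.\<close>

lemma along_along:
  fixes f :: "real ^ 'n::finite \<Rightarrow> 'b::real_normed_vector"
  assumes "open S" "smooth_on S f" "smooth_on S v" "x \<in> S"
  shows "along u (along v f) x = along u (\<lambda>y. frechet_derivative f (at y) (v x)) x + frechet_derivative f (at x) (along u v x)"
proof -
  define F where "F = (\<lambda>i y. frechet_derivative f (at y) (axis i 1))"
  have F: "smooth_on S (F i)" for i unfolding F_def by (rule smooth_on_deriv[OF assms(2)])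
  have exp: "frechet_derivative f (at y) w = (\<Sum>i\<in>UNIV. (w $ i) *\<^sub>R F i y)" if "y \<in> S" for y w
  proof -
    have lin: "linear (frechet_derivative f (at y))"
      using smooth_on_differentiable[OF assms(2) that] linear_frechet_derivative by blast
    have "(\<Sum>i\<in>UNIV. (w $ i) *\<^sub>R axis i 1) = w"
      by (simp add: vec_eq_iff axis_def if_distrib cong: if_cong)
    then have "frechet_derivative f (at y) w = frechet_derivative f (at y) (\<Sum>i\<in>UNIV. (w $ i) *\<^sub>R axis i 1)"
      by (simp only:)
    also have "\<dots> = (\<Sum>i\<in>UNIV. frechet_derivative f (at y) ((w $ i) *\<^sub>R axis i 1))"
      by (rule linear_sum[OF lin])
    finally show ?thesis by (simp add: linear_scale[OF lin] F_def)
  qed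
  have vi: "smooth_on S (\<lambda>y. v y $ i)" for i
    by (rule smooth_on_bounded_linear[OF bounded_linear_vec_nth assms(1,3)])
  have "along u (along v f) x = along u (\<lambda>y. \<Sum>i\<in>UNIV. (v y $ i) *\<^sub>R F i y) x"
    by (rule along_cong[OF assms(1) smooth_on_along[OF assms(1-3)] _ assms(4)]) (simp add: along_def exp)
  also have "\<dots> = (\<Sum>i\<in>UNIV. along u (\<lambda>y. (v y $ i) *\<^sub>R F i y) x)"
    by (intro along_sum[OF assms(1)] smooth_on_scaleR assms vi F)
  also have "\<dots> = (\<Sum>i\<in>UNIV. along u (\<lambda>y. v y $ i) x *\<^sub>R F i x + (v x $ i) *\<^sub>R along u (F i) x)"
    by (simp add: along_scaleR[OF vi F assms(4)])
  also have "\<dots> = (\<Sum>i\<in>UNIV. (along u v x $ i) *\<^sub>R F i x) + (\<Sum>i\<in>UNIV. (v x $ i) *\<^sub>R along u (F i) x)"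
    by (simp add: along_bounded_linear[OF bounded_linear_vec_nth assms(3,4)] sum.distrib)
  also have "(\<Sum>i\<in>UNIV. (v x $ i) *\<^sub>R along u (F i) x) = along u (\<lambda>y. \<Sum>i\<in>UNIV. (v x $ i) *\<^sub>R F i y) x"
    by (simp add: along_sum[OF assms(1) smooth_on_scaleR[OF assms(1) smooth_on_const F] assms(4)]
        along_scaleR[OF smooth_on_const F assms(4)])
  also have "\<dots> = along u (\<lambda>y. frechet_derivative f (at y) (v x)) x"
    by (rule along_cong[OF assms(1) _ _ assms(4)]) (auto intro!: smooth_on_sum smooth_on_scaleR smooth_on_const F assms simp: exp)
  finally show ?thesis by (simp add: exp[OF assms(4)] add.commute)
qed

text \<open>The two terms with frozen fields cancel by symmetry of the second derivative; what
  remains is the derivative of \<open>f\<close> along the Lie bracket.\<close>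

lemma along_commutator:
  fixes f :: "real ^ 'n::finite \<Rightarrow> 'b::euclidean_space"
  assumes "open S" "smooth_on S f" "smooth_on S u" "smooth_on S v" "x \<in> S"
  shows "along u (along v f) x - along v (along u f) x = frechet_derivative f (at x) (along u v x - along v u x)"
proof -
  have "linear (frechet_derivative f (at x))"
    using smooth_on_differentiable[OF assms(2,5)] linear_frechet_derivative by blast
  moreover have "along u (\<lambda>y. frechet_derivative f (at y) (v x)) x = along v (\<lambda>y. frechet_derivative f (at y) (u x)) x"
    unfolding along_def by (rule second_derivative_sym[OF assms(2,1,5)])
  ultimately show ?thesis
    using along_along[OF assms(1,2,4,5), of u] along_along[OF assms(1,2,3,5), of v] by (simp add: linear_diff)
qed

section \<open>Principal frames\<close>

lemma orthonormal_parseval: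
  fixes B :: "'a::euclidean_space set"
  assumes "finite B" "card B = DIM('a)" "\<And>b. b \<in> B \<Longrightarrow> b \<bullet> b = 1" "\<And>b c. b \<in> B \<Longrightarrow> c \<in> B \<Longrightarrow> b \<noteq> c \<Longrightarrow> b \<bullet> c = 0"
  shows "v \<bullet> w = (\<Sum>b\<in>B. (v \<bullet> b) * (w \<bullet> b))"
proof -
  have "pairwise orthogonal B" using assms(4) by (auto simp: pairwise_def orthogonal_def)
  moreover have "0 \<notin> B" using assms(3) by force
  ultimately have "independent B" by (rule pairwise_orthogonal_independent)
  then have span: "span B = UNIV"
    using card_ge_dim_independent[of B UNIV] assms(2) by auto
  define r where "r = v - (\<Sum>b\<in>B. (v \<bullet> b) *\<^sub>R b)"
  have "orthogonal r c" if "c \<in> B" for c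
  proof -
    have "(\<Sum>b\<in>B. (v \<bullet> b) * (b \<bullet> c)) = (\<Sum>b\<in>B. if b = c then v \<bullet> b else 0)"
      using assms(3,4) that by (intro sum.cong) auto
    then show ?thesis using that assms(1)
      by (simp add: orthogonal_def r_def inner_diff_left inner_sum_left)
  qed
  then have "orthogonal r r" using orthogonal_to_span[of r B r] span by (simp add: orthogonal_commute)
  then have "r = 0" by (simp add: orthogonal_def)
  then have "v = (\<Sum>b\<in>B. (v \<bullet> b) *\<^sub>R b)" by (simp add: r_def)
  then have "v \<bullet> w = (\<Sum>b\<in>B. (v \<bullet> b) *\<^sub>R b) \<bullet> w" by (simp only:)
  then have "v \<bullet> w = (\<Sum>b\<in>B. (v \<bullet> b) * (b \<bullet> w))" by (simp only: inner_sum_left inner_scaleR_left)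
  then show ?thesis by (simp add: inner_commute[of w])
qed

text \<open>Three tangent vectors, the normal \<open>N\<close> and the two normals of the product of
  spheres fill the six-dimensional ambient space.\<close>

lemma orthonormal_parseval_6:
  fixes e :: "3 \<Rightarrow> R33"
  assumes fi: "\<And>i j. e i \<bullet> e j = kron i j" "\<And>i. e i \<bullet> N = 0" "\<And>i. N \<bullet> e i = 0" "N \<bullet> N = 1"
    "\<And>i. e i \<bullet> n1 = 0" "\<And>i. e i \<bullet> n2 = 0" "N \<bullet> n1 = 0" "N \<bullet> n2 = 0"
    "n1 \<bullet> n1 = 1" "n2 \<bullet> n2 = 1" "n1 \<bullet> n2 = 0"
  shows "v \<bullet> w = (\<Sum>m\<in>UNIV. (v \<bullet> e m) * (w \<bullet> e m)) + (v \<bullet> N) * (w \<bullet> N)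
    + (v \<bullet> n1) * (w \<bullet> n1) + (v \<bullet> n2) * (w \<bullet> n2)"
proof -
  have neq: "e i \<noteq> e j" if "i \<noteq> j" for i j using fi(1)[of i i] fi(1)[of i j] that by auto
  have neq2: "e i \<noteq> N" "e i \<noteq> n1" "e i \<noteq> n2" "N \<noteq> n1" "N \<noteq> n2" "n1 \<noteq> n2" for i
    using fi(1)[of i i, simplified] fi(2)[of i] fi(5)[of i] fi(6)[of i] fi(4,7-11) by (metis zero_neq_one)+
  have inj: "inj (\<lambda>m. e m)" using neq by (auto simp: inj_def)
  define B where "B = range (\<lambda>m. e m) \<union> {N, n1, n2}"
  have disj: "range (\<lambda>m. e m) \<inter> {N, n1, n2} = {}"
  proof -
    have "e m \<notin> {N, n1, n2}" for m using neq2(1-3)[of m] by simp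
    then show ?thesis by blast
  qed
  have "card B = card (range (\<lambda>m. e m)) + card {N, n1, n2}"
    unfolding B_def using disj by (intro card_Un_disjoint) auto
  also have "\<dots> = DIM(R33)" using inj neq2 by (simp add: card_image)
  finally have card: "card B = DIM(R33)" .
  have fi': "n1 \<bullet> e i = 0" "n2 \<bullet> e i = 0" "n1 \<bullet> N = 0" "n2 \<bullet> N = 0" "n2 \<bullet> n1 = 0" for i
    using fi by (simp_all add: inner_commute)
  have B: "(\<exists>m. b = e m) \<or> b = N \<or> b = n1 \<or> b = n2" if "b \<in> B" for b
    using that unfolding B_def by blast
  have "v \<bullet> w = (\<Sum>b\<in>B. (v \<bullet> b) * (w \<bullet> b))"
  proof (rule orthonormal_parseval[OF _ card])
    show "finite B" by (simp add: B_def)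
    show "b \<bullet> b = 1" if "b \<in> B" for b
      using B[OF that] by (elim disjE exE) (simp_all add: fi)
    show "b \<bullet> c = 0" if "b \<in> B" "c \<in> B" "b \<noteq> c" for b c
      using B[OF that(1)] B[OF that(2)] that(3) by (elim disjE exE) (auto simp add: fi fi')
  qed
  also have "\<dots> = (\<Sum>b\<in>range (\<lambda>m. e m). (v \<bullet> b) * (w \<bullet> b)) + (\<Sum>b\<in>{N, n1, n2}. (v \<bullet> b) * (w \<bullet> b))"
    unfolding B_def using disj by (intro sum.union_disjoint) auto
  finally show ?thesis using neq2 inj by (simp add: sum.reindex)
qed

lemma bounded_linear_product_structure: "bounded_linear product_structure"
  unfolding product_structure_def
  by (intro bounded_linear_Pair bounded_linear_fst bounded_linear_minus bounded_linear_snd)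

lemma product_structure_inner: "product_structure v \<bullet> w = v \<bullet> product_structure w"
  by (simp add: product_structure_def inner_prod_def)

lemma product_structure_involution [simp]: "product_structure (product_structure v) = v"
  by (simp add: product_structure_def)

text \<open>The projections to the two factors are (1 + P) / 2 and (1 - P) / 2.\<close>

lemma fst_inner_fst: "fst v \<bullet> fst w = (v \<bullet> w + product_structure v \<bullet> w) / 2"
  and snd_inner_snd: "snd v \<bullet> snd w = (v \<bullet> w - product_structure v \<bullet> w) / 2"
  by (simp_all add: product_structure_def inner_prod_def)

lemma inner_axis_pair: "v \<bullet> (a, 0) = fst v \<bullet> a" "v \<bullet> (0, b) = snd v \<bullet> b"
  by (simp_all add: inner_prod_def)

text \<open>The hypersurface over a coordinate domain: \<open>F\<close> parametrizes it, and its
  differential maps the fields \<open>u i\<close> to an orthonormal frame. As the shape operator is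
  minus the tangential derivative of \<open>N\<close>, the axiom \<open>principal\<close> says that
  \<open>u i\<close> has principal curvature \<open>k i\<close>.\<close>

locale principal_frame =
  fixes W :: "(real ^ 3) set" and F N :: "real ^ 3 \<Rightarrow> R33" and k :: "3 \<Rightarrow> real"
    and u :: "3 \<Rightarrow> real ^ 3 \<Rightarrow> real ^ 3"
  assumes W: "open W" and F: "smooth_on W F" and N: "smooth_on W N" and u: "smooth_on W (u i)"
    and inj_k: "inj k"
    and F_mem: "y \<in> W \<Longrightarrow> F y \<in> S2xS2"
    and dF_inj: "y \<in> W \<Longrightarrow> inj (frechet_derivative F (at y))"
    and N_tangent: "y \<in> W \<Longrightarrow> N y \<in> tangent_S2xS2 (F y)"
    and N_norm: "y \<in> W \<Longrightarrow> norm (N y) = 1"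
    and N_normal: "y \<in> W \<Longrightarrow> N y \<bullet> frechet_derivative F (at y) v = 0"
    and orthonormal: "y \<in> W \<Longrightarrow> along (u i) F y \<bullet> along (u j) F y = kron i j"
    and principal: "y \<in> W \<Longrightarrow> tangent_proj (F y) (along (u i) N y) = - k i *\<^sub>R along (u i) F y"
begin

definition e :: "3 \<Rightarrow> real ^ 3 \<Rightarrow> R33" where "e i = along (u i) F"
definition C :: "real ^ 3 \<Rightarrow> real" where "C y = product_structure (N y) \<bullet> N y"
definition x :: "3 \<Rightarrow> real ^ 3 \<Rightarrow> real" where "x i y = product_structure (e i y) \<bullet> N y"
definition f :: "3 \<Rightarrow> 3 \<Rightarrow> real ^ 3 \<Rightarrow> real" where "f i j y = product_structure (e i y) \<bullet> e j y"
definition G :: "3 \<Rightarrow> 3 \<Rightarrow> 3 \<Rightarrow> real ^ 3 \<Rightarrow> real" where "G i j m y = along (u i) (e j) y \<bullet> e m y"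
text \<open>\<open>n1\<close> and \<open>n2\<close> are the unit normals of the product of spheres
  in the ambient Euclidean space.\<close>

definition n1 :: "real ^ 3 \<Rightarrow> R33" where "n1 y = (fst (F y), 0)"
definition n2 :: "real ^ 3 \<Rightarrow> R33" where "n2 y = (0, snd (F y))"

lemma e_smooth: "smooth_on W (e i)"
  unfolding e_def by (rule smooth_on_along[OF W F u])

lemma n_smooth: "smooth_on W n1" "smooth_on W n2"
proof -
  have "bounded_linear (\<lambda>v::R33. (fst v, 0::real ^ 3))" "bounded_linear (\<lambda>v::R33. (0::real ^ 3, snd v))"
    by (intro bounded_linear_Pair bounded_linear_fst bounded_linear_snd bounded_linear_zero)+
  from this[THEN smooth_on_bounded_linear, OF W F] show "smooth_on W n1" "smooth_on W n2"
    unfolding n1_def[abs_def] n2_def[abs_def] .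
qed

lemma inner_n: "v \<bullet> n1 y = fst v \<bullet> fst (F y)" "v \<bullet> n2 y = snd v \<bullet> snd (F y)"
  by (simp_all add: n1_def n2_def inner_prod_def)

lemma along_n: "y \<in> W \<Longrightarrow> along (u i) n1 y = (fst (e i y), 0)" "y \<in> W \<Longrightarrow> along (u i) n2 y = (0, snd (e i y))"
proof -
  have b: "bounded_linear (\<lambda>v::R33. (fst v, 0::real ^ 3))" "bounded_linear (\<lambda>v::R33. (0::real ^ 3, snd v))"
    by (intro bounded_linear_Pair bounded_linear_fst bounded_linear_snd bounded_linear_zero)+
  show "y \<in> W \<Longrightarrow> along (u i) n1 y = (fst (e i y), 0)" "y \<in> W \<Longrightarrow> along (u i) n2 y = (0, snd (e i y))"
    using along_bounded_linear[OF b(1) F] along_bounded_linear[OF b(2) F]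
    by (simp_all add: n1_def[abs_def] n2_def[abs_def] e_def)
qed

lemma along_const_fun:
  fixes g :: "real ^ 3 \<Rightarrow> real"
  assumes "smooth_on W g" "\<And>y. y \<in> W \<Longrightarrow> g y = c" "y \<in> W"
  shows "along v g y = 0"
  using along_cong[OF W assms(1), of "\<lambda>_. c" y v] assms by simp

lemma frame_inner:
  assumes "y \<in> W"
  shows "e i y \<bullet> e j y = kron i j" "e i y \<bullet> N y = 0" "N y \<bullet> e i y = 0" "N y \<bullet> N y = 1"
    "e i y \<bullet> n1 y = 0" "e i y \<bullet> n2 y = 0" "N y \<bullet> n1 y = 0" "N y \<bullet> n2 y = 0"
    "n1 y \<bullet> n1 y = 1" "n2 y \<bullet> n2 y = 1" "n1 y \<bullet> n2 y = 0"
proof -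
  show "e i y \<bullet> e j y = kron i j" unfolding e_def by (rule orthonormal[OF assms])
  show "N y \<bullet> e i y = 0" "e i y \<bullet> N y = 0"
    using N_normal[OF assms] by (simp_all add: e_def along_def inner_commute)
  show "N y \<bullet> N y = 1" using N_norm[OF assms] by (simp add: norm_eq_1)
  have n: "n1 y \<bullet> n1 y = 1" "n2 y \<bullet> n2 y = 1" if "y \<in> W" for y
    using F_mem[OF that] by (auto simp: n1_def n2_def S2xS2_def mem_Times_iff norm_eq_1)
  show "n1 y \<bullet> n1 y = 1" "n2 y \<bullet> n2 y = 1" using n assms by auto
  show "n1 y \<bullet> n2 y = 0" by (simp add: n1_def n2_def)
  show "N y \<bullet> n1 y = 0" "N y \<bullet> n2 y = 0"
    using N_tangent[OF assms] by (auto simp: inner_n tangent_S2xS2_def)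
  have "along (u i) (\<lambda>y. n1 y \<bullet> n1 y) y = 0" "along (u i) (\<lambda>y. n2 y \<bullet> n2 y) y = 0"
    using n by (intro along_const_fun[OF smooth_on_inner[OF W]] n_smooth assms; simp)+
  then have "2 * ((fst (e i y), 0) \<bullet> n1 y) = 0" "2 * ((0, snd (e i y)) \<bullet> n2 y) = 0"
    unfolding along_inner[OF n_smooth(1) n_smooth(1) assms] along_inner[OF n_smooth(2) n_smooth(2) assms]
      along_n[OF assms] by (simp_all add: inner_commute)
  then show "e i y \<bullet> n1 y = 0" "e i y \<bullet> n2 y = 0"
    by (simp_all add: n1_def n2_def inner_prod_def)
qed

lemma parseval:
  assumes "y \<in> W"
  shows "v \<bullet> w = (\<Sum>m\<in>UNIV. (v \<bullet> e m y) * (w \<bullet> e m y)) + (v \<bullet> N y) * (w \<bullet> N y)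
    + (v \<bullet> n1 y) * (w \<bullet> n1 y) + (v \<bullet> n2 y) * (w \<bullet> n2 y)"
proof -
  show ?thesis by (rule orthonormal_parseval_6) (rule frame_inner[OF assms])+
qed

text \<open>The components along \<open>n1\<close> and \<open>n2\<close> come from differentiating
  the orthogonality of \<open>N\<close> to them; the projections to the two factors give the
  opposite signs of \<open>x\<close>.\<close>

lemma along_N:
  assumes "y \<in> W"
  shows "along (u i) N y \<bullet> e j y = - k i * kron i j" "along (u i) N y \<bullet> N y = 0"
    "along (u i) N y \<bullet> n1 y = - x i y / 2" "along (u i) N y \<bullet> n2 y = x i y / 2"
proof -
  note fi = frame_inner[OF assms]
  have "tangent_proj (F y) v \<bullet> w = v \<bullet> w - (v \<bullet> n1 y) * (w \<bullet> n1 y) - (v \<bullet> n2 y) * (w \<bullet> n2 y)" for v w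
    unfolding inner_n by (simp add: tangent_proj_def inner_prod_def inner_diff_left inner_commute[of _ "fst w"] inner_commute[of _ "snd w"] inner_diff_right)
  from this[of "along (u i) N y" "e j y"] show "along (u i) N y \<bullet> e j y = - k i * kron i j"
    using principal[OF assms, of i] fi by (simp add: e_def)
  have "along (u i) (\<lambda>y. N y \<bullet> N y) y = 0"
    by (rule along_const_fun[OF smooth_on_inner[OF W N N] _ assms]) (rule frame_inner)
  then show "along (u i) N y \<bullet> N y = 0"
    by (simp add: along_inner[OF N N assms] inner_commute)
  have a: "along (u i) (\<lambda>y. N y \<bullet> n1 y) y = 0" "along (u i) (\<lambda>y. N y \<bullet> n2 y) y = 0"
    by (rule along_const_fun[OF smooth_on_inner[OF W N n_smooth(1)] frame_inner(7) assms])
       (assumption, rule along_const_fun[OF smooth_on_inner[OF W N n_smooth(2)] frame_inner(8) assms])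
  have "along (u i) N y \<bullet> n1 y = - (fst (e i y) \<bullet> fst (N y))" "along (u i) N y \<bullet> n2 y = - (snd (e i y) \<bullet> snd (N y))"
    using a unfolding along_inner[OF N n_smooth(1) assms] along_inner[OF N n_smooth(2) assms] along_n[OF assms]
    by (simp_all add: inner_axis_pair inner_commute[of "fst (e i y)"] inner_commute[of "snd (e i y)"] eq_neg_iff_add_eq_0)
  then show "along (u i) N y \<bullet> n1 y = - x i y / 2" "along (u i) N y \<bullet> n2 y = x i y / 2"
    unfolding fst_inner_fst snd_inner_snd using fi by (simp_all add: x_def)
qed

lemma along_e:
  assumes "y \<in> W"
  shows "along (u i) (e j) y \<bullet> e m y = G i j m y" "along (u i) (e j) y \<bullet> N y = k i * kron i j"
    "along (u i) (e j) y \<bullet> n1 y = - (kron i j + f i j y) / 2" "along (u i) (e j) y \<bullet> n2 y = - (kron i j - f i j y) / 2"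
proof -
  note fi = frame_inner[OF assms]
  show "along (u i) (e j) y \<bullet> e m y = G i j m y" by (simp add: G_def)
  have "along (u i) (\<lambda>y. e j y \<bullet> N y) y = 0"
    by (rule along_const_fun[OF smooth_on_inner[OF W e_smooth N] frame_inner(2) assms])
  then show "along (u i) (e j) y \<bullet> N y = k i * kron i j"
    using along_N(1)[OF assms, of i j]
    unfolding along_inner[OF e_smooth N assms] inner_commute[of "e j y" "along (u i) N y"] by simp
  have a: "along (u i) (\<lambda>y. e j y \<bullet> n1 y) y = 0" "along (u i) (\<lambda>y. e j y \<bullet> n2 y) y = 0"
    by (rule along_const_fun[OF smooth_on_inner[OF W e_smooth n_smooth(1)] frame_inner(5) assms])
       (assumption, rule along_const_fun[OF smooth_on_inner[OF W e_smooth n_smooth(2)] frame_inner(6) assms])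
  have "along (u i) (e j) y \<bullet> n1 y = - (fst (e i y) \<bullet> fst (e j y))" "along (u i) (e j) y \<bullet> n2 y = - (snd (e i y) \<bullet> snd (e j y))"
    using a unfolding along_inner[OF e_smooth n_smooth(1) assms] along_inner[OF e_smooth n_smooth(2) assms] along_n[OF assms]
    by (simp_all add: inner_axis_pair inner_commute[of "fst (e i y)"] inner_commute[of "snd (e i y)"] eq_neg_iff_add_eq_0)
  then show "along (u i) (e j) y \<bullet> n1 y = - (kron i j + f i j y) / 2" "along (u i) (e j) y \<bullet> n2 y = - (kron i j - f i j y) / 2"
    unfolding fst_inner_fst snd_inner_snd f_def fi(1) by (simp_all only: minus_divide_left)
qed

text \<open>\<open>P\<close> fixes \<open>n1\<close> and reverses \<open>n2\<close>, so it preserves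
  the span of the frame and \<open>N\<close>.\<close>

lemma P_frame:
  assumes "y \<in> W"
  shows "product_structure (e i y) \<bullet> e j y = f i j y" "product_structure (e i y) \<bullet> N y = x i y"
    "product_structure (e i y) \<bullet> n1 y = 0" "product_structure (e i y) \<bullet> n2 y = 0"
    "product_structure (N y) \<bullet> e j y = x j y" "product_structure (N y) \<bullet> N y = C y"
    "product_structure (N y) \<bullet> n1 y = 0" "product_structure (N y) \<bullet> n2 y = 0"
    "f i j y = f j i y"
proof -
  have "product_structure v \<bullet> n1 y = v \<bullet> n1 y" "product_structure v \<bullet> n2 y = - (v \<bullet> n2 y)" for v
    by (simp_all add: product_structure_def inner_n)
  then show "product_structure (e i y) \<bullet> n1 y = 0" "product_structure (e i y) \<bullet> n2 y = 0"
    "product_structure (N y) \<bullet> n1 y = 0" "product_structure (N y) \<bullet> n2 y = 0"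
    using frame_inner[OF assms] by auto
  show "product_structure (N y) \<bullet> e j y = x j y" "f i j y = f j i y"
    by (metis x_def f_def product_structure_inner inner_commute)+
qed (simp_all add: f_def x_def C_def)

text \<open>The normal parts of \<open>along (u i) (e j)\<close> are symmetric in
  \<open>i, j\<close>, so only connection coefficients remain in the commutator; injectivity of the
  differential carries the identity back to the fields \<open>u m\<close>.\<close>

lemma bracket:
  assumes "y \<in> W"
  shows "along (u i) (u j) y - along (u j) (u i) y = (\<Sum>m\<in>UNIV. (G i j m y - G j i m y) *\<^sub>R u m y)"
proof -
  have lin: "linear (frechet_derivative F (at y))"
    using smooth_on_differentiable[OF F assms] linear_frechet_derivative by blast
  define v where "v = along (u i) (e j) y - along (u j) (e i) y - (\<Sum>m\<in>UNIV. (G i j m y - G j i m y) *\<^sub>R e m y)"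
  note fi = frame_inner[OF assms]
  have "v \<bullet> e m y = 0" for m
    by (simp add: v_def inner_diff_left inner_sum_left along_e[OF assms] fi if_distrib sum.delta' cong: if_cong)
  moreover have "v \<bullet> N y = 0" "v \<bullet> n1 y = 0" "v \<bullet> n2 y = 0"
    using P_frame(9)[OF assms, of i j]
    by (simp_all add: v_def inner_diff_left inner_sum_left along_e[OF assms] fi)
  ultimately have "v \<bullet> v = 0" using parseval[OF assms, of v v] by simp
  then have v0: "v = 0" by simp
  have "frechet_derivative F (at y) (along (u i) (u j) y - along (u j) (u i) y) = along (u i) (e j) y - along (u j) (e i) y"
    using along_commutator[OF W F u u assms, of i j] by (simp add: e_def)
  also have "\<dots> = (\<Sum>m\<in>UNIV. (G i j m y - G j i m y) *\<^sub>R e m y)" using v0 by (simp add: v_def)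
  also have "\<dots> = frechet_derivative F (at y) (\<Sum>m\<in>UNIV. (G i j m y - G j i m y) *\<^sub>R u m y)"
    by (simp add: linear_sum[OF lin] linear_scale[OF lin] e_def along_def)
  finally show ?thesis using dF_inj[OF assms] by (simp add: inj_eq)
qed

lemma commutator_e:
  assumes "y \<in> W"
  shows "along (u i) (along (u j) (e a)) y - along (u j) (along (u i) (e a)) y
     = (\<Sum>m\<in>UNIV. (G i j m y - G j i m y) *\<^sub>R along (u m) (e a) y)"
proof -
  have lin: "linear (frechet_derivative (e a) (at y))"
    using smooth_on_differentiable[OF e_smooth assms] linear_frechet_derivative by blast
  show ?thesis
    unfolding along_commutator[OF W e_smooth u u assms] bracket[OF assms]
    by (simp add: linear_sum[OF lin] linear_scale[OF lin] along_def)
qed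

text \<open>Everything is read off in components with respect to the ambient orthonormal basis.
  Flatness of the ambient space is \<open>commutator_e\<close>: its component along \<open>N\<close>
  is the Codazzi equation, its component along \<open>e b\<close> the Gauss equation.\<close>

sublocale frame_eqs W "{g. smooth_on W g}" "\<lambda>i. along (u i)" k C x f G
proof
  show "inj k" by (rule inj_k)
next
  fix c show "(\<lambda>_. c) \<in> {g. smooth_on W g}" by (simp add: smooth_on_const)
next
  fix g h :: "real ^ 3 \<Rightarrow> real" assume gh: "g \<in> {g. smooth_on W g}" "h \<in> {g. smooth_on W g}"
  show "(\<lambda>y. g y + h y) \<in> {g. smooth_on W g}" using gh by (simp add: smooth_on_add W)
  show "(\<lambda>y. g y * h y) \<in> {g. smooth_on W g}" using gh by (simp add: smooth_on_mult W)
  fix y i assume y: "y \<in> W"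
  show "along (u i) (\<lambda>y. g y + h y) y = along (u i) g y + along (u i) h y"
    using gh y by (simp add: along_add)
  show "along (u i) (\<lambda>y. g y * h y) y = along (u i) g y * h y + g y * along (u i) h y"
    using gh y by (simp add: along_mult)
next
  fix g :: "real ^ 3 \<Rightarrow> real" and i assume "g \<in> {g. smooth_on W g}"
  then show "along (u i) g \<in> {g. smooth_on W g}" by (simp add: smooth_on_along W u)
next
  fix g h :: "real ^ 3 \<Rightarrow> real" and i y
  assume "g \<in> {g. smooth_on W g}" "h \<in> {g. smooth_on W g}" "\<And>y. y \<in> W \<Longrightarrow> g y = h y" "y \<in> W"
  then show "along (u i) g y = along (u i) h y" using along_cong[OF W, of g h y "u i"] by simp
next
  fix i c y show "along (u i) (\<lambda>_. c) y = (0::real)" by simp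
next
  have P: "smooth_on W g \<Longrightarrow> smooth_on W (\<lambda>y. product_structure (g y))" for g
    by (rule smooth_on_bounded_linear[OF bounded_linear_product_structure W])
  fix i j m
  show "C \<in> {g. smooth_on W g}" "x i \<in> {g. smooth_on W g}" "f i j \<in> {g. smooth_on W g}" "G i j m \<in> {g. smooth_on W g}"
    unfolding C_def[abs_def] x_def[abs_def] f_def[abs_def] G_def[abs_def]
    by (simp_all add: smooth_on_inner W P e_smooth N smooth_on_along u)
  have DP: "along v (\<lambda>y. product_structure (g y)) y = product_structure (along v g y)" if "smooth_on W g" "y \<in> W" for v g y
    by (rule along_bounded_linear[OF bounded_linear_product_structure that])
  fix y l a b assume y: "y \<in> W"
  note fi = frame_inner[OF y] and pv = parseval[OF y] and PF = P_frame[OF y] and DN = along_N[OF y] and De = along_e[OF y]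
  show fs: "f i j y = f j i y" for i j by (rule PF)
  show skew: "G i j m y = - G i m j y" for i j m
  proof -
    have "along (u i) (\<lambda>y. e j y \<bullet> e m y) y = 0"
      by (rule along_const_fun[OF smooth_on_inner[OF W e_smooth e_smooth] frame_inner(1) y])
    then show ?thesis by (simp add: along_inner[OF e_smooth e_smooth y] G_def inner_commute)
  qed
  have delta: "(\<Sum>m\<in>UNIV. c * kron l m * h m) = c * h l" for c h and l :: 3
  proof -
    have "(\<Sum>m\<in>UNIV. c * kron l m * h m) = (\<Sum>m\<in>UNIV. if m = l then c * h l else 0)"
      by (intro sum.cong) auto
    then show ?thesis by simp
  qed
  have PP: "product_structure v \<bullet> product_structure w = v \<bullet> w" for v w
    by (simp add: product_structure_inner)
  show "(\<Sum>m\<in>UNIV. f i m y * f m j y) + x i y * x j y = kron i j"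
    using pv[of "product_structure (e i y)" "product_structure (e j y)"]
    by (simp add: PF PP fi fs[of j])
  show "(\<Sum>m\<in>UNIV. f i m y * x m y) = - C y * x i y"
    using pv[of "product_structure (e i y)" "product_structure (N y)"]
    by (simp add: PF PP fi eq_neg_iff_add_eq_0 mult.commute[of "C y"])
  show "(\<Sum>m\<in>UNIV. (x m y)\<^sup>2) + (C y)\<^sup>2 = 1"
    using pv[of "product_structure (N y)" "product_structure (N y)"]
    by (simp add: PF PP fi power2_eq_square)
  show "(\<Sum>m\<in>UNIV. f m m y) = - C y"
  proof -
    \<comment> \<open>Three is the trace of the projection to the first factor, computed in the
      standard basis and again in the frame, where \<open>n1\<close> contributes 1 and
      \<open>n2\<close> contributes 0.\<close>
    have "3 = (\<Sum>c\<in>(Basis :: (real ^ 3) set). (c, 0 :: real ^ 3) \<bullet> (c, 0))"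
      by (simp cong: sum.cong)
    also have "\<dots> = (\<Sum>c\<in>Basis. (\<Sum>m\<in>UNIV. (fst (e m y) \<bullet> c) * (fst (e m y) \<bullet> c)) + (fst (N y) \<bullet> c) * (fst (N y) \<bullet> c)
        + (fst (n1 y) \<bullet> c) * (fst (n1 y) \<bullet> c) + (fst (n2 y) \<bullet> c) * (fst (n2 y) \<bullet> c))"
      by (rule sum.cong, rule refl, subst pv) (simp add: inner_commute[of "(_, 0)"] inner_axis_pair inner_commute[of _ "fst _"])
    also have "\<dots> = (\<Sum>m\<in>UNIV. fst (e m y) \<bullet> fst (e m y)) + fst (N y) \<bullet> fst (N y)
        + fst (n1 y) \<bullet> fst (n1 y) + fst (n2 y) \<bullet> fst (n2 y)"
      unfolding sum.distrib by (subst sum.swap) (simp only: euclidean_inner[symmetric])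
    also have "\<dots> = (\<Sum>m\<in>UNIV. (1 + f m m y) / 2) + (1 + C y) / 2 + 1"
      using fi(9) unfolding fst_inner_fst[of "e _ y"] fst_inner_fst[of "N y"] fi(1,4)
      by (simp add: f_def C_def) (simp add: n1_def n2_def)
    also have "(\<Sum>m\<in>UNIV. (1 + f m m y) / 2) = (3 + (\<Sum>m\<in>UNIV. f m m y)) / 2"
      by (simp add: sum.distrib flip: sum_divide_distrib)
    finally show ?thesis by (simp add: field_simps)
  qed
  show "along (u l) C y = - 2 * k l * x l y"
  proof -
    have "along (u l) C y = 2 * (along (u l) N y \<bullet> product_structure (N y))"
      unfolding C_def[abs_def] along_inner[OF P[OF N] N y] DP[OF N y] by (simp add: product_structure_inner inner_commute)
    then show ?thesis unfolding pv[of "along (u l) N y" "product_structure (N y)"] by (simp only: DN PF delta) simp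
  qed
  show "along (u l) (x i) y = (\<Sum>m\<in>UNIV. G l i m y * x m y) + k l * (C y * kron l i - f l i y)"
  proof -
    have "along (u l) (x i) y = along (u l) (e i) y \<bullet> product_structure (N y) + along (u l) N y \<bullet> product_structure (e i y)"
      unfolding x_def[abs_def] along_inner[OF P[OF e_smooth] N y] DP[OF e_smooth y] by (simp add: product_structure_inner inner_commute)
    then show ?thesis unfolding pv[of "along (u l) N y" "product_structure (e i y)"] pv[of "along (u l) (e i) y" "product_structure (N y)"]
      by (simp only: DN De PF delta) (simp add: fs[of i l] algebra_simps)
  qed
  show "along (u l) (f i j) y = (\<Sum>m\<in>UNIV. G l i m y * f m j y + G l j m y * f i m y)
          + k l * (kron l i * x j y + kron l j * x i y)"
  proof -
    have "along (u l) (f i j) y = along (u l) (e i) y \<bullet> product_structure (e j y) + along (u l) (e j) y \<bullet> product_structure (e i y)"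
      unfolding f_def[abs_def] along_inner[OF P[OF e_smooth] e_smooth y] DP[OF e_smooth y] by (simp add: product_structure_inner inner_commute)
    then show ?thesis unfolding pv[of "along (u l) (e i) y" "product_structure (e j y)"] pv[of "along (u l) (e j) y" "product_structure (e i y)"]
      by (simp only: De PF) (simp add: fs[of j] sum.distrib algebra_simps)
  qed
  have sDe: "smooth_on W (along (u i) (e j))" for i j
    by (rule smooth_on_along[OF W e_smooth u])
  show "(k j - k m) * G i j m y - (k i - k m) * G j i m y = (x i y * f j m y - x j y * f i m y) / 2"
  proof -
    \<comment> \<open>The second fundamental form is constant in the frame because the
      \<open>k i\<close> are; so differentiating it gives zero.\<close>
    have *: "along (u i) (along (u j) (e m)) y \<bullet> N y = k i * G j m i y - f j m y * x i y / 2" for i j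
    proof -
      have "along (u i) (\<lambda>y. along (u j) (e m) y \<bullet> N y) y = 0"
        by (rule along_const_fun[OF smooth_on_inner[OF W sDe N] along_e(2) y])
      then have "along (u i) (along (u j) (e m)) y \<bullet> N y = - (along (u i) N y \<bullet> along (u j) (e m) y)"
        unfolding along_inner[OF sDe N y] by (simp add: inner_commute)
      then show ?thesis unfolding pv[of "along (u i) N y" "along (u j) (e m) y"]
        by (simp only: De DN delta) (simp add: field_simps)
    qed
    have "along (u i) (along (u j) (e m)) y \<bullet> N y - along (u j) (along (u i) (e m)) y \<bullet> N y
        = (\<Sum>r\<in>UNIV. (G i j r y - G j i r y) * (k r * kron r m))"
      using arg_cong[OF commutator_e[OF y, of i j m], of "\<lambda>v. v \<bullet> N y"] by (simp add: inner_diff_left inner_sum_left De)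
    also have "\<dots> = (\<Sum>r\<in>UNIV. if r = m then (G i j r y - G j i r y) * k r else 0)"
      by (intro sum.cong) auto
    also have "\<dots> = (G i j m y - G j i m y) * k m" by simp
    finally show ?thesis
      unfolding * using skew[of i j m] skew[of j i m] by (simp add: field_simps)
  qed
  show "along (u i) (G j a b) y - along (u j) (G i a b) y
          + (\<Sum>m\<in>UNIV. G j a m y * G i m b y - G i a m y * G j m b y
                - (G i j m y - G j i m y) * G m a b y)
          = (k i * k j + 1/2) * (kron j a * kron i b - kron i a * kron j b)
          + (f j a y * f i b y - f i a y * f j b y) / 2"
  proof -
    \<comment> \<open>In the products of the \<open>n1\<close> and \<open>n2\<close> components the
      terms mixing \<open>kron\<close> and \<open>f\<close> cancel; this is the origin of both
      halves in the Gauss equation.\<close>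
    have *: "along (u i) (G j a b) y = along (u i) (along (u j) (e a)) y \<bullet> e b y
        - (\<Sum>m\<in>UNIV. G j a m y * G i m b y) + (k j * kron j a) * (k i * kron i b)
        + ((kron j a + f j a y) * (kron i b + f i b y) + (kron j a - f j a y) * (kron i b - f i b y)) / 4" for i j
    proof -
      have "along (u i) (G j a b) y = along (u i) (along (u j) (e a)) y \<bullet> e b y + along (u j) (e a) y \<bullet> along (u i) (e b) y"
        unfolding G_def[abs_def] by (rule along_inner[OF sDe e_smooth y])
      moreover have "along (u j) (e a) y \<bullet> along (u i) (e b) y = - (\<Sum>m\<in>UNIV. G j a m y * G i m b y) + (k j * kron j a) * (k i * kron i b)
        + ((kron j a + f j a y) * (kron i b + f i b y) + (kron j a - f j a y) * (kron i b - f i b y)) / 4"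
        unfolding pv[of "along (u j) (e a) y" "along (u i) (e b) y"] De by (simp add: skew[of i b] sum_negf field_simps)
      ultimately show ?thesis by simp
    qed
    have "along (u i) (along (u j) (e a)) y \<bullet> e b y - along (u j) (along (u i) (e a)) y \<bullet> e b y
        = (\<Sum>m\<in>UNIV. (G i j m y - G j i m y) * G m a b y)"
      using arg_cong[OF commutator_e[OF y, of i j a], of "\<lambda>v. v \<bullet> e b y"] by (simp add: inner_diff_left inner_sum_left De)
    then show ?thesis
      unfolding *[of i j] *[of j i] sum_subtractf by (simp add: field_simps)
  qed
qed

end

section \<open>Scalar curvature\<close>

lemma vec_axis_sum: "(\<Sum>i\<in>UNIV. (v $ i) *\<^sub>R axis i (1::real)) = v"
  by (simp add: vec_eq_iff axis_def if_distrib cong: if_cong)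

lemma linear_vec_expand:
  assumes "linear L" shows "L v = (\<Sum>i\<in>UNIV. (v $ i) *\<^sub>R L (axis i (1::real)))"
proof -
  have "L v = L (\<Sum>i\<in>UNIV. (v $ i) *\<^sub>R axis i 1)" by (simp only: vec_axis_sum)
  then show ?thesis by (simp add: linear_sum[OF assms] linear_scale[OF assms])
qed

text \<open>A metric trace may be taken in any frame \<open>a\<close> for which the inverse metric
  is the sum of the products of each frame vector with itself.\<close>

lemma bilinear_contraction:
  fixes \<Psi> :: "real ^ 'n::finite \<Rightarrow> real ^ 'n \<Rightarrow> real" and a :: "'k::finite \<Rightarrow> real ^ 'n"
  assumes "\<And>v. linear (\<Psi> v)" "\<And>w. linear (\<lambda>v. \<Psi> v w)"
  shows "(\<Sum>j\<in>UNIV. \<Sum>k\<in>UNIV. (\<Sum>m\<in>UNIV. a m $ j * a m $ k) * \<Psi> (axis j 1) (axis k 1)) = (\<Sum>m\<in>UNIV. \<Psi> (a m) (a m))"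
proof -
  have "\<Psi> v v = (\<Sum>j\<in>UNIV. \<Sum>k\<in>UNIV. v $ j * v $ k * \<Psi> (axis j 1) (axis k 1))" for v
  proof -
    have "\<Psi> v v = (\<Sum>j\<in>UNIV. v $ j * \<Psi> (axis j 1) v)"
      using linear_vec_expand[OF assms(2)[of v], of v] by simp
    moreover have "\<Psi> (axis j 1) v = (\<Sum>k\<in>UNIV. v $ k * \<Psi> (axis j 1) (axis k 1))" for j
      using linear_vec_expand[OF assms(1)[of "axis j 1"], of v] by simp
    ultimately show ?thesis by (simp add: sum_distrib_left mult.assoc)
  qed
  then have "(\<Sum>m\<in>UNIV. \<Psi> (a m) (a m)) = (\<Sum>m\<in>UNIV. \<Sum>j\<in>UNIV. \<Sum>k\<in>UNIV. a m $ j * a m $ k * \<Psi> (axis j 1) (axis k 1))"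
    by simp
  also have "\<dots> = (\<Sum>j\<in>UNIV. \<Sum>m\<in>UNIV. \<Sum>k\<in>UNIV. a m $ j * a m $ k * \<Psi> (axis j 1) (axis k 1))"
    by (rule sum.swap)
  also have "\<dots> = (\<Sum>j\<in>UNIV. \<Sum>k\<in>UNIV. \<Sum>m\<in>UNIV. a m $ j * a m $ k * \<Psi> (axis j 1) (axis k 1))"
    by (intro sum.cong refl sum.swap)
  finally show ?thesis by (simp add: sum_distrib_right)
qed

lemma partial_along: "partial i h y = along (\<lambda>_. axis i 1) h y"
  by (simp add: partial_def along_def)

context principal_frame
begin

section \<open>The curvature of the induced metric, expressed in a principal frame\<close>

definition dF :: "3 \<Rightarrow> real ^ 3 \<Rightarrow> R33" where "dF i y = frechet_derivative F (at y) (axis i 1)"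
definition hess :: "3 \<Rightarrow> 3 \<Rightarrow> real ^ 3 \<Rightarrow> R33" where "hess i j = along (\<lambda>_. axis i 1) (dF j)"
definition metric :: "real ^ 3 \<Rightarrow> real ^ 3 ^ 3" where "metric y = (\<chi> i j. dF i y \<bullet> dF j y)"
definition Hess :: "real ^ 3 \<Rightarrow> real ^ 3 \<Rightarrow> real ^ 3 \<Rightarrow> R33" where
  "Hess y v w = frechet_derivative (\<lambda>z. frechet_derivative F (at z) w) (at y) v"

lemma lin: "y \<in> W \<Longrightarrow> linear (frechet_derivative F (at y))"
  using smooth_on_differentiable[OF F] linear_frechet_derivative by blast

lemma dF_smooth: "smooth_on W (dF i)"
  unfolding dF_def[abs_def] by (rule smooth_on_deriv[OF F])

lemma hess_smooth: "smooth_on W (hess i j)"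
  unfolding hess_def by (rule smooth_on_along[OF W dF_smooth smooth_on_const])

lemma hess_Hess: "hess i j y = Hess y (axis i 1) (axis j 1)"
  by (simp add: hess_def Hess_def dF_def[abs_def] along_def)

lemma Hess_sym: "y \<in> W \<Longrightarrow> Hess y v w = Hess y w v"
  unfolding Hess_def by (rule second_derivative_sym[OF F W])

lemma hess_sym: "y \<in> W \<Longrightarrow> hess i j y = hess j i y"
  unfolding hess_Hess by (rule Hess_sym)

lemma Hess_linear: assumes "y \<in> W" shows "linear (\<lambda>v. Hess y v w)" "linear (Hess y v)"
proof -
  show l: "linear (\<lambda>v. Hess y v w)" for w
    unfolding Hess_def
    using linear_frechet_derivative[OF smooth_on_differentiable[OF smooth_on_deriv[OF F] assms]] .
  show "linear (Hess y v)"
    using l[of v] ext[of "Hess y v" "\<lambda>w. Hess y w v", OF Hess_sym[OF assms]] by simp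
qed

lemma dF_normal:
  assumes "y \<in> W"
  shows "frechet_derivative F (at y) v \<bullet> N y = 0" "frechet_derivative F (at y) v \<bullet> n1 y = 0"
    "frechet_derivative F (at y) v \<bullet> n2 y = 0"
proof -
  show "frechet_derivative F (at y) v \<bullet> N y = 0" using N_normal[OF assms] by (simp add: inner_commute)
  have b: "bounded_linear (\<lambda>v::R33. (fst v, 0::real ^ 3))" "bounded_linear (\<lambda>v::R33. (0::real ^ 3, snd v))"
    by (intro bounded_linear_Pair bounded_linear_fst bounded_linear_snd bounded_linear_zero)+
  have a: "along (\<lambda>_. v) n1 y = (fst (frechet_derivative F (at y) v), 0)" "along (\<lambda>_. v) n2 y = (0, snd (frechet_derivative F (at y) v))"
    using along_bounded_linear[OF b(1) F assms, of "\<lambda>_. v"] along_bounded_linear[OF b(2) F assms, of "\<lambda>_. v"]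
    by (simp_all add: n1_def[abs_def] n2_def[abs_def] along_def)
  have "along (\<lambda>_. v) (\<lambda>y. n1 y \<bullet> n1 y) y = 0" "along (\<lambda>_. v) (\<lambda>y. n2 y \<bullet> n2 y) y = 0"
    by (rule along_const_fun[OF smooth_on_inner[OF W n_smooth(1) n_smooth(1)] frame_inner(9) assms])
      (assumption, rule along_const_fun[OF smooth_on_inner[OF W n_smooth(2) n_smooth(2)] frame_inner(10) assms])
  then have "2 * ((fst (frechet_derivative F (at y) v), 0) \<bullet> n1 y) = 0" "2 * ((0, snd (frechet_derivative F (at y) v)) \<bullet> n2 y) = 0"
    unfolding along_inner[OF n_smooth(1) n_smooth(1) assms] along_inner[OF n_smooth(2) n_smooth(2) assms] a
    by (simp_all add: inner_commute)
  then show "frechet_derivative F (at y) v \<bullet> n1 y = 0" "frechet_derivative F (at y) v \<bullet> n2 y = 0"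
    by (simp_all add: n1_def n2_def inner_prod_def)
qed

lemma tangent_expand:
  assumes "y \<in> W"
  shows "v = (v \<bullet> N y) *\<^sub>R N y + (v \<bullet> n1 y) *\<^sub>R n1 y + (v \<bullet> n2 y) *\<^sub>R n2 y + (\<Sum>m\<in>UNIV. (v \<bullet> e m y) *\<^sub>R e m y)"
    (is "v = ?r")
proof -
  define r where "r = ?r"
  have d: "v \<bullet> w = r \<bullet> w" for w
    unfolding r_def parseval[OF assms, of v w]
    by (simp add: inner_add_left inner_sum_left inner_commute[of w])
  have "(v - r) \<bullet> (v - r) = 0" by (simp only: inner_diff_left d diff_self)
  then have "v = r" by simp
  then show ?thesis unfolding r_def .
qed

text \<open>The frame spans the image of the differential, whose injectivity turns an expansion in
  \<open>e m\<close> into one in \<open>u m\<close>.\<close>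

lemma coordinate_expand:
  assumes "y \<in> W"
  shows "v = (\<Sum>m\<in>UNIV. (frechet_derivative F (at y) v \<bullet> e m y) *\<^sub>R u m y)"
proof -
  have "frechet_derivative F (at y) v = (\<Sum>m\<in>UNIV. (frechet_derivative F (at y) v \<bullet> e m y) *\<^sub>R e m y)"
    by (rule trans[OF tangent_expand[OF assms]]) (simp add: dF_normal[OF assms])
  also have "\<dots> = frechet_derivative F (at y) (\<Sum>m\<in>UNIV. (frechet_derivative F (at y) v \<bullet> e m y) *\<^sub>R u m y)"
    by (simp add: linear_sum[OF lin[OF assms]] linear_scale[OF lin[OF assms]] e_def along_def)
  finally show ?thesis by (rule injD[OF dF_inj[OF assms]])
qed

lemma e_dF: "y \<in> W \<Longrightarrow> e m y = (\<Sum>a\<in>UNIV. (u m y $ a) *\<^sub>R dF a y)"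
  unfolding e_def along_def dF_def by (rule linear_vec_expand[OF lin])

text \<open>The coordinate vectors \<open>u m\<close> are orthonormal for the metric, so the sum of
  their products with their transposes is a one-sided inverse, hence the inverse.\<close>

lemma matrix_inv_metric:
  assumes "y \<in> W"
  shows "matrix_inv (metric y) = (\<chi> a b. \<Sum>m\<in>UNIV. u m y $ a * u m y $ b)" (is "_ = ?Q")
    and "matrix_inv (metric y) ** metric y = mat 1"
proof -
  have "(\<Sum>a\<in>UNIV. (dF i y \<bullet> dF a y) * (\<Sum>m\<in>UNIV. u m y $ a * u m y $ b)) = axis i 1 $ b" for i b
  proof -
    have "(\<Sum>a\<in>UNIV. (dF i y \<bullet> dF a y) * (\<Sum>m\<in>UNIV. u m y $ a * u m y $ b))
        = (\<Sum>m\<in>UNIV. (\<Sum>a\<in>UNIV. (u m y $ a) * (dF i y \<bullet> dF a y)) * u m y $ b)"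
      unfolding sum_distrib_left sum_distrib_right by (subst sum.swap) (simp add: mult_ac)
    also have "\<dots> = (\<Sum>m\<in>UNIV. (dF i y \<bullet> e m y) * u m y $ b)"
      by (simp add: e_dF[OF assms] inner_sum_right)
    also have "\<dots> = (\<Sum>m\<in>UNIV. (frechet_derivative F (at y) (axis i 1) \<bullet> e m y) *\<^sub>R u m y) $ b"
      by (simp add: dF_def)
    finally show ?thesis by (simp only: coordinate_expand[OF assms, symmetric])
  qed
  then have 1: "metric y ** ?Q = mat 1"
    unfolding vec_eq_iff matrix_matrix_mult_def metric_def mat_def by (simp add: axis_def eq_commute)
  then have 2: "?Q ** metric y = mat 1" by (rule matrix_left_right_inverse[THEN iffD1])
  have "metric y ** matrix_inv (metric y) = mat 1 \<and> matrix_inv (metric y) ** metric y = mat 1"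
    unfolding matrix_inv_def by (rule someI_ex) (use 1 2 in blast)
  then have "matrix_inv (metric y) ** (metric y ** ?Q) = ?Q"
    unfolding matrix_mul_assoc by simp
  then show 3: "matrix_inv (metric y) = ?Q" unfolding 1 by simp
  show "matrix_inv (metric y) ** metric y = mat 1" unfolding 3 by (rule 2)
qed

text \<open>By symmetry of second derivatives the combination of metric derivatives collapses to
  twice \<open>hess i j \<bullet> dF l\<close>; the Christoffel symbols are the coordinates of the
  tangential part of \<open>hess i j\<close>.\<close>

lemma christoffel_metric:
  assumes "y \<in> W"
  shows "christoffel metric c i j y = (\<Sum>m\<in>UNIV. u m y $ c * (hess i j y \<bullet> e m y))"
proof -
  have p: "partial i (\<lambda>y. metric y $ j $ l) y = hess i j y \<bullet> dF l y + dF j y \<bullet> hess i l y" for i j l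
    unfolding metric_def vec_lambda_beta partial_along along_inner[OF dF_smooth dF_smooth assms] hess_def ..
  have "partial i (\<lambda>y. metric y $ j $ l) y + partial j (\<lambda>y. metric y $ i $ l) y - partial l (\<lambda>y. metric y $ i $ j) y
      = 2 * (hess i j y \<bullet> dF l y)" for l
    unfolding p hess_sym[OF assms, of j i] hess_sym[OF assms, of l i] hess_sym[OF assms, of l j]
    by (simp add: inner_commute[of "dF j y"])
  then have "christoffel metric c i j y = (\<Sum>l\<in>UNIV. (\<Sum>m\<in>UNIV. u m y $ c * u m y $ l) * (hess i j y \<bullet> dF l y))"
    unfolding christoffel_def matrix_inv_metric(1)[OF assms] vec_lambda_beta
    by (simp only: mult.left_commute[of _ 2] sum_distrib_left[symmetric])
  also have "\<dots> = (\<Sum>m\<in>UNIV. u m y $ c * (\<Sum>l\<in>UNIV. u m y $ l * (hess i j y \<bullet> dF l y)))"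
    unfolding sum_distrib_left sum_distrib_right by (subst sum.swap) (simp add: mult_ac)
  finally show ?thesis unfolding e_dF[OF assms] inner_sum_right inner_scaleR_right .
qed

lemma metric_inverse:
  assumes "y \<in> W"
  shows "(\<Sum>d\<in>UNIV. (dF c y \<bullet> dF d y) * (\<Sum>m\<in>UNIV. u m y $ l * u m y $ d)) = (if c = l then 1 else 0)"
proof -
  have "metric y ** matrix_inv (metric y) = mat 1"
    using matrix_inv_metric(2)[OF assms] by (rule matrix_left_right_inverse[THEN iffD1])
  then have "(\<Sum>d\<in>UNIV. metric y $ c $ d * matrix_inv (metric y) $ d $ l) = (if c = l then 1 else 0)"
    by (simp add: vec_eq_iff matrix_matrix_mult_def mat_def)
  then show ?thesis unfolding matrix_inv_metric(1)[OF assms] by (simp add: metric_def mult.commute)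
qed

text \<open>A visibly smooth form of the Christoffel symbols. \<open>christoffel\<close> is known to
  equal it on \<open>W\<close>, which suffices for derivatives because \<open>W\<close> is
  open.\<close>

definition chr :: "3 \<Rightarrow> 3 \<Rightarrow> 3 \<Rightarrow> real ^ 3 \<Rightarrow> real" where
  "chr c i j y = (\<Sum>m\<in>UNIV. u m y $ c * (hess i j y \<bullet> e m y))"

lemma chr_smooth: "smooth_on W (chr c i j)"
  unfolding chr_def[abs_def]
  by (intro smooth_on_sum smooth_on_mult smooth_on_inner W hess_smooth e_smooth smooth_on_bounded_linear[OF bounded_linear_vec_nth W u])

lemma partial_christoffel: "y \<in> W \<Longrightarrow> partial a (christoffel metric c i j) y = along (\<lambda>_. axis a 1) (chr c i j) y"
  unfolding partial_along
  by (rule along_cong[OF W chr_smooth, symmetric]) (simp_all add: christoffel_metric chr_def)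

lemma chr_tangent:
  assumes "y \<in> W"
  shows "(\<Sum>c\<in>UNIV. chr c i j y *\<^sub>R dF c y)
    = hess i j y - (hess i j y \<bullet> N y) *\<^sub>R N y - (hess i j y \<bullet> n1 y) *\<^sub>R n1 y - (hess i j y \<bullet> n2 y) *\<^sub>R n2 y"
proof -
  have "(\<Sum>c\<in>UNIV. chr c i j y *\<^sub>R dF c y) = (\<Sum>m\<in>UNIV. (hess i j y \<bullet> e m y) *\<^sub>R (\<Sum>c\<in>UNIV. (u m y $ c) *\<^sub>R dF c y))"
    unfolding chr_def scaleR_sum_left scaleR_sum_right by (subst sum.swap) (simp add: mult.commute)
  also have "\<dots> = (\<Sum>m\<in>UNIV. (hess i j y \<bullet> e m y) *\<^sub>R e m y)" by (simp only: e_dF[OF assms])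
  also have "\<dots> = hess i j y - ((hess i j y \<bullet> N y) *\<^sub>R N y + (hess i j y \<bullet> n1 y) *\<^sub>R n1 y + (hess i j y \<bullet> n2 y) *\<^sub>R n2 y)"
    unfolding eq_diff_eq by (rule trans[OF _ tangent_expand[OF assms, symmetric]]) (simp add: add_ac)
  finally show ?thesis by (simp add: diff_diff_eq)
qed

text \<open>The Gauss formula in \<open>\<real>\<^sup>6\<close>, where the normal space is spanned by \<open>N\<close>, \<open>n1\<close> and \<open>n2\<close>.\<close>

definition Rlow :: "real ^ 3 \<Rightarrow> real ^ 3 \<Rightarrow> real ^ 3 \<Rightarrow> real ^ 3 \<Rightarrow> real ^ 3 \<Rightarrow> real" where
  "Rlow y a b c d =
     (Hess y b c \<bullet> N y) * (Hess y a d \<bullet> N y) - (Hess y a c \<bullet> N y) * (Hess y b d \<bullet> N y)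
   + ((Hess y b c \<bullet> n1 y) * (Hess y a d \<bullet> n1 y) - (Hess y a c \<bullet> n1 y) * (Hess y b d \<bullet> n1 y))
   + ((Hess y b c \<bullet> n2 y) * (Hess y a d \<bullet> n2 y) - (Hess y a c \<bullet> n2 y) * (Hess y b d \<bullet> n2 y))"

text \<open>Split \<open>hess j r\<close> into its tangential part and the parts along
  \<open>N\<close>, \<open>n1\<close>, \<open>n2\<close>, differentiate, and pair with
  \<open>dF d\<close>. Third derivatives cancel by symmetry, and the quadratic Christoffel terms
  cancel by \<open>quad2\<close>; only products of second fundamental forms remain.\<close>

lemma riemann_lowered:
  assumes "y \<in> W"
  shows "(\<Sum>l\<in>UNIV. riemann metric l i j r y * (dF l y \<bullet> dF d y)) = Rlow y (axis i 1) (axis j 1) (axis r 1) (axis d 1)"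
proof -
  let ?D = "\<lambda>i. along (\<lambda>_. axis i 1)"
  have nrm: "dF d y \<bullet> N y = 0" "dF d y \<bullet> n1 y = 0" "dF d y \<bullet> n2 y = 0"
    "N y \<bullet> dF d y = 0" "n1 y \<bullet> dF d y = 0" "n2 y \<bullet> dF d y = 0" if "y \<in> W" for y d
    using dF_normal[OF that] by (simp_all add: dF_def inner_commute)
  have D\<nu>: "?D i \<nu> y \<bullet> dF d y = - (hess i d y \<bullet> \<nu> y)"
    if "smooth_on W \<nu>" "\<And>y. y \<in> W \<Longrightarrow> \<nu> y \<bullet> dF d y = 0" for \<nu> i
  proof -
    have "?D i (\<lambda>y. \<nu> y \<bullet> dF d y) y = 0"
      by (rule along_const_fun[OF smooth_on_inner[OF W that(1) dF_smooth] that(2) assms])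
    then show ?thesis
      unfolding along_inner[OF that(1) dF_smooth assms] hess_def by (simp add: inner_commute eq_neg_iff_add_eq_0)
  qed
  have DN: "?D i N y \<bullet> dF d y = - (hess i d y \<bullet> N y)" "?D i n1 y \<bullet> dF d y = - (hess i d y \<bullet> n1 y)"
    "?D i n2 y \<bullet> dF d y = - (hess i d y \<bullet> n2 y)" for i
    by (rule D\<nu>; simp add: N n_smooth nrm)+
  have quad: "(\<Sum>l\<in>UNIV. chr l i m y * (dF l y \<bullet> dF d y)) = hess i m y \<bullet> dF d y" for i m
  proof -
    have "(\<Sum>l\<in>UNIV. chr l i m y * (dF l y \<bullet> dF d y)) = (\<Sum>l\<in>UNIV. chr l i m y *\<^sub>R dF l y) \<bullet> dF d y"
      by (simp add: inner_sum_left)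
    then show ?thesis unfolding chr_tangent[OF assms] by (simp add: inner_diff_left nrm assms)
  qed
  have A: "(\<Sum>c\<in>UNIV. ?D i (chr c j r) y * (dF c y \<bullet> dF d y)) =
      ?D i (hess j r) y \<bullet> dF d y - (\<Sum>c\<in>UNIV. chr c j r y * (hess i c y \<bullet> dF d y))
      + (hess j r y \<bullet> N y) * (hess i d y \<bullet> N y) + (hess j r y \<bullet> n1 y) * (hess i d y \<bullet> n1 y) + (hess j r y \<bullet> n2 y) * (hess i d y \<bullet> n2 y)"
    for i j r
  proof -
    have sm: "smooth_on W (\<lambda>y. (hess j r y \<bullet> N y) *\<^sub>R N y)" "smooth_on W (\<lambda>y. (hess j r y \<bullet> n1 y) *\<^sub>R n1 y)"
      "smooth_on W (\<lambda>y. (hess j r y \<bullet> n2 y) *\<^sub>R n2 y)"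
      by (intro smooth_on_scaleR smooth_on_inner W hess_smooth N n_smooth)+
    have sc: "smooth_on W (\<lambda>y. chr c j r y *\<^sub>R dF c y)" for c
      by (intro smooth_on_scaleR W chr_smooth dF_smooth)
    define R where "R = (\<lambda>y. (\<Sum>c\<in>UNIV. chr c j r y *\<^sub>R dF c y)
      + ((hess j r y \<bullet> N y) *\<^sub>R N y + ((hess j r y \<bullet> n1 y) *\<^sub>R n1 y + (hess j r y \<bullet> n2 y) *\<^sub>R n2 y)))"
    have R: "hess j r y = R y" if "y \<in> W" for y
      unfolding R_def chr_tangent[OF that] by simp
    have "?D i (hess j r) y = ?D i R y"
      by (rule along_cong[OF W hess_smooth R assms])
    also have "\<dots> = ?D i (\<lambda>y. \<Sum>c\<in>UNIV. chr c j r y *\<^sub>R dF c y) y + (?D i (\<lambda>y. (hess j r y \<bullet> N y) *\<^sub>R N y) y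
        + (?D i (\<lambda>y. (hess j r y \<bullet> n1 y) *\<^sub>R n1 y) y + ?D i (\<lambda>y. (hess j r y \<bullet> n2 y) *\<^sub>R n2 y) y))"
      unfolding R_def
      by (simp only: along_add[OF smooth_on_sum[OF W sc] smooth_on_add[OF W sm(1) smooth_on_add[OF W sm(2,3)]] assms]
          along_add[OF sm(1) smooth_on_add[OF W sm(2,3)] assms] along_add[OF sm(2,3) assms])
    also have "?D i (\<lambda>y. \<Sum>c\<in>UNIV. chr c j r y *\<^sub>R dF c y) y = (\<Sum>c\<in>UNIV. ?D i (chr c j r) y *\<^sub>R dF c y + chr c j r y *\<^sub>R hess i c y)"
      by (simp only: along_sum[OF W sc assms] along_scaleR[OF chr_smooth dF_smooth assms] hess_def)
    finally have "?D i (hess j r) y \<bullet> dF d y = (\<Sum>c\<in>UNIV. ?D i (chr c j r) y * (dF c y \<bullet> dF d y)) + (\<Sum>c\<in>UNIV. chr c j r y * (hess i c y \<bullet> dF d y))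
        + ((hess j r y \<bullet> N y) * (?D i N y \<bullet> dF d y) + ((hess j r y \<bullet> n1 y) * (?D i n1 y \<bullet> dF d y) + (hess j r y \<bullet> n2 y) * (?D i n2 y \<bullet> dF d y)))"
      by (simp add: along_scaleR[OF smooth_on_inner[OF W hess_smooth N] N assms]
          along_scaleR[OF smooth_on_inner[OF W hess_smooth n_smooth(1)] n_smooth(1) assms]
          along_scaleR[OF smooth_on_inner[OF W hess_smooth n_smooth(2)] n_smooth(2) assms]
          inner_add_left inner_sum_left sum.distrib nrm assms)
    then show ?thesis unfolding DN by simp
  qed
  have comm: "?D i (hess j r) y = ?D j (hess i r) y"
    unfolding hess_def along_def by (rule second_derivative_sym[OF dF_smooth W assms])
  have quad2: "(\<Sum>l\<in>UNIV. (\<Sum>m\<in>UNIV. chr m j r y * chr l i m y) * (dF l y \<bullet> dF d y)) = (\<Sum>m\<in>UNIV. chr m j r y * (hess i m y \<bullet> dF d y))" for i j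
    unfolding quad[symmetric] sum_distrib_left sum_distrib_right by (subst sum.swap) (simp add: mult.assoc)
  have chr: "christoffel metric c i j y = chr c i j y" for c i j
    by (simp add: christoffel_metric[OF assms] chr_def)
  have "(\<Sum>l\<in>UNIV. riemann metric l i j r y * (dF l y \<bullet> dF d y)) =
      (\<Sum>l\<in>UNIV. ?D i (chr l j r) y * (dF l y \<bullet> dF d y)) - (\<Sum>l\<in>UNIV. ?D j (chr l i r) y * (dF l y \<bullet> dF d y))
      + (\<Sum>l\<in>UNIV. (\<Sum>m\<in>UNIV. chr m j r y * chr l i m y) * (dF l y \<bullet> dF d y))
      - (\<Sum>l\<in>UNIV. (\<Sum>m\<in>UNIV. chr m i r y * chr l j m y) * (dF l y \<bullet> dF d y))"
    unfolding riemann_def partial_christoffel[OF assms] chr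
    by (simp add: sum_subtractf sum.distrib left_diff_distrib distrib_right)
  also have "\<dots> = Rlow y (axis i 1) (axis j 1) (axis r 1) (axis d 1)"
    unfolding A quad2 comm Rlow_def hess_Hess[symmetric] by simp
  finally show ?thesis .
qed

end

context principal_frame
begin

lemma riemann_raised:
  assumes "y \<in> W"
  shows "riemann metric l i j r y =
    (\<Sum>d\<in>UNIV. (\<Sum>m\<in>UNIV. u m y $ l * u m y $ d) * Rlow y (axis i 1) (axis j 1) (axis r 1) (axis d 1))"
proof -
  have "(\<Sum>d\<in>UNIV. (\<Sum>m\<in>UNIV. u m y $ l * u m y $ d) * (\<Sum>c\<in>UNIV. riemann metric c i j r y * (dF c y \<bullet> dF d y)))
      = (\<Sum>c\<in>UNIV. riemann metric c i j r y * (\<Sum>d\<in>UNIV. (dF c y \<bullet> dF d y) * (\<Sum>m\<in>UNIV. u m y $ l * u m y $ d)))"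
    unfolding sum_distrib_left[where r = "riemann metric _ _ _ _ _"] sum_distrib_left[of "\<Sum>m\<in>UNIV. u m y $ l * u m y $ _"]
    by (subst sum.swap) (simp add: mult_ac)
  also have "\<dots> = (\<Sum>c\<in>UNIV. if c = l then riemann metric c i j r y else 0)"
    unfolding metric_inverse[OF assms] by (intro sum.cong) auto
  also have "\<dots> = riemann metric l i j r y" by simp
  finally show ?thesis unfolding riemann_lowered[OF assms] by simp
qed

lemma Rlow_linear:
  assumes "y \<in> W"
  shows "linear (\<lambda>a. Rlow y a b c d)" "linear (\<lambda>b. Rlow y a b c d)" "linear (\<lambda>c. Rlow y a b c d)" "linear (\<lambda>d. Rlow y a b c d)"
  unfolding Rlow_def
  by (rule linearI; simp add: linear_add[OF Hess_linear(1)[OF assms]] linear_scale[OF Hess_linear(1)[OF assms]]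
      linear_add[OF Hess_linear(2)[OF assms]] linear_scale[OF Hess_linear(2)[OF assms]] inner_add_left algebra_simps)+

text \<open>Raising an index and tracing are contractions with the inverse metric;
  \<open>bilinear_contraction\<close> turns both traces into sums over the frame.\<close>

lemma scalar_curvature_frame:
  assumes "y \<in> W"
  shows "scalar_curvature_coord metric y = (\<Sum>m\<in>UNIV. \<Sum>n\<in>UNIV. Rlow y (u n y) (u m y) (u m y) (u n y))"
proof -
  have ric: "ricci metric j r y = (\<Sum>n\<in>UNIV. Rlow y (u n y) (axis j 1) (axis r 1) (u n y))" for j r
    unfolding ricci_def riemann_raised[OF assms]
    by (rule bilinear_contraction) (rule Rlow_linear[OF assms])+
  show ?thesis
    unfolding scalar_curvature_coord_def ric matrix_inv_metric(1)[OF assms] vec_lambda_beta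
    by (rule bilinear_contraction) (intro linear_compose_sum ballI Rlow_linear[OF assms])+
qed

text \<open>The second derivative of \<open>F\<close> and the derivative of \<open>e j\<close>
  differ by a tangent vector, so their normal components agree.\<close>

lemma Hess_frame:
  assumes "y \<in> W"
  shows "Hess y (u i y) (u j y) \<bullet> N y = k i * kron i j"
    "Hess y (u i y) (u j y) \<bullet> n1 y = - (kron i j + f i j y) / 2"
    "Hess y (u i y) (u j y) \<bullet> n2 y = - (kron i j - f i j y) / 2"
proof -
  have "along (u i) (e j) y = Hess y (u i y) (u j y) + frechet_derivative F (at y) (along (u i) (u j) y)"
    unfolding e_def along_along[OF W F u assms] by (simp add: Hess_def along_def)
  then have "Hess y (u i y) (u j y) \<bullet> v = along (u i) (e j) y \<bullet> v" if "frechet_derivative F (at y) (along (u i) (u j) y) \<bullet> v = 0" for v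
    using that by (simp add: inner_add_left)
  then show "Hess y (u i y) (u j y) \<bullet> N y = k i * kron i j"
    "Hess y (u i y) (u j y) \<bullet> n1 y = - (kron i j + f i j y) / 2"
    "Hess y (u i y) (u j y) \<bullet> n2 y = - (kron i j - f i j y) / 2"
    by (simp_all only: dF_normal[OF assms] along_e[OF assms])
qed

text \<open>The traces of \<open>f\<close> and of its square are \<open>- C\<close> and 2 plus the
  square of \<open>C\<close>; thus \<open>C\<close> cancels and the ambient curvature contributes
  the constant 2.\<close>

theorem scalar_curvature_metric:
  assumes "y \<in> W" "distinct [i, j, l]"
  shows "scalar_curvature_coord metric y = 2 + 2 * (k i * k j + k i * k l + k j * k l)"
proof -
  have d: "i \<noteq> j" "j \<noteq> l" "i \<noteq> l" "j \<noteq> i" "l \<noteq> j" "l \<noteq> i" using assms by auto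
  note sum3 = sum_3_distinct[OF assms(2)]
  define fv where "fv = (\<lambda>a b. f a b y)"
  have sym: "fv j i = fv i j" "fv l i = fv i l" "fv l j = fv j l"
    unfolding fv_def by (rule f_sym[OF assms(1)])+
  have tr: "fv i i + fv j j + fv l l = - C y"
    using P_trace[OF assms(1)] by (simp add: sum3 fv_def)
  have sq: "(fv i i)\<^sup>2 + (fv i j)\<^sup>2 + (fv i l)\<^sup>2 + (x i y)\<^sup>2 = 1"
    "(fv i j)\<^sup>2 + (fv j j)\<^sup>2 + (fv j l)\<^sup>2 + (x j y)\<^sup>2 = 1" "(fv i l)\<^sup>2 + (fv j l)\<^sup>2 + (fv l l)\<^sup>2 + (x l y)\<^sup>2 = 1"
    using P_square[OF assms(1), of i i] P_square[OF assms(1), of j j] P_square[OF assms(1), of l l] sym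
    by (simp_all add: sum3 power2_eq_square fv_def)
  have un: "(x i y)\<^sup>2 + (x j y)\<^sup>2 + (x l y)\<^sup>2 + (C y)\<^sup>2 = 1"
    using P_unit[OF assms(1)] by (simp add: sum3)
  have R: "Rlow y (u n y) (u m y) (u m y) (u n y) = k m * k n - (k n * kron n m) * (k m * kron m n)
      + (1 + fv m m * fv n n - (kron n m) * (kron m n) - fv n m * fv m n) / 2" for m n
    unfolding Rlow_def Hess_frame[OF assms(1)] fv_def by (simp add: field_simps)
  have "scalar_curvature_coord metric y = 2 * (k i * k j + k i * k l + k j * k l)
     + (6 + (fv i i + fv j j + fv l l)\<^sup>2 - ((fv i i)\<^sup>2 + (fv j j)\<^sup>2 + (fv l l)\<^sup>2 + 2 * (fv i j)\<^sup>2 + 2 * (fv i l)\<^sup>2 + 2 * (fv j l)\<^sup>2)) / 2"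
    unfolding scalar_curvature_frame[OF assms(1)] sum3 R using d sym
    by (simp add: power2_eq_square field_simps)
  also have "(fv i i + fv j j + fv l l)\<^sup>2 = (C y)\<^sup>2" unfolding tr by simp
  also have "(fv i i)\<^sup>2 + (fv j j)\<^sup>2 + (fv l l)\<^sup>2 + 2 * (fv i j)\<^sup>2 + 2 * (fv i l)\<^sup>2 + 2 * (fv j l)\<^sup>2 = 2 + (C y)\<^sup>2"
    using sq un by linarith
  finally show ?thesis by simp
qed

end

section \<open>Existence of principal frames\<close>

lemma obtain_distinct_3:
  fixes l :: 3
  obtains i j where "distinct [i, j, l]"
proof -
  have "card (UNIV - {l}) = 2" by (simp add: card_Diff_singleton)
  then have "\<exists>i j. UNIV - {l} = {i, j} \<and> i \<noteq> j" unfolding card_2_iff by blast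
  then obtain i j where ij: "UNIV - {l} = {i, j}" "i \<noteq> j" by blast
  then have "i \<noteq> l" "j \<noteq> l" by blast+
  then show thesis using that[of i j] ij(2) by simp
qed

context frame_eqs
begin

text \<open>The axioms of \<open>frame_eqs\<close> survive a simultaneous change of sign of
  \<open>C\<close>, \<open>x\<close> and \<open>f\<close>, that is, of \<open>P\<close>; this turns
  \<open>C = - 1\<close> into \<open>C = 1\<close>.\<close>

lemma pole_product_abs:
  assumes "distinct [i, j, l]" "k l = 0" "p \<in> W" "(C p)\<^sup>2 = 1"
  shows "4 * (k i * k j) = - 3"
proof (cases "C p = 1")
  case True
  then show ?thesis using pole_product assms by blast
next
  case False
  then have "C p = - 1" using assms(4) power2_eq_1_iff by blast
  interpret neg: frame_eqs W S D k "\<lambda>y. - C y" "\<lambda>i y. - x i y" "\<lambda>i j y. - f i j y" \<Gamma>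
  proof
    fix y i j m l a b assume y: "y \<in> W"
    show "(k j - k m) * \<Gamma> i j m y - (k i - k m) * \<Gamma> j i m y = (- x i y * - f j m y - - x j y * - f i m y) / 2"
      using codazzi[OF y, of j m i] by simp
    show "D i (\<Gamma> j a b) y - D j (\<Gamma> i a b) y
          + (\<Sum>m\<in>UNIV. \<Gamma> j a m y * \<Gamma> i m b y - \<Gamma> i a m y * \<Gamma> j m b y
                - (\<Gamma> i j m y - \<Gamma> j i m y) * \<Gamma> m a b y)
          = (k i * k j + 1/2) * (kron j a * kron i b - kron i a * kron j b)
          + (- f j a y * - f i b y - - f i a y * - f j b y) / 2"
      using gauss[OF y, of i j a b] by simp
    show "- f i j y = - f j i y" using f_sym[OF y, of i j] by simp
    show "\<Gamma> i j m y = - \<Gamma> i m j y" by (rule G_skew[OF y])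
    show "(\<Sum>m\<in>UNIV. - f i m y * - f m j y) + - x i y * - x j y = kron i j"
      using P_square[OF y, of i j] by simp
    show "(\<Sum>m\<in>UNIV. - f i m y * - x m y) = - (- C y) * - x i y"
      using P_normal[OF y, of i] by simp
    show "(\<Sum>m\<in>UNIV. (- x m y)\<^sup>2) + (- C y)\<^sup>2 = 1" using P_unit[OF y] by simp
    show "(\<Sum>m\<in>UNIV. - f m m y) = - (- C y)" using P_trace[OF y] by (simp add: sum_negf)
    show "D l (\<lambda>y. - C y) y = - 2 * k l * - x l y" using D_C[OF y, of l] y by simp
    show "D l (\<lambda>y. - x i y) y = (\<Sum>m\<in>UNIV. \<Gamma> l i m y * - x m y) + k l * (- C y * kron l i - - f l i y)"
      using D_x[OF y, of l i] y by (simp add: sum_negf algebra_simps)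
    show "D l (\<lambda>y. - f i j y) y = (\<Sum>m\<in>UNIV. \<Gamma> l i m y * - f m j y + \<Gamma> l j m y * - f i m y)
          + k l * (kron l i * - x j y + kron l j * - x i y)"
      using D_f[OF y, of l i j] y by (simp add: sum_negf sum.distrib sum_subtractf algebra_simps)
  qed (auto intro: inj_k)
  show ?thesis using neg.pole_product[OF assms(1-3)] \<open>C p = - 1\<close> by simp
qed

text \<open>At a critical point \<open>k m * x m = 0\<close> for every \<open>m\<close>. Some
  \<open>x l\<close> is nonzero by \<open>P_unit\<close>, so \<open>k l = 0\<close>; the other two
  curvatures are nonzero and make their \<open>x\<close> vanish.\<close>

lemma critical_point_values:
  assumes "p \<in> W" "(C p)\<^sup>2 \<noteq> 1" "\<And>l. D l C p = 0"
  obtains i j l where "distinct [i, j, l]" "k l = 0" "C p = 0" "2 * (k i * k j) = - 1"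
proof -
  have kx: "k m * x m p = 0" for m using D_C[OF assms(1), of m] assms(3)[of m] by simp
  have "\<exists>l. x l p \<noteq> 0"
  proof (rule ccontr)
    assume "\<not> ?thesis"
    then show False using P_unit[OF assms(1)] assms(2) by simp
  qed
  then obtain l where l: "x l p \<noteq> 0" by blast
  obtain i j where d: "distinct [i, j, l]" by (rule obtain_distinct_3)
  have kl: "k l = 0" using kx[of l] l by simp
  have "k i \<noteq> 0" "k j \<noteq> 0" using k_neq[of i l] k_neq[of j l] kl d by auto
  then have "x i p = 0" "x j p = 0" using kx[of i] kx[of j] by auto
  then show thesis
    using that[OF d kl] critical_values[OF d kl assms(1) _ _ l] by blast
qed

end

text \<open>The data in a chart before any frame is available; a smooth principal frame is
  constructed from them.\<close>

locale local_hypersurface =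
  fixes W :: "(real ^ 3) set" and F N :: "real ^ 3 \<Rightarrow> R33"
  assumes W: "open W" and F: "smooth_on W F" and N: "smooth_on W N"
    and F_mem: "y \<in> W \<Longrightarrow> F y \<in> S2xS2"
    and dF_inj: "y \<in> W \<Longrightarrow> inj (frechet_derivative F (at y))"
    and N_tangent: "y \<in> W \<Longrightarrow> N y \<in> tangent_S2xS2 (F y)"
    and N_norm: "y \<in> W \<Longrightarrow> norm (N y) = 1"
    and N_normal: "y \<in> W \<Longrightarrow> N y \<bullet> frechet_derivative F (at y) v = 0"
begin

abbreviation dF where "dF y \<equiv> frechet_derivative F (at y)"
abbreviation dN where "dN y \<equiv> frechet_derivative N (at y)"

lemma lin: "y \<in> W \<Longrightarrow> linear (dF y)" "y \<in> W \<Longrightarrow> linear (dN y)"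
  using smooth_on_differentiable[OF F] smooth_on_differentiable[OF N] linear_frechet_derivative by blast+

lemma dF_eq_iff: "y \<in> W \<Longrightarrow> dF y v = dF y w \<longleftrightarrow> v = w"
  using dF_inj by (auto dest: injD)

definition n1 :: "real ^ 3 \<Rightarrow> R33" where "n1 y = (fst (F y), 0)"
definition n2 :: "real ^ 3 \<Rightarrow> R33" where "n2 y = (0, snd (F y))"

lemma inner_n: "v \<bullet> n1 y = fst v \<bullet> fst (F y)" "v \<bullet> n2 y = snd v \<bullet> snd (F y)"
  by (simp_all add: n1_def n2_def inner_prod_def)

lemma derivative_const_inner:
  fixes g h :: "real ^ 3 \<Rightarrow> 'b::euclidean_space"
  assumes "smooth_on W g" "smooth_on W h" "\<And>y. y \<in> W \<Longrightarrow> g y \<bullet> h y = c" "y \<in> W"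
  shows "frechet_derivative g (at y) v \<bullet> h y + g y \<bullet> frechet_derivative h (at y) v = 0"
proof -
  have "along (\<lambda>_. v) (\<lambda>y. g y \<bullet> h y) y = along (\<lambda>_. v) (\<lambda>_. c) y"
    by (rule along_cong[OF W smooth_on_inner[OF W assms(1,2)] assms(3,4)])
  then show ?thesis unfolding along_inner[OF assms(1,2,4)] by (simp add: along_def)
qed

lemma normals:
  assumes "y \<in> W"
  shows "n1 y \<bullet> n1 y = 1" "n2 y \<bullet> n2 y = 1" "n1 y \<bullet> n2 y = 0" "N y \<bullet> n1 y = 0" "N y \<bullet> n2 y = 0" "N y \<bullet> N y = 1"
    "dF y v \<bullet> n1 y = 0" "dF y v \<bullet> n2 y = 0" "dF y v \<bullet> N y = 0" "dN y v \<bullet> N y = 0"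
proof -
  have u: "fst (F y) \<bullet> fst (F y) = 1" "snd (F y) \<bullet> snd (F y) = 1" if "y \<in> W" for y
    using F_mem[OF that] by (auto simp: S2xS2_def mem_Times_iff norm_eq_1)
  show "n1 y \<bullet> n1 y = 1" "n2 y \<bullet> n2 y = 1" using u[OF assms] by (simp_all add: inner_n) (simp_all add: n1_def n2_def)
  show "n1 y \<bullet> n2 y = 0" by (simp add: n1_def n2_def)
  show "N y \<bullet> n1 y = 0" "N y \<bullet> n2 y = 0"
    using N_tangent[OF assms] by (auto simp: inner_n tangent_S2xS2_def)
  have NN: "N y \<bullet> N y = 1" if "y \<in> W" for y using N_norm[OF that] by (simp add: norm_eq_1)
  then show "N y \<bullet> N y = 1" using assms .
  show "dN y v \<bullet> N y = 0"
    using derivative_const_inner[OF N N NN assms, of v] by (simp add: inner_commute)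
  show "dF y v \<bullet> N y = 0" using N_normal[OF assms] by (simp add: inner_commute)
  have s: "smooth_on W (\<lambda>y. fst (F y))" "smooth_on W (\<lambda>y. snd (F y))"
    by (rule smooth_on_bounded_linear[OF bounded_linear_fst W F] smooth_on_bounded_linear[OF bounded_linear_snd W F])+
  have "frechet_derivative (\<lambda>y. fst (F y)) (at y) v = fst (dF y v)" "frechet_derivative (\<lambda>y. snd (F y)) (at y) v = snd (dF y v)"
    using along_bounded_linear[OF bounded_linear_fst F assms, of "\<lambda>_. v"] along_bounded_linear[OF bounded_linear_snd F assms, of "\<lambda>_. v"]
    by (simp_all add: along_def)
  then show "dF y v \<bullet> n1 y = 0" "dF y v \<bullet> n2 y = 0"
    using derivative_const_inner[OF s(1) s(1) u(1) assms, of v] derivative_const_inner[OF s(2) s(2) u(2) assms, of v]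
    unfolding inner_n by (simp_all add: inner_commute)
qed

lemma tangent_proj_inner:
  "tangent_proj (F y) v \<bullet> w = v \<bullet> w - (v \<bullet> n1 y) * (w \<bullet> n1 y) - (v \<bullet> n2 y) * (w \<bullet> n2 y)"
  unfolding inner_n by (simp add: tangent_proj_def inner_prod_def inner_diff_left inner_commute[of _ "fst w"] inner_commute[of _ "snd w"] inner_diff_right)

text \<open>The orthogonal complement of the three normals has dimension 6 - 3 and contains the
  image of the injective differential, also of dimension 3.\<close>

lemma tangent_image:
  assumes y: "y \<in> W" and z: "z \<bullet> N y = 0" "z \<bullet> n1 y = 0" "z \<bullet> n2 y = 0"
  obtains w where "dF y w = z"
proof -
  define A where "A = {N y, n1 y, n2 y}"
  note nm = normals[OF y]
  have neq: "N y \<noteq> n1 y" "N y \<noteq> n2 y" "n1 y \<noteq> n2 y" "0 \<notin> A"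
    using nm(1-6) unfolding A_def by (auto simp: inner_commute)
  have "pairwise orthogonal A"
    using nm(1-6) unfolding A_def by (auto simp: pairwise_insert orthogonal_def inner_commute)
  then have ind: "independent A" using neq(4) by (rule pairwise_orthogonal_independent)
  have dimA: "dim (span A) = 3"
    unfolding dim_span dim_eq_card_independent[OF ind] using neq by (simp add: A_def)
  define B where "B = {z \<in> UNIV. \<forall>x\<in>span A. orthogonal x z}"
  have "dim B + dim (span A) = dim (UNIV :: R33 set)"
    unfolding B_def by (rule dim_subspace_orthogonal_to_vectors) auto
  then have dimB: "dim B = 3" using dimA by simp
  have Bm: "w \<in> B \<longleftrightarrow> w \<bullet> N y = 0 \<and> w \<bullet> n1 y = 0 \<and> w \<bullet> n2 y = 0" for w
  proof
    assume "w \<in> B"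
    then have "orthogonal x w" if "x \<in> A" for x using that by (auto simp: B_def span_base)
    from this[of "N y"] this[of "n1 y"] this[of "n2 y"] show "w \<bullet> N y = 0 \<and> w \<bullet> n1 y = 0 \<and> w \<bullet> n2 y = 0"
      by (simp add: A_def orthogonal_def inner_commute)
  next
    assume "w \<bullet> N y = 0 \<and> w \<bullet> n1 y = 0 \<and> w \<bullet> n2 y = 0"
    then have "\<And>x. x \<in> A \<Longrightarrow> orthogonal w x" by (auto simp: A_def orthogonal_def)
    then have "orthogonal w x" if "x \<in> span A" for x by (rule orthogonal_to_span[OF that])
    then show "w \<in> B" by (auto simp: B_def orthogonal_commute)
  qed
  have sB: "subspace B" unfolding subspace_def by (auto simp: Bm inner_add_left)
  have sR: "subspace (range (dF y))" using lin(1)[OF y] by (simp add: linear_subspace_image)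
  have "dim (range (dF y)) = 3"
    using dim_image_eq[OF lin(1)[OF y], of UNIV] dF_inj[OF y] by simp
  moreover have "range (dF y) \<subseteq> B" by (auto simp: Bm nm)
  ultimately have "range (dF y) = B"
    using subspace_dim_equal[OF sR sB] dimB by simp
  then have "z \<in> range (dF y)" using Bm z by blast
  then show thesis using that by blast
qed

lemma shape_exists:
  assumes y: "y \<in> W"
  obtains w where "dF y w = - tangent_proj (F y) (dN y v)"
proof (rule tangent_image[OF y])
  show "- tangent_proj (F y) (dN y v) \<bullet> N y = 0" "- tangent_proj (F y) (dN y v) \<bullet> n1 y = 0" "- tangent_proj (F y) (dN y v) \<bullet> n2 y = 0"
    using normals[OF y] by (simp_all add: tangent_proj_inner inner_commute[of "n2 y" "n1 y"])
qed

text \<open>Differentiating the orthogonality of \<open>N\<close> and \<open>dF y w\<close> turns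
  each side into minus the pairing of \<open>N\<close> with a second derivative of \<open>F\<close>,
  which is symmetric.\<close>

lemma second_form_sym:
  assumes y: "y \<in> W" shows "dN y v \<bullet> dF y w = dN y w \<bullet> dF y v"
proof -
  have "dN y v \<bullet> dF y w + N y \<bullet> frechet_derivative (\<lambda>y. dF y w) (at y) v = 0" for v w
    by (rule derivative_const_inner[OF N smooth_on_deriv[OF F] N_normal y])
  from this[of v w] this[of w v] show ?thesis
    using second_derivative_sym[OF F W y, of w v] by simp
qed

end

lemma linear_tangent_proj: "linear (tangent_proj x)"
  by (rule linearI) (auto simp: tangent_proj_def inner_add_left algebra_simps)

lemma smooth_on_det:
  fixes A :: "'a::real_normed_vector \<Rightarrow> real ^ 'n ^ 'n"
  assumes "open S" "\<And>i j. smooth_on S (\<lambda>y. A y $ i $ j)"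
  shows "smooth_on S (\<lambda>y. det (A y))"
  unfolding det_def by (intro smooth_on_sum smooth_on_mult smooth_on_const smooth_on_prod assms)

lemma distinct_shift_3: "distinct [i, i + 1, i + 2]" for i :: 3
  using exhaust_3[of i] by auto

context local_hypersurface
begin

definition g :: "real ^ 3 \<Rightarrow> real ^ 3 ^ 3" where
  "g y = (\<chi> i j. dF y (axis i 1) \<bullet> dF y (axis j 1))"

text \<open>The shape operator applied to the vector field \<open>v\<close>. Cramer's rule, which solves for it in
  coordinates, shows that it is smooth.\<close>

definition shape_field :: "(real ^ 3 \<Rightarrow> real ^ 3) \<Rightarrow> real ^ 3 \<Rightarrow> real ^ 3" where
  "shape_field v y = (\<chi> m. det (\<chi> i j. if j = m then - (along v N y \<bullet> dF y (axis i 1)) else g y $ i $ j) / det (g y))"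

lemma g_mult: assumes "y \<in> W" shows "(g y *v a) $ i = dF y (axis i 1) \<bullet> dF y a"
proof -
  have "dF y a = (\<Sum>j\<in>UNIV. (a $ j) *\<^sub>R dF y (axis j 1))"
    by (rule linear_vec_expand[OF lin(1)[OF assms]])
  then have "dF y (axis i 1) \<bullet> dF y a = (\<Sum>j\<in>UNIV. (a $ j) * (dF y (axis i 1) \<bullet> dF y (axis j 1)))"
    by (simp only: inner_sum_right inner_scaleR_right)
  then show ?thesis by (simp add: g_def matrix_vector_mult_def mult.commute)
qed

lemma dF_inner_eq_0:
  assumes "y \<in> W" "\<And>i. dF y (axis i 1) \<bullet> z = 0" shows "dF y a \<bullet> z = 0"
proof -
  have "dF y a = (\<Sum>j\<in>UNIV. (a $ j) *\<^sub>R dF y (axis j 1))"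
    by (rule linear_vec_expand[OF lin(1)[OF assms(1)]])
  then have "dF y a \<bullet> z = (\<Sum>j\<in>UNIV. (a $ j) * (dF y (axis j 1) \<bullet> z))"
    by (simp only: inner_sum_left inner_scaleR_left)
  then show ?thesis by (simp add: assms(2))
qed

text \<open>For a Gram matrix, the difference of two vectors with equal images is sent by
  \<open>dF y\<close> to a vector orthogonal to itself.\<close>

lemma det_g: assumes "y \<in> W" shows "det (g y) \<noteq> 0"
proof -
  have "inj ((*v) (g y))"
  proof (rule injI)
    fix a b assume eq: "g y *v a = g y *v b"
    have "dF y (axis i 1) \<bullet> dF y (a - b) = 0" for i
      using eq g_mult[OF assms, of a i] g_mult[OF assms, of b i] by (simp add: linear_diff[OF lin(1)[OF assms]] inner_diff_right)
    then have "dF y (a - b) \<bullet> dF y (a - b) = 0" by (rule dF_inner_eq_0[OF assms])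
    then have "dF y a = dF y b" by (simp add: linear_diff[OF lin(1)[OF assms]])
    then show "a = b" using dF_eq_iff[OF assms] by simp
  qed
  then show ?thesis
    using matrix_left_invertible_injective[of "g y"] invertible_left_inverse invertible_det_nz by blast
qed

lemma shape_field_smooth:
  assumes "smooth_on W v" shows "smooth_on W (shape_field v)"
proof -
  have dFi: "smooth_on W (\<lambda>y. dF y (axis i 1))" for i by (rule smooth_on_deriv[OF F])
  have gij: "smooth_on W (\<lambda>y. g y $ i $ j)" for i j
    unfolding g_def vec_lambda_beta by (rule smooth_on_inner[OF W dFi dFi])
  have b: "smooth_on W (\<lambda>y. - (along v N y \<bullet> dF y (axis i 1)))" for i
    by (rule smooth_on_uminus[OF W smooth_on_inner[OF W smooth_on_along[OF W N assms] dFi]])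
  have ent: "smooth_on W (\<lambda>y. if j = m then - (along v N y \<bullet> dF y (axis i 1)) else g y $ i $ j)" for i j m
    by (cases "j = m") (simp_all add: gij b)
  have detm: "smooth_on W (\<lambda>y. det (\<chi> i j. if j = m then - (along v N y \<bullet> dF y (axis i 1)) else g y $ i $ j))" for m
    by (rule smooth_on_det[OF W]) (simp only: vec_lambda_beta, rule ent)
  show ?thesis
    unfolding shape_field_def[abs_def] divide_inverse
    by (intro smooth_on_vec_lambda smooth_on_mult smooth_on_inverse detm smooth_on_det[OF W gij] det_g W)
qed

lemma dF_shape_field:
  assumes y: "y \<in> W" shows "dF y (shape_field v y) = - tangent_proj (F y) (dN y (v y))"
proof -
  obtain w where w: "dF y w = - tangent_proj (F y) (dN y (v y))" by (rule shape_exists[OF y])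
  define b where "b = (\<chi> i. - (along v N y \<bullet> dF y (axis i 1)))"
  have "(g y *v w) $ i = b $ i" for i
  proof -
    have "(g y *v w) $ i = - (tangent_proj (F y) (dN y (v y)) \<bullet> dF y (axis i 1))"
      by (simp add: g_mult[OF y] w inner_commute)
    then show ?thesis by (simp add: b_def tangent_proj_inner normals[OF y] along_def)
  qed
  then have "g y *v w = b" by (simp add: vec_eq_iff)
  then have "w = shape_field v y"
    unfolding cramer[OF det_g[OF y]] shape_field_def b_def vec_lambda_beta .
  then show ?thesis using w by simp
qed

definition eigen :: "real ^ 3 \<Rightarrow> real \<Rightarrow> real ^ 3 \<Rightarrow> bool" where
  "eigen y a v \<longleftrightarrow> tangent_proj (F y) (dN y v) = - a *\<^sub>R dF y v"

lemma eigen_scale: "y \<in> W \<Longrightarrow> eigen y a v \<Longrightarrow> eigen y a (r *\<^sub>R v)"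
  by (simp add: eigen_def linear_scale[OF lin(1)] linear_scale[OF lin(2)] linear_scale[OF linear_tangent_proj])

lemma eigen_orthogonal:
  assumes y: "y \<in> W" and "eigen y a v" "eigen y b w" "a \<noteq> b"
  shows "dF y v \<bullet> dF y w = 0"
proof -
  have "tangent_proj (F y) (dN y v) \<bullet> dF y w = dN y v \<bullet> dF y w" for v w
    by (simp add: tangent_proj_inner normals[OF y])
  from this[of v w] this[of w v]
  have "- (a * (dF y v \<bullet> dF y w)) = dN y v \<bullet> dF y w" "- (b * (dF y w \<bullet> dF y v)) = dN y w \<bullet> dF y v"
    using assms(2,3) unfolding eigen_def by simp_all
  then have "a * (dF y v \<bullet> dF y w) = b * (dF y v \<bullet> dF y w)"
    using second_form_sym[OF y, of v w] inner_commute[of "dF y w" "dF y v"] by (metis neg_equal_iff_equal)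
  then show ?thesis using assms(4) by simp
qed

text \<open>Eigenvectors for distinct values have orthogonal images, which together with the three
  normals give an orthonormal basis of the ambient space; the remainder of \<open>v\<close> is
  orthogonal to all of it.\<close>

lemma eigen_expand:
  assumes y: "y \<in> W" and k: "inj k" and V: "\<And>m :: 3. V m \<noteq> 0" "\<And>m. eigen y (k m) (V m)"
  obtains c where "v = (\<Sum>m\<in>UNIV. c m *\<^sub>R V m)"
proof -
  have n: "dF y (V m) \<noteq> 0" for m
    using V(1)[of m] dF_eq_iff[OF y, of "V m" 0] linear_0[OF lin(1)[OF y]] by auto
  have orth: "dF y (V i) \<bullet> dF y (V j) = 0" if "i \<noteq> j" for i j
    by (rule eigen_orthogonal[OF y V(2) V(2)]) (use injD[OF k] that in blast)
  define e where "e = (\<lambda>m. dF y (V m) /\<^sub>R norm (dF y (V m)))"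
  have ee: "e i \<bullet> e j = kron i j" for i j
    by (cases "i = j") (use orth[of i j] n[of i] in \<open>simp_all add: e_def dot_square_norm power2_eq_square\<close>)
  note nm = normals[OF y]
  have en: "e i \<bullet> N y = 0" "e i \<bullet> n1 y = 0" "e i \<bullet> n2 y = 0" for i
    by (simp_all add: e_def nm)
  define c where "c = (\<lambda>m. (dF y v \<bullet> dF y (V m)) / (dF y (V m) \<bullet> dF y (V m)))"
  define r where "r = v - (\<Sum>m\<in>UNIV. c m *\<^sub>R V m)"
  have "dF y r = dF y v - (\<Sum>m\<in>UNIV. c m *\<^sub>R dF y (V m))"
    by (simp add: r_def linear_diff[OF lin(1)[OF y]] linear_sum[OF lin(1)[OF y]] linear_scale[OF lin(1)[OF y]])
  moreover have "(\<Sum>m\<in>UNIV. c m * (dF y (V m) \<bullet> dF y (V j))) = dF y v \<bullet> dF y (V j)" for j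
  proof -
    have "(\<Sum>m\<in>UNIV. c m * (dF y (V m) \<bullet> dF y (V j))) = (\<Sum>m\<in>UNIV. if m = j then dF y v \<bullet> dF y (V j) else 0)"
      using orth n by (intro sum.cong) (auto simp: c_def)
    then show ?thesis by simp
  qed
  ultimately have "dF y r \<bullet> dF y (V j) = 0" for j
    by (simp add: inner_diff_left inner_sum_left)
  then have "dF y r \<bullet> e j = 0" for j by (simp add: e_def)
  then have "dF y r \<bullet> dF y r = 0"
    using orthonormal_parseval_6[of e "N y" "n1 y" "n2 y" "dF y r" "dF y r"] ee en nm by (simp add: inner_commute)
  then have "r = 0" using dF_eq_iff[OF y, of r 0] linear_0[OF lin(1)[OF y]] by simp
  then show thesis using that[of c] by (simp add: r_def)
qed

lemma shape_field_expand:
  assumes y: "y \<in> W" and V: "\<And>m :: 3. eigen y (k m) (V m)" and v: "v y = (\<Sum>m\<in>UNIV. c m *\<^sub>R V m)"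
  shows "shape_field v y = (\<Sum>m\<in>UNIV. (c m * k m) *\<^sub>R V m)"
proof -
  note l1 = lin(1)[OF y] and l2 = lin(2)[OF y]
  have "dF y (shape_field v y) = dF y (\<Sum>m\<in>UNIV. (c m * k m) *\<^sub>R V m)"
    unfolding dF_shape_field[OF y] v
    using V by (simp add: linear_sum[OF l1] linear_scale[OF l1] linear_sum[OF l2] linear_scale[OF l2]
        linear_sum[OF linear_tangent_proj] linear_scale[OF linear_tangent_proj] eigen_def sum_negf)
  then show ?thesis using dF_eq_iff[OF y] by simp
qed

text \<open>The eigenvectors in \<open>eig\<close> are chosen point by point, without continuity. A
  polynomial in the shape operator that annihilates the other two eigenspaces, applied to a constant
  vector, gives smooth eigenvector fields; they are nonzero at \<open>p\<close>, hence nearby, and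
  can be normalized there.\<close>

lemma principal_frame_exists:
  assumes k: "inj k" and eig: "\<And>y i. y \<in> W \<Longrightarrow> \<exists>v. v \<noteq> 0 \<and> eigen y (k i) v" and p: "p \<in> W"
  obtains W' u where "p \<in> W'" "W' \<subseteq> W" "principal_frame W' F N k u"
proof -
  have kn: "k a \<noteq> k b" if "a \<noteq> b" for a b using injD[OF k] that by blast
  obtain V0 where V0: "\<And>i. V0 i \<noteq> 0" "\<And>i. eigen p (k i) (V0 i)" using eig[OF p] by metis
  define S where "S = (\<lambda>i y. shape_field (\<lambda>_. V0 i) y - k (i + 1) *\<^sub>R V0 i)"
  \<comment> \<open>\<open>Z i = (A - k (i + 2)) (A - k (i + 1)) (V0 i)\<close>, where \<open>i + 1\<close> and \<open>i + 2\<close> are taken modulo 3\<close>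
  define Z where "Z = (\<lambda>i y. shape_field (S i) y - k (i + 2) *\<^sub>R S i y)"
  have Ssm: "smooth_on W (S i)" for i
    unfolding S_def by (intro smooth_on_diff W shape_field_smooth smooth_on_const)
  have Zsm: "smooth_on W (Z i)" for i
    unfolding Z_def by (intro smooth_on_diff W shape_field_smooth Ssm smooth_on_scaleR smooth_on_const)
  have Z: "Z i y = (c i * (k i - k (i + 1)) * (k i - k (i + 2))) *\<^sub>R V i"
    if "y \<in> W" "\<And>m. eigen y (k m) (V m)" "V0 i = (\<Sum>m\<in>UNIV. c m *\<^sub>R V m)" for i y V c
  proof -
    have "S i y = (\<Sum>m\<in>UNIV. (c m * (k m - k (i + 1))) *\<^sub>R V m)"
      unfolding S_def shape_field_expand[OF that(1,2), of "\<lambda>_. V0 i" c, OF that(3)]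
      by (subst that(3)) (simp add: scaleR_sum_right algebra_simps flip: sum_subtractf)
    moreover from shape_field_expand[where v = "S i", OF that(1,2) this]
    have "shape_field (S i) y = (\<Sum>m\<in>UNIV. (c m * (k m - k (i + 1)) * k m) *\<^sub>R V m)" .
    ultimately have "Z i y = (\<Sum>m\<in>UNIV. (c m * (k m - k (i + 1)) * (k m - k (i + 2))) *\<^sub>R V m)"
      unfolding Z_def by (simp add: scaleR_sum_right algebra_simps flip: sum_subtractf)
    then show ?thesis by (simp add: sum_3_distinct[OF distinct_shift_3[of i]])
  qed
  have Zeig: "eigen y (k i) (Z i y)" if y: "y \<in> W" for i y
  proof -
    obtain V where V: "\<And>i. V i \<noteq> 0" "\<And>i. eigen y (k i) (V i)" using eig[OF y] by metis
    obtain c where c: "V0 i = (\<Sum>m\<in>UNIV. c m *\<^sub>R V m)" by (rule eigen_expand[OF y k V])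
    show ?thesis unfolding Z[OF y V(2) c] by (rule eigen_scale[OF y V(2)])
  qed
  have Zp: "Z i p \<noteq> 0" for i
  proof -
    have "V0 i = (\<Sum>m\<in>UNIV. kron m i *\<^sub>R V0 m)"
    proof -
      have "(\<Sum>m\<in>UNIV. kron m i *\<^sub>R V0 m) = (\<Sum>m\<in>UNIV. if m = i then V0 i else 0)"
        by (intro sum.cong) auto
      then show ?thesis by simp
    qed
    from Z[OF p V0(2) this] show ?thesis
      using V0(1)[of i] distinct_shift_3[of i] kn[of i "i + 1"] kn[of i "i + 2"] by simp
  qed
  define W' where "W' = (\<Inter>i. W \<inter> Z i -` (- {0}))"
  have W'o: "open W'"
    unfolding W'_def
    by (intro open_INT finite_UNIV ballI continuous_open_preimage smooth_on_continuous Zsm W) auto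
  have W': "W' \<subseteq> W" "p \<in> W'" "\<And>y i. y \<in> W' \<Longrightarrow> Z i y \<noteq> 0" using p Zp by (auto simp: W'_def)
  define r where "r = (\<lambda>i y. inverse (sqrt (along (Z i) F y \<bullet> along (Z i) F y)))"
  define u where "u = (\<lambda>i y. r i y *\<^sub>R Z i y)"
  have pos: "along (Z i) F y \<bullet> along (Z i) F y > 0" if "y \<in> W'" for i y
  proof -
    have "y \<in> W" "Z i y \<noteq> 0" using W' that by auto
    then have "dF y (Z i y) \<noteq> 0"
      using dF_eq_iff[of y "Z i y" 0] linear_0[OF lin(1)] by auto
    then show ?thesis by (simp add: along_def)
  qed
  have usm: "smooth_on W' (u i)" for i
    unfolding u_def r_def
    by (intro smooth_on_scaleR smooth_on_inverse_sqrt smooth_on_inner smooth_on_along W'o pos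
        smooth_on_subset[OF Zsm W'(1)] smooth_on_subset[OF F W'(1)])
  have ueig: "eigen y (k i) (u i y)" if "y \<in> W'" for i y
    unfolding u_def using W' that by (intro eigen_scale Zeig) auto
  have "principal_frame W' F N k u"
  proof
    show "open W'" "smooth_on W' F" "smooth_on W' N" "smooth_on W' (u i)" "inj k" for i
      using W'o smooth_on_subset[OF F W'(1)] smooth_on_subset[OF N W'(1)] usm k by auto
    fix y i j v assume y': "y \<in> W'"
    then have y: "y \<in> W" using W' by auto
    show "F y \<in> S2xS2" "inj (dF y)" "N y \<in> tangent_S2xS2 (F y)" "norm (N y) = 1" "N y \<bullet> dF y v = 0"
      by (rule F_mem[OF y] dF_inj[OF y] N_tangent[OF y] N_norm[OF y] N_normal[OF y])+
    show "tangent_proj (F y) (along (u i) N y) = - k i *\<^sub>R along (u i) F y"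
      using ueig[OF y', of i] by (simp add: eigen_def along_def)
    show "along (u i) F y \<bullet> along (u j) F y = kron i j"
    proof (cases "i = j")
      case True
      have "along (u i) F y = r i y *\<^sub>R along (Z i) F y"
        by (simp add: along_def u_def linear_scale[OF lin(1)[OF y]])
      then have "along (u i) F y \<bullet> along (u i) F y = (r i y)\<^sup>2 * (along (Z i) F y \<bullet> along (Z i) F y)"
        by (simp add: power2_eq_square)
      also have "\<dots> = 1" using pos[OF y', of i] by (simp add: r_def power_inverse)
      finally show ?thesis using True by simp
    next
      case False
      then show ?thesis
        using eigen_orthogonal[OF y ueig[OF y'] ueig[OF y'] kn[OF False]] by (simp add: along_def)
    qed
  qed
  then show thesis using that W' by blast
qed

end

section \<open>Charts and the theorem\<close>

context local_hypersurface
begin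

definition shape :: "real ^ 3 \<Rightarrow> real ^ 3 \<Rightarrow> real ^ 3" where
  "shape y v = (THE w. dF y w = - tangent_proj (F y) (dN y v))"

lemma dF_shape:
  assumes y: "y \<in> W" shows "dF y (shape y v) = - tangent_proj (F y) (dN y v)"
proof -
  obtain w where w: "dF y w = - tangent_proj (F y) (dN y v)" by (rule shape_exists[OF y])
  show ?thesis unfolding shape_def
    by (rule theI[of _ w]) (use w dF_eq_iff[OF y] in metis)+
qed

lemma shape_eigen: "y \<in> W \<Longrightarrow> shape y v = a *\<^sub>R v \<longleftrightarrow> eigen y a v"
  using dF_eq_iff[of y "shape y v" "a *\<^sub>R v"]
  by (auto simp: dF_shape eigen_def linear_scale[OF lin(1)] minus_equation_iff)

lemma linear_shape: assumes y: "y \<in> W" shows "linear (shape y)"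
proof (rule linearI)
  show "shape y (v + w) = shape y v + shape y w" for v w
    unfolding dF_eq_iff[OF y, symmetric]
    by (simp add: dF_shape[OF y] linear_add[OF lin(1)[OF y]] linear_add[OF lin(2)[OF y]] linear_add[OF linear_tangent_proj])
  show "shape y (r *\<^sub>R v) = r *\<^sub>R shape y v" for r v
    unfolding dF_eq_iff[OF y, symmetric]
    by (simp add: dF_shape[OF y] linear_scale[OF lin(1)[OF y]] linear_scale[OF lin(2)[OF y]] linear_scale[OF linear_tangent_proj])
qed

lemma det_shape:
  assumes y: "y \<in> W" shows "det (matrix (shape y)) = 0 \<longleftrightarrow> (\<exists>v. v \<noteq> 0 \<and> eigen y 0 v)"
proof -
  have "det (matrix (shape y)) \<noteq> 0 \<longleftrightarrow> inj (shape y)"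
    by (rule det_nz_iff_inj[OF linear_shape[OF y]])
  also have "\<dots> \<longleftrightarrow> (\<forall>v. shape y v = 0 \<longrightarrow> v = 0)"
    by (rule linear_injective_0[OF linear_shape[OF y]])
  finally show ?thesis using shape_eigen[OF y, of _ 0] by auto
qed

end

lemma frechet_derivative_chain:
  assumes "open S" "y \<in> S" "\<And>z. z \<in> S \<Longrightarrow> f z = h (\<psi> z)"
    and "h differentiable (at (\<psi> y))" "\<psi> differentiable (at y)"
  shows "frechet_derivative f (at y) v = frechet_derivative h (at (\<psi> y)) (frechet_derivative \<psi> (at y) v)"
proof -
  have "((\<lambda>z. h (\<psi> z)) has_derivative (\<lambda>v. frechet_derivative h (at (\<psi> y)) (frechet_derivative \<psi> (at y) v))) (at y)"
    by (rule has_derivative_compose[OF has_derivative_frechet[OF assms(5)] has_derivative_frechet[OF assms(4)]])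
  then have "(f has_derivative (\<lambda>v. frechet_derivative h (at (\<psi> y)) (frechet_derivative \<psi> (at y) v))) (at y)"
    by (rule has_derivative_transform_within_open[OF _ assms(1,2)]) (simp add: assms(3))
  from frechet_derivative_at[OF this] show ?thesis by metis
qed

section \<open>Charts, transition maps and change of coordinates\<close>

context
  fixes M :: "'m topology" and \<A> :: "('m, 'n::finite) chart set"
  assumes M: "smooth_manifold M \<A>"
begin

lemma chart_inj: "c \<in> \<A> \<Longrightarrow> inj_on (snd c) (fst c)" and chart_sub: "c \<in> \<A> \<Longrightarrow> fst c \<subseteq> topspace M"
  and chart_open: "c \<in> \<A> \<Longrightarrow> open (snd c ` fst c)"
  and overlap_open: "c \<in> \<A> \<Longrightarrow> d \<in> \<A> \<Longrightarrow> open (snd c ` (fst c \<inter> fst d))"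
proof -
  have *: "openin M (fst c) \<and> open (snd c ` fst c) \<and>
      homeomorphic_map (subtopology M (fst c)) (top_of_set (snd c ` fst c)) (snd c)" if "c \<in> \<A>" for c
    using M that by (simp add: smooth_manifold_def case_prod_beta)
  show sub: "fst c \<subseteq> topspace M" if "c \<in> \<A>" for c using *[OF that] openin_subset by blast
  have top: "topspace (subtopology M (fst c)) = fst c" if "c \<in> \<A>" for c using sub[OF that] by (rule topspace_subtopology_subset)
  show "inj_on (snd c) (fst c)" if "c \<in> \<A>" for c
    using homeomorphic_imp_injective_map *[OF that] top[OF that] by metis
  show "open (snd c ` fst c)" if "c \<in> \<A>" for c using *[OF that] by blast
  show "open (snd c ` (fst c \<inter> fst d))" if "c \<in> \<A>" "d \<in> \<A>" for c d
  proof -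
    have "openin (subtopology M (fst c)) (fst c \<inter> fst d)"
      using *[OF that(2)] by (metis openin_subtopology_Int2)
    moreover have "open_map (subtopology M (fst c)) (top_of_set (snd c ` fst c)) (snd c)"
      using *[OF that(1)] homeomorphic_imp_open_map by blast
    ultimately have "openin (top_of_set (snd c ` fst c)) (snd c ` (fst c \<inter> fst d))"
      by (simp add: open_map_def)
    then show ?thesis using *[OF that(1)] openin_open_trans by blast
  qed
qed

lemma in_chart_apply: "c \<in> \<A> \<Longrightarrow> q \<in> fst c \<Longrightarrow> in_chart c f (snd c q) = f q"
  using chart_inj by (simp add: in_chart_def)

lemma chart_at_mem: "q \<in> topspace M \<Longrightarrow> chart_at \<A> q \<in> \<A> \<and> q \<in> fst (chart_at \<A> q)"
proof -
  assume "q \<in> topspace M"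
  then have "q \<in> (\<Union>c\<in>\<A>. fst c)" using M by (simp add: smooth_manifold_def)
  then have "\<exists>c. c \<in> \<A> \<and> q \<in> fst c" by blast
  then show ?thesis unfolding chart_at_def by (rule someI_ex)
qed

lemma transition_differentiable:
  assumes "c \<in> \<A>" "d \<in> \<A>" "q \<in> fst c" "q \<in> fst d"
  shows "in_chart c (snd d) differentiable (at (snd c q))"
proof -
  have "smooth_on (snd c ` (fst c \<inter> fst d)) (in_chart c (snd d))"
    using M assms by (auto simp: smooth_manifold_def)
  then show ?thesis by (rule smooth_on_differentiable) (use assms in auto)
qed

text \<open>The chain rule for the identity, written as a composition of transition maps on the open
  overlap.\<close>

lemma transition_inverse:
  assumes "c \<in> \<A>" "d \<in> \<A>" "q \<in> fst c" "q \<in> fst d"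
  shows "frechet_derivative (in_chart d (snd c)) (at (snd d q)) (frechet_derivative (in_chart c (snd d)) (at (snd c q)) v) = v"
proof -
  have "frechet_derivative (\<lambda>z. z) (at (snd c q)) v
     = frechet_derivative (in_chart d (snd c)) (at (in_chart c (snd d) (snd c q))) (frechet_derivative (in_chart c (snd d)) (at (snd c q)) v)"
  proof (rule frechet_derivative_chain[OF overlap_open[OF assms(1,2)]])
    show "snd c q \<in> snd c ` (fst c \<inter> fst d)" using assms by auto
    show "in_chart c (snd d) differentiable at (snd c q)" by (rule transition_differentiable[OF assms])
    show "in_chart d (snd c) differentiable at (in_chart c (snd d) (snd c q))"
      unfolding in_chart_apply[OF assms(1,3)] by (rule transition_differentiable[OF assms(2,1,4,3)])
    show "z = in_chart d (snd c) (in_chart c (snd d) z)" if "z \<in> snd c ` (fst c \<inter> fst d)" for z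
      using that by (auto simp: in_chart_apply[OF assms(1)] in_chart_apply[OF assms(2)])
  qed
  moreover have "frechet_derivative (\<lambda>z. z) (at (snd c q)) v = v"
    using frechet_derivative_at[OF has_derivative_ident, of "snd c q"] by metis
  ultimately show ?thesis unfolding in_chart_apply[OF assms(1,3)] by simp
qed

lemma chart_change:
  fixes f :: "'m \<Rightarrow> 'b::real_normed_vector"
  assumes "c \<in> \<A>" "d \<in> \<A>" "q \<in> fst c" "q \<in> fst d" "smooth_map \<A> f"
  shows "frechet_derivative (in_chart c f) (at (snd c q)) v
     = frechet_derivative (in_chart d f) (at (snd d q)) (frechet_derivative (in_chart c (snd d)) (at (snd c q)) v)"
proof -
  have "frechet_derivative (in_chart c f) (at (snd c q)) v
     = frechet_derivative (in_chart d f) (at (in_chart c (snd d) (snd c q))) (frechet_derivative (in_chart c (snd d)) (at (snd c q)) v)"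
  proof (rule frechet_derivative_chain[OF overlap_open[OF assms(1,2)]])
    show "snd c q \<in> snd c ` (fst c \<inter> fst d)" using assms by auto
    show "in_chart c (snd d) differentiable at (snd c q)" by (rule transition_differentiable[OF assms(1-4)])
    show "in_chart d f differentiable at (in_chart c (snd d) (snd c q))"
      unfolding in_chart_apply[OF assms(1,3)]
      using assms by (intro smooth_on_differentiable[of "snd d ` fst d"]) (auto simp: smooth_map_def)
    show "in_chart c f z = in_chart d f (in_chart c (snd d) z)" if "z \<in> snd c ` (fst c \<inter> fst d)" for z
      using that by (auto simp: in_chart_apply[OF assms(1)] in_chart_apply[OF assms(2)])
  qed
  then show ?thesis unfolding in_chart_apply[OF assms(1,3)] .
qed

end

text \<open>The pointwise notions use \<open>chart_at\<close>, which may change from point to point,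
  whereas a frame needs one chart on an open set. The derivative \<open>L\<close> of the coordinate
  change is bijective and carries immersion, normality and eigenvectors over to
  \<open>c\<close>.\<close>

lemma local_hypersurface_chart:
  assumes H: "hypersurface M \<A> \<Phi>" and NF: "unit_normal_field M \<A> \<Phi> N" and c: "c \<in> \<A>"
  shows "local_hypersurface (snd c ` fst c) (in_chart c \<Phi>) (in_chart c N)"
    and "q \<in> fst c \<Longrightarrow> a \<in> principal_curvatures \<A> \<Phi> N q \<Longrightarrow>
      \<exists>v. v \<noteq> 0 \<and> local_hypersurface.eigen (in_chart c \<Phi>) (in_chart c N) (snd c q) a v"
proof -
  have M: "smooth_manifold M \<A>" and sm: "smooth_map \<A> \<Phi>" "smooth_map \<A> N"
    using H NF by (auto simp: hypersurface_def unit_normal_field_def)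
  have diff: "\<exists>L. (\<forall>v. frechet_derivative (in_chart c \<Phi>) (at (snd c q)) v = differential \<A> \<Phi> q (L v))
      \<and> (\<forall>v. frechet_derivative (in_chart c N) (at (snd c q)) v = differential \<A> N q (L v))
      \<and> inj L \<and> surj L \<and> L 0 = 0" if q: "q \<in> fst c" for q
  proof -
    define d where "d = chart_at \<A> q"
    have d: "d \<in> \<A>" "q \<in> fst d"
      using chart_at_mem[OF M, of q] chart_sub[OF M c] q unfolding d_def by auto
    define L where "L = frechet_derivative (in_chart c (snd d)) (at (snd c q))"
    define L' where "L' = frechet_derivative (in_chart d (snd c)) (at (snd d q))"
    have LL: "L' (L v) = v" "L (L' v) = v" for v
      unfolding L_def L'_def by (rule transition_inverse[OF M c d(1) q d(2)] transition_inverse[OF M d(1) c d(2) q])+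
    have "linear L" unfolding L_def
      by (rule linear_frechet_derivative[OF transition_differentiable[OF M c d(1) q d(2)]])
    then show ?thesis
      using chart_change[OF M c d(1) q d(2) sm(1)] chart_change[OF M c d(1) q d(2) sm(2)] LL linear_0[of L]
      unfolding differential_def Let_def d_def[symmetric] L_def[symmetric]
      by (intro exI[of _ L]) (metis injI surjI)
  qed
  show lh: "local_hypersurface (snd c ` fst c) (in_chart c \<Phi>) (in_chart c N)"
  proof
    show "open (snd c ` fst c)" by (rule chart_open[OF M c])
    show "smooth_on (snd c ` fst c) (in_chart c \<Phi>)" "smooth_on (snd c ` fst c) (in_chart c N)"
      using sm c by (auto simp: smooth_map_def)
    fix y v assume "y \<in> snd c ` fst c"
    then obtain q where q: "q \<in> fst c" "y = snd c q" by auto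
    have qM: "q \<in> topspace M" using chart_sub[OF M c] q by auto
    obtain L where L: "\<And>v. frechet_derivative (in_chart c \<Phi>) (at y) v = differential \<A> \<Phi> q (L v)" "inj L"
      using diff[OF q(1)] q(2) by metis
    have ap: "in_chart c \<Phi> y = \<Phi> q" "in_chart c N y = N q"
      using in_chart_apply[OF M c q(1)] q(2) by auto
    show "in_chart c \<Phi> y \<in> S2xS2" using H qM by (auto simp: ap hypersurface_def)
    have "inj (differential \<A> \<Phi> q)" using H qM by (auto simp: hypersurface_def)
    then show "inj (frechet_derivative (in_chart c \<Phi>) (at y))"
      using L by (auto simp: inj_def)
    show "in_chart c N y \<in> tangent_S2xS2 (in_chart c \<Phi> y)" "norm (in_chart c N y) = 1"
      "in_chart c N y \<bullet> frechet_derivative (in_chart c \<Phi>) (at y) v = 0"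
      using NF qM by (auto simp: ap L(1) unit_normal_field_def)
  qed
  then interpret lh: local_hypersurface "snd c ` fst c" "in_chart c \<Phi>" "in_chart c N" .
  show "\<exists>v. v \<noteq> 0 \<and> lh.eigen (snd c q) a v" if q: "q \<in> fst c" and a: "a \<in> principal_curvatures \<A> \<Phi> N q"
  proof -
    obtain w where w: "w \<noteq> 0" "shape_operator \<A> \<Phi> N q w = a *\<^sub>R w" using a by (auto simp: principal_curvatures_def)
    obtain L where L: "\<And>v. frechet_derivative (in_chart c \<Phi>) (at (snd c q)) v = differential \<A> \<Phi> q (L v)"
      "\<And>v. frechet_derivative (in_chart c N) (at (snd c q)) v = differential \<A> N q (L v)" "surj L" "L 0 = 0"
      using diff[OF q] by metis
    have y: "snd c q \<in> snd c ` fst c" using q by auto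
    have ap: "in_chart c \<Phi> (snd c q) = \<Phi> q" using in_chart_apply[OF M c q] .
    have qM: "q \<in> topspace M" using chart_sub[OF M c] q by auto
    obtain v where v: "L v = w" using L(3) by (metis surjD)
    obtain z where "frechet_derivative (in_chart c \<Phi>) (at (snd c q)) z
        = - tangent_proj (in_chart c \<Phi> (snd c q)) (frechet_derivative (in_chart c N) (at (snd c q)) v)"
      by (rule lh.shape_exists[OF y])
    then have z: "differential \<A> \<Phi> q (L z) = - tangent_proj (\<Phi> q) (differential \<A> N q w)"
      unfolding L ap v .
    have inj: "inj (differential \<A> \<Phi> q)" using H qM by (auto simp: hypersurface_def)
    have "shape_operator \<A> \<Phi> N q w = L z"
      unfolding shape_operator_def
    proof (rule the_equality)
      show "w' = L z" if "differential \<A> \<Phi> q w' = - tangent_proj (\<Phi> q) (differential \<A> N q w)" for w'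
        by (rule injD[OF inj]) (simp add: that z)
    qed (rule z)
    then have e: "differential \<A> \<Phi> q (a *\<^sub>R w) = - tangent_proj (\<Phi> q) (differential \<A> N q w)"
      using z w(2) by simp
    have "linear (differential \<A> \<Phi> q)"
      using chart_at_mem[OF M qM] sm(1) unfolding differential_def Let_def
      by (intro linear_frechet_derivative smooth_on_differentiable[of "snd (chart_at \<A> q) ` fst (chart_at \<A> q)"])
        (auto simp: smooth_map_def)
    then have "tangent_proj (\<Phi> q) (differential \<A> N q w) = - a *\<^sub>R differential \<A> \<Phi> q w"
      using e by (simp add: linear_scale minus_equation_iff)
    then have "lh.eigen (snd c q) a v" unfolding lh.eigen_def L ap v .
    moreover have "v \<noteq> 0" using v w(1) L(4) by auto
    ultimately show ?thesis by blast
  qed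
qed

text \<open>Collects at one point all consequences of the local analysis, as statements about the
  constants \<open>k\<close> and the value of \<open>C_fun N\<close>.\<close>

lemma hypersurface_point:
  fixes k :: "3 \<Rightarrow> real" and p :: 'm
  assumes H: "hypersurface M \<A> \<Phi>" and NF: "unit_normal_field M \<A> \<Phi> N"
    and k: "inj k" and pc: "\<forall>p\<in>topspace M. principal_curvatures \<A> \<Phi> N p = range k" and p: "p \<in> topspace M"
  shows "gauss_kronecker \<A> \<Phi> N p = 0 \<longleftrightarrow> (\<exists>l. k l = 0)"
    and "(C_fun N p)\<^sup>2 \<le> 1"
    and "distinct [i, j, l] \<Longrightarrow> scalar_curvature \<A> \<Phi> p = 2 + 2 * (k i * k j + k i * k l + k j * k l)"
    and "distinct [i, j, l] \<Longrightarrow> k l = 0 \<Longrightarrow> (C_fun N p)\<^sup>2 = 1 \<Longrightarrow> 4 * (k i * k j) = - 3"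
    and "critical_point \<A> (C_fun N) p \<Longrightarrow> (C_fun N p)\<^sup>2 \<noteq> 1 \<Longrightarrow>
      C_fun N p = 0 \<and> (\<exists>i j l. distinct [i, j, l] \<and> k l = 0 \<and> 2 * (k i * k j) = - 1)"
proof -
  have M: "smooth_manifold M \<A>" using H by (auto simp: hypersurface_def)
  \<comment> \<open>In this chart the differential at \<open>p\<close> is literally the coordinate
    derivative; a change of chart matters only for the neighbouring points.\<close>
  define c where "c = chart_at \<A> p"
  have c: "c \<in> \<A>" "p \<in> fst c" using chart_at_mem[OF M p] by (auto simp: c_def)
  define W where "W = snd c ` fst c"
  define F where "F = in_chart c \<Phi>"
  define Nc where "Nc = in_chart c N"
  define y where "y = snd c p"
  have y: "y \<in> W" using c by (auto simp: y_def W_def)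
  interpret lh: local_hypersurface W F Nc
    unfolding W_def F_def Nc_def by (rule local_hypersurface_chart(1)[OF H NF c(1)])
  have eig: "\<exists>v. v \<noteq> 0 \<and> lh.eigen z (k i) v" if z: "z \<in> W" for z i
  proof -
    obtain q where q: "q \<in> fst c" "z = snd c q" using z by (auto simp: W_def)
    then have "k i \<in> principal_curvatures \<A> \<Phi> N q" using pc chart_sub[OF M c(1)] by auto
    then show ?thesis using local_hypersurface_chart(2)[OF H NF c(1) q(1)] q(2) unfolding F_def Nc_def by blast
  qed
  obtain W' u where u: "y \<in> W'" "W' \<subseteq> W" "principal_frame W' F Nc k u"
    by (rule lh.principal_frame_exists[OF k eig y])
  interpret pf: principal_frame W' F Nc k u by (rule u)
  have diff: "differential \<A> g p = frechet_derivative (in_chart c g) (at y)" for g :: "'m \<Rightarrow> 'b::real_normed_vector"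
    by (simp add: differential_def Let_def c_def y_def)
  have ap: "F y = \<Phi> p" "Nc y = N p"
    unfolding F_def Nc_def y_def by (rule in_chart_apply[OF M c])+
  have shape: "shape_operator \<A> \<Phi> N p = lh.shape y"
    by (rule ext) (simp add: shape_operator_def lh.shape_def ap diff flip: F_def Nc_def)
  have Cy: "C_fun N p = pf.C y" by (simp add: C_fun_def pf.C_def ap)
  have "gauss_kronecker \<A> \<Phi> N p = 0 \<longleftrightarrow> (\<exists>v. v \<noteq> 0 \<and> lh.eigen y 0 v)"
    unfolding gauss_kronecker_def shape by (rule lh.det_shape[OF y])
  also have "\<dots> \<longleftrightarrow> 0 \<in> principal_curvatures \<A> \<Phi> N p"
    unfolding principal_curvatures_def shape by (simp only: mem_Collect_eq lh.shape_eigen[OF y])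
  also have "\<dots> \<longleftrightarrow> (\<exists>l. k l = 0)" using pc p by (simp add: image_iff eq_commute[of 0])
  finally show "gauss_kronecker \<A> \<Phi> N p = 0 \<longleftrightarrow> (\<exists>l. k l = 0)" .
  show "(C_fun N p)\<^sup>2 \<le> 1"
  proof -
    have "0 \<le> (\<Sum>m\<in>UNIV. (pf.x m y)\<^sup>2)" by (intro sum_nonneg) simp
    then show ?thesis using pf.P_unit[OF u(1)] unfolding Cy by linarith
  qed
  have "induced_metric c \<Phi> = pf.metric"
    by (rule ext) (simp add: induced_metric_def pf.metric_def pf.dF_def flip: F_def)
  then have "scalar_curvature \<A> \<Phi> p = scalar_curvature_coord pf.metric y"
    by (simp add: scalar_curvature_def Let_def c_def y_def)
  then show "scalar_curvature \<A> \<Phi> p = 2 + 2 * (k i * k j + k i * k l + k j * k l)" if "distinct [i, j, l]"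
    using pf.scalar_curvature_metric[OF u(1) that] by simp
  show "4 * (k i * k j) = - 3" if "distinct [i, j, l]" "k l = 0" "(C_fun N p)\<^sup>2 = 1"
    using pf.pole_product_abs[OF that(1,2) u(1)] that(3) unfolding Cy by simp
  show "C_fun N p = 0 \<and> (\<exists>i j l. distinct [i, j, l] \<and> k l = 0 \<and> 2 * (k i * k j) = - 1)"
    if crit: "critical_point \<A> (C_fun N) p" and C: "(C_fun N p)\<^sup>2 \<noteq> 1"
  proof -
    have "in_chart c (C_fun N) = pf.C"
      by (rule ext) (simp only: pf.C_def, simp add: in_chart_def C_fun_def Nc_def)
    then have al: "along (u l) pf.C y = 0" for l
      using crit by (simp add: critical_point_def diff along_def)
    have "(pf.C y)\<^sup>2 \<noteq> 1" using C unfolding Cy .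
    from pf.critical_point_values[OF u(1) this al]
    obtain i j l where "distinct [i, j, l]" "k l = 0" "pf.C y = 0" "2 * (k i * k j) = - 1" .
    then show ?thesis unfolding Cy by blast
  qed
qed

theorem theorem4:
  fixes M :: "'m topology"
    and \<A> :: "('m, 3) chart set"
    and \<Phi> N :: "'m \<Rightarrow> (real ^ 3) \<times> (real ^ 3)"
    and k1 k2 k3 :: real
  assumes "hypersurface M \<A> \<Phi>"
    and "orientable M \<A>"
    and "unit_normal_field M \<A> \<Phi> N"
    and "distinct [k1, k2, k3]"
    and "\<forall>p\<in>topspace M. principal_curvatures \<A> \<Phi> N p = {k1, k2, k3}"
  shows "((\<forall>p\<in>topspace M. 2 * scalar_curvature \<A> \<Phi> p \<noteq> 1) \<and>
          (\<forall>p\<in>topspace M. gauss_kronecker \<A> \<Phi> N p = 0)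
            \<longrightarrow> (\<forall>p\<in>topspace M. (C_fun N p)\<^sup>2 < 1))
       \<and> (\<forall>p0\<in>topspace M. critical_point \<A> (C_fun N) p0 \<longrightarrow>
            ((C_fun N p0)\<^sup>2 = 1 \<or> C_fun N p0 = 0) \<and>
            (C_fun N p0 = 0 \<longrightarrow>
               (\<forall>p\<in>topspace M. gauss_kronecker \<A> \<Phi> N p = 0 \<and> scalar_curvature \<A> \<Phi> p = 1)))"
proof -
  define k :: "3 \<Rightarrow> real" where "k = (\<lambda>i. if i = 1 then k1 else if i = 2 then k2 else k3)"
  have rk: "range k = {k1, k2, k3}"
    unfolding UNIV_3 by (auto simp: k_def)
  have "card (range k) = CARD(3)" using assms(4) unfolding rk by simp
  then have k: "inj k" by (intro eq_card_imp_inj_on) auto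
  have pc: "\<forall>p\<in>topspace M. principal_curvatures \<A> \<Phi> N p = range k"
    using assms(5) unfolding rk .
  note pt = hypersurface_point[OF assms(1,3) k pc]
  show ?thesis
  proof (intro conjI impI ballI)
    fix p assume h: "(\<forall>p\<in>topspace M. 2 * scalar_curvature \<A> \<Phi> p \<noteq> 1) \<and> (\<forall>p\<in>topspace M. gauss_kronecker \<A> \<Phi> N p = 0)"
      and p: "p \<in> topspace M"
    obtain l where l: "k l = 0" using pt(1)[OF p] h p by blast
    obtain i j where d: "distinct [i, j, l]" by (rule obtain_distinct_3)
    have "(C_fun N p)\<^sup>2 \<noteq> 1"
    proof
      assume "(C_fun N p)\<^sup>2 = 1"
      then have "4 * (k i * k j) = - 3" by (rule pt(4)[OF p d l])
      \<comment> \<open>Since \<open>k l = 0\<close>, the scalar curvature is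
        \<open>2 + 2 * (k i * k j)\<close>, here one half.\<close>
      then have "2 * scalar_curvature \<A> \<Phi> p = 1" using pt(3)[OF p d] l by simp
      then show False using h p by blast
    qed
    then show "(C_fun N p)\<^sup>2 < 1" using pt(2)[OF p] by simp
  next
    fix p0 assume p0: "p0 \<in> topspace M" "critical_point \<A> (C_fun N) p0"
    then show "(C_fun N p0)\<^sup>2 = 1 \<or> C_fun N p0 = 0" using pt(5) by blast
    fix p assume C: "C_fun N p0 = 0" and p: "p \<in> topspace M"
    \<comment> \<open>\<open>C = 0\<close> excludes the alternative that its square is 1. The
      relation obtained at \<open>p0\<close> concerns the constants \<open>k\<close> only, so it
      determines both curvatures at every \<open>p\<close>.\<close>
    obtain i j l where ijl: "distinct [i, j, l]" "k l = 0" "2 * (k i * k j) = - 1"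
      using pt(5)[OF p0] C by auto
    show "gauss_kronecker \<A> \<Phi> N p = 0" using pt(1)[OF p] ijl(2) by blast
    show "scalar_curvature \<A> \<Phi> p = 1" using pt(3)[OF p ijl(1)] ijl by simp
  qed
qed

end
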